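(* Let $1<p_0<\infty$ and let $\varphi:[1,\infty)\to(0,\infty)$ be non-decreasing. Let $f$ be a locally integrable function on $\mathbb{R}^n$ and $g$ a non-negative measurable function such that for every weight $w\in A_{p_0}$ and every cube $Q$ $$\frac{1}{|Q|}\int_Q|f-f_Q|\,dx\le\varphi([w]_{A_{p_0}})\,\ell(Q)\left(\frac{1}{w(Q)}\int_Q g^{p_0}\,w\,dx\right)^{1/p_0}.$$ Then for any $p$ with $1<p<p_0$, any $w\in A_p$ and any cube $Q$ $$\left(\frac{1}{w(Q)}\int_Q|f-f_Q|^p\,w\,dx\right)^{1/p}\le c\,\varphi\left(c_{p,p_0,n}\,[w]_{A_p}^{\frac{p_0-1}{p-1}}\right)\ell(Q)\left(\frac{1}{w(Q)}\int_Q g^p\,w\,dx\right)^{1/p},$$ where $c$ and $c_{p,p_0,n}$ are constants depending only on $p$, $p_0$ and the dimension $n$.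
   Context: Cubes are cubes in $\mathbb{R}^n$ with sides parallel to the coordinate axes, with side length $\ell(Q)$. A weight is a locally integrable non-negative function; $w(Q)=\int_Q w\,dx$; $f_Q=\frac{1}{|Q|}\int_Q f\,dx$. For $1<p<\infty$, $w\in A_p$ if $$[w]_{A_p}:=\sup_Q\left(\frac{1}{|Q|}\int_Q w\,dx\right)\left(\frac{1}{|Q|}\int_Q w^{1-p'}\,dx\right)^{p-1}<\infty,\qquad p'=\frac{p}{p-1}.$$ *)

theory Defs
  imports "HOL-Analysis.Analysis"
begin

text \<open>
  Powers of extended non-negative reals with real exponent, with the conventions of measure theory:
  \<open>0\<close> to a negative power is \<open>\<infinity>\<close> (whereas \<open>0 powr a = 0\<close> on the reals), and \<open>\<infinity>\<close> to a negative
  power is \<open>0\<close>.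
\<close>

definition ennpow :: "ennreal \<Rightarrow> real \<Rightarrow> ennreal" where
  "ennpow x a =
     (if a = 0 then 1
      else if x = \<infinity> then (if a > 0 then \<infinity> else 0)
      else if x = 0 then (if a > 0 then 0 else \<infinity>)
      else ennreal (enn2real x powr a))"

definition cube :: "real ^ 'n \<Rightarrow> real \<Rightarrow> (real ^ 'n) set" where
  "cube a l = cbox a (\<chi> i. a $ i + l)"

definition locally_integrable :: "(real ^ 'n \<Rightarrow> real) \<Rightarrow> bool" where
  "locally_integrable f \<longleftrightarrow> (\<forall>K. compact K \<longrightarrow> set_integrable lebesgue K f)"

definition weight :: "(real ^ 'n \<Rightarrow> real) \<Rightarrow> bool" where
  "weight w \<longleftrightarrow> locally_integrable w \<and> (\<forall>x. 0 \<le> w x)"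

definition wmeas :: "(real ^ 'n \<Rightarrow> real) \<Rightarrow> (real ^ 'n) set \<Rightarrow> ennreal" where
  "wmeas w Q = (\<integral>\<^sup>+x\<in>Q. ennreal (w x) \<partial>lebesgue)"

definition avg :: "(real ^ 'n \<Rightarrow> real) \<Rightarrow> (real ^ 'n) set \<Rightarrow> real" where
  "avg f Q = (LINT x:Q|lebesgue. f x) / measure lebesgue Q"

definition Ap_const :: "real \<Rightarrow> (real ^ 'n \<Rightarrow> real) \<Rightarrow> ennreal" where
  "Ap_const p w =
     (SUP (a, l) \<in> UNIV \<times> {0<..}.
        wmeas w (cube a l) / emeasure lebesgue (cube a l) *
        ennpow ((\<integral>\<^sup>+x\<in>cube a l. ennpow (ennreal (w x)) (1 - p / (p - 1)) \<partial>lebesgue)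
                  / emeasure lebesgue (cube a l)) (p - 1))"

text \<open>
  The a.e. vanishing weight is excluded explicitly: because \<open>0 * \<infinity> = 0\<close> in \<^typ>\<open>ennreal\<close>, its
  constant would come out as \<open>0\<close>, and the averages with respect to \<open>w(Q) = 0\<close> make no sense.
  For every other weight, a finite constant forces \<open>w > 0\<close> a.e.
\<close>

definition Ap :: "real \<Rightarrow> (real ^ 'n \<Rightarrow> real) set" where
  "Ap p = {w. weight w \<and> \<not> (AE x in lebesgue. w x = 0) \<and> Ap_const p w < \<infinity>}"

end

theory Submission
  imports Defs
begin

text \<open>
  Extrapolation: for \<open>w \<in> A\<^sub>p\<close>, the Rubio de Francia algorithm applied to \<open>g 1\<^sub>Q\<close> yields an
  \<open>A\<^sub>1\<close> majorant \<open>R\<close> whose constant is controlled by the norm of the maximal operator on \<open>L\<^sup>p(w)\<close>,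
  that is, by \<open>[w]\<^bsup>1/(p-1)\<^esup>\<close> (Buckley's bound). The weight \<open>w R\<^bsup>p-p\<^sub>0\<^esup>\<close> then lies in
  \<open>A\<^bsub>p\<^sub>0\<^esub>\<close> with constant at most \<open>C [w]\<^bsup>(p\<^sub>0-1)/(p-1)\<^esup>\<close>; inserting it into the hypothesis and applying
  Hoelder's inequality gives the \<open>L\<^sup>1\<close> oscillation estimate with \<open>p\<close> in place of \<open>p\<^sub>0\<close>.

  Self-improvement: the functional \<open>\<ell>(Q) (w(Q)\<^sup>-\<^sup>1 \<integral>\<^sub>Q g\<^sup>p w)\<^bsup>1/p\<^esup>\<close>, raised to the power \<open>p\<close> and
  multiplied by \<open>w(Q)\<close>, is additive over disjoint cubes up to the factor \<open>\<ell>(Q)\<^sup>p\<close>. In a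
  Calderon-Zygmund decomposition of \<open>\<bar>f - f\<^sub>Q\<bar>\<close> the stopping cubes have small side length, so
  the decomposition can be iterated with geometrically decreasing contributions, whatever the weight.
\<close>

text \<open>Two obstacles shape the details. The maximal inequality has to hold for the measures
  \<open>w dx\<close> and \<open>\<sigma> dx\<close> with a constant that ignores the weight. For
  cubes in arbitrary position such a constant depends on the measure, but for nested partitions it
  does not: there it is Doob's inequality. So everything is first done for dyadic partitions, and
  finitely many shifted grids carry it over to all cubes.

  In the second half nothing guarantees that \<open>\<bar>f - c\<bar> powr p * w\<close> is
  integrable, so a term containing the unknown integral cannot be absorbed. Instead the estimate is
  proved off an exceptional set whose Lebesgue measure halves in each generation while the constant
  stays fixed; the set disappears in the limit. The constant is stable because the triangle
  inequality costs 2^p at each generation and a cube with a quarter of the side pays 4^(-p).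

  \<open>\<phi>\<close> survives linearly because its argument depends on \<open>w\<close> alone:
  for fixed \<open>w\<close> the extrapolated estimate holds on all cubes with one and the same
  factor, and it is this factor that is iterated.\<close>

lemma ennpow_0_exp [simp]: "ennpow x 0 = 1"
  by (simp add: ennpow_def)

lemma ennpow_zero [simp]: "0 < a \<Longrightarrow> ennpow 0 a = 0"
  by (simp add: ennpow_def)

lemma ennpow_top [simp]: "0 < a \<Longrightarrow> ennpow top a = top"
  by (simp add: ennpow_def)

lemma ennpow_one [simp]: "ennpow 1 a = 1"
  by (simp add: ennpow_def)

lemma ennpow_ennreal: "0 < x \<Longrightarrow> ennpow (ennreal x) a = ennreal (x powr a)"
  by (simp add: ennpow_def ennreal_eq_0_iff)

lemma ennpow_ennreal': "0 \<le> x \<Longrightarrow> 0 < a \<Longrightarrow> ennpow (ennreal x) a = ennreal (x powr a)"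
  by (cases "x = 0") (auto simp: ennpow_ennreal)

lemma ennreal_cases3:
  obtains "x = (0::ennreal)" | r where "x = ennreal r" "0 < r" | "x = top"
  by (cases x) (auto simp: less_le)

lemma ennpow_eq_0_iff: "0 < a \<Longrightarrow> ennpow x a = 0 \<longleftrightarrow> x = 0"
  by (cases x rule: ennreal_cases3) (auto simp: ennpow_ennreal)

lemma ennpow_eq_top_iff: "0 < a \<Longrightarrow> ennpow x a = top \<longleftrightarrow> x = top"
  by (cases x rule: ennreal_cases3) (auto simp: ennpow_ennreal)

lemma ennpow_1 [simp]: "ennpow x 1 = x"
  by (cases x rule: ennreal_cases3) (auto simp: ennpow_ennreal)

lemma ennpow_ennpow: "ennpow (ennpow x a) b = ennpow x (a * b)"
proof (cases x rule: ennreal_cases3)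
  case (2 r)
  then show ?thesis by (simp add: ennpow_ennreal powr_powr)
qed (auto simp: ennpow_def mult_less_0_iff zero_less_mult_iff split: if_splits)

lemma ennpow_mono:
  assumes "0 \<le> a" "x \<le> y" shows "ennpow x a \<le> ennpow y a"
proof (cases "a = 0")
  case False
  with assms have a: "a > 0" by simp
  show ?thesis
    by (cases x rule: ennreal_cases3; cases y rule: ennreal_cases3)
       (use a assms in \<open>auto simp: ennpow_ennreal top_unique intro!: powr_mono2\<close>)
qed simp

lemma ennpow_antimono:
  assumes "a \<le> 0" "x \<le> y" shows "ennpow y a \<le> ennpow x a"
proof (cases "a = 0")
  case False
  with assms have a: "a < 0" by simp
  then have t: "ennpow 0 a = top" "ennpow top a = 0" by (simp_all add: ennpow_def)
  show ?thesis
    by (cases x rule: ennreal_cases3; cases y rule: ennreal_cases3)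
       (use a assms in \<open>auto simp: t ennpow_ennreal top_unique intro!: powr_mono2'\<close>)
qed simp

text \<open>The sign condition is essential: for \<open>a < 0\<close>, \<open>x = 0\<close>,
  \<open>y = top\<close> the left side is \<open>top\<close> while the right side is
  \<open>top * 0 = 0\<close>. For this reason the later computations with negative exponents pass to
  real representatives.\<close>

lemma ennpow_mult:
  assumes "0 \<le> a" shows "ennpow (x * y) a = ennpow x a * ennpow y a"
proof (cases "a = 0")
  case False
  with assms have a: "a > 0" by simp
  show ?thesis
    by (cases x rule: ennreal_cases3; cases y rule: ennreal_cases3)
       (use a in \<open>auto simp: ennpow_ennreal powr_mult ennreal_top_mult ennreal_mult_top
          simp flip: ennreal_mult\<close>)
qed simp

lemma ennpow_add:
  assumes "0 \<le> a" "0 \<le> b" shows "ennpow x (a + b) = ennpow x a * ennpow x b"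
proof (cases "a = 0 \<or> b = 0")
  case False
  with assms have "a > 0" "b > 0" by auto
  then show ?thesis
    by (cases x rule: ennreal_cases3) (auto simp: ennpow_ennreal powr_add simp flip: ennreal_mult)
qed auto

lemma ennpow_measurable [measurable]: "(\<lambda>x. ennpow x a) \<in> borel_measurable borel"
  unfolding ennpow_def by measurable

section \<open>Hoelder's inequality for extended non-negative functions\<close>

lemma ennreal_Young:
  fixes x y :: ennreal
  assumes "0 < \<theta>" "\<theta> < 1"
  shows "ennpow x \<theta> * ennpow y (1 - \<theta>) \<le> ennreal \<theta> * x + ennreal (1 - \<theta>) * y"
proof (cases x rule: ennreal_cases3)
  case xr: (2 r)
  show ?thesis
  proof (cases y rule: ennreal_cases3)
    case ys: (2 s)
    have "r powr \<theta> * s powr (1 - \<theta>) \<le> \<theta> * r + (1 - \<theta>) * s"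
      using Youngs_inequality_0[of \<theta> "1 - \<theta>" r s] assms xr ys by auto
    then have "ennreal (r powr \<theta> * s powr (1 - \<theta>)) \<le> ennreal (\<theta> * r + (1 - \<theta>) * s)"
      by (rule ennreal_leI)
    then show ?thesis using assms xr ys
      by (simp add: ennpow_ennreal ennreal_mult ennreal_plus)
  qed (use assms xr in \<open>auto simp: ennreal_mult_top\<close>)
qed (use assms in \<open>auto simp: ennreal_mult_top\<close>)

text \<open>Normalise both integrals to 1 and integrate Young's inequality. The degenerate cases are
  separate because of \<open>0 * top = 0\<close>: a vanishing factor makes the left side vanish, an
  infinite factor next to a non-zero one makes the right side infinite. The form with
  \<open>\<theta>\<close> serves the three later choices \<open>1 / p\<close>,
  \<open>(p - 1) / (p0 - 1)\<close> and \<open>p / p0\<close>.\<close>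

lemma nn_integral_Hoelder:
  assumes [measurable]: "u \<in> borel_measurable M" "v \<in> borel_measurable M" and \<theta>: "0 < \<theta>" "\<theta> < 1"
  shows "(\<integral>\<^sup>+x. ennpow (u x) \<theta> * ennpow (v x) (1 - \<theta>) \<partial>M)
    \<le> ennpow (\<integral>\<^sup>+x. u x \<partial>M) \<theta> * ennpow (\<integral>\<^sup>+x. v x \<partial>M) (1 - \<theta>)" (is "?L \<le> ennpow ?U \<theta> * ennpow ?V _")
proof -
  consider "?U = 0" | "?V = 0" | "?U = top" "?V \<noteq> 0" | "?V = top" "?U \<noteq> 0" | "0 < ?U" "?U < top" "0 < ?V" "?V < top"
    using less_top zero_less_iff_neq_zero by blast
  then show ?thesis
  proof cases
    case 1
    then have "AE x in M. u x = 0" by (subst (asm) nn_integral_0_iff_AE) auto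
    then have "?L = 0" using \<theta> by (subst nn_integral_0_iff_AE) auto
    then show ?thesis by simp
  next
    case 2
    then have "AE x in M. v x = 0" by (subst (asm) nn_integral_0_iff_AE) auto
    then have "?L = 0" using \<theta> by (subst nn_integral_0_iff_AE) auto
    then show ?thesis by simp
  next
    case 3
    then show ?thesis using \<theta> by (simp add: ennreal_top_mult ennpow_eq_0_iff)
  next
    case 4
    then show ?thesis using \<theta> by (simp add: ennreal_mult_top ennpow_eq_0_iff)
  next
    case 5
    have "?L \<le> (\<integral>\<^sup>+x. (ennreal \<theta> * (u x / ?U) + ennreal (1 - \<theta>) * (v x / ?V)) * (ennpow ?U \<theta> * ennpow ?V (1 - \<theta>)) \<partial>M)"
    proof (rule nn_integral_mono)
      fix x
      have "ennpow (u x) \<theta> * ennpow (v x) (1 - \<theta>)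
          = ennpow (u x / ?U * ?U) \<theta> * ennpow (v x / ?V * ?V) (1 - \<theta>)"
        using 5 by (simp add: ennreal_divide_times ennreal_divide_self)
      also have "\<dots> = ennpow (u x / ?U) \<theta> * ennpow (v x / ?V) (1 - \<theta>) * (ennpow ?U \<theta> * ennpow ?V (1 - \<theta>))"
        using \<theta> by (simp add: ennpow_mult mult_ac)
      also have "\<dots> \<le> (ennreal \<theta> * (u x / ?U) + ennreal (1 - \<theta>) * (v x / ?V)) * (ennpow ?U \<theta> * ennpow ?V (1 - \<theta>))"
        by (intro mult_right_mono ennreal_Young \<theta>) auto
      finally show "ennpow (u x) \<theta> * ennpow (v x) (1 - \<theta>) \<le> \<dots>" .
    qed
    also have "\<dots> = (ennreal \<theta> * (?U / ?U) + ennreal (1 - \<theta>) * (?V / ?V)) * (ennpow ?U \<theta> * ennpow ?V (1 - \<theta>))"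
      by (simp add: nn_integral_multc nn_integral_add nn_integral_cmult nn_integral_divide)
    also have "\<dots> = ennpow ?U \<theta> * ennpow ?V (1 - \<theta>)"
      using 5 \<theta> by (simp add: ennreal_plus[symmetric] del: ennreal_plus)
    finally show ?thesis .
  qed
qed

subsection \<open>Maximal functions of partition filtrations\<close>

text \<open>A partition is encoded by labels: \<open>\<pi> k\<close> sends a point to the name of
  its cell at level \<open>k\<close>, and larger \<open>k\<close> means finer cells. With labels in
  a countable type, measurability and countable sums over cells come from fibres of a measurable
  map, and the same atoms serve every density over \<open>M\<close>.\<close>

definition atom :: "'a measure \<Rightarrow> (int \<Rightarrow> 'a \<Rightarrow> 'i) \<Rightarrow> int \<Rightarrow> 'a \<Rightarrow> 'a set" where
  "atom M \<pi> k x = {y \<in> space M. \<pi> k y = \<pi> k x}"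

definition atom_mean :: "'a measure \<Rightarrow> (int \<Rightarrow> 'a \<Rightarrow> 'i) \<Rightarrow> int \<Rightarrow> ('a \<Rightarrow> ennreal) \<Rightarrow> 'a \<Rightarrow> ennreal" where
  "atom_mean M \<pi> k f x = (\<integral>\<^sup>+y\<in>atom M \<pi> k x. f y \<partial>M) / emeasure M (atom M \<pi> k x)"

definition doob_max :: "'a measure \<Rightarrow> (int \<Rightarrow> 'a \<Rightarrow> 'i) \<Rightarrow> ('a \<Rightarrow> ennreal) \<Rightarrow> 'a \<Rightarrow> ennreal" where
  "doob_max M \<pi> f x = (SUP k. atom_mean M \<pi> k f x)"

lemma atom_density [simp]: "atom (density M w) \<pi> = atom M \<pi>"
  by (simp add: atom_def fun_eq_iff)

lemma ennreal_mult_le_of_less_divide: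
  assumes "t < a / (b::ennreal)" shows "t * b \<le> a"
proof (cases "b = 0 \<or> b = top")
  case True
  then show ?thesis
    using assms by (auto simp: divide_ennreal_def)
next
  case False
  have "t * b \<le> a / b * b"
    using assms by (intro mult_right_mono) auto
  also have "\<dots> = a"
    using False by (simp add: ennreal_divide_times less_top)
  finally show ?thesis .
qed

lemma ennreal_divide_self_le_1: "b / b \<le> (1::ennreal)"
  by (cases b rule: ennreal_cases3) (auto simp: divide_ennreal)

locale partition_filtration =
  fixes M :: "'a measure" and \<pi> :: "int \<Rightarrow> 'a \<Rightarrow> 'i::countable"
  assumes meas [measurable]: "\<And>k. \<pi> k \<in> measurable M (count_space UNIV)"
    and nested: "\<And>k x y. \<pi> (k + 1) x = \<pi> (k + 1) y \<Longrightarrow> \<pi> k x = \<pi> k y"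
begin

lemma density: "partition_filtration (density M w) \<pi>"
  by unfold_locales (auto simp: meas intro: nested)

lemma nested_le:
  assumes "j \<le> k" "\<pi> k x = \<pi> k y" shows "\<pi> j x = \<pi> j y"
  using assms
proof (induction k rule: int_ge_induct)
  case (step k)
  then show ?case using nested[of k x y] by simp
qed

lemma atom_sets [measurable]: "atom M \<pi> k x \<in> sets M"
  unfolding atom_def by measurable

lemma sets_saturated:
  assumes "B \<subseteq> space M" "\<And>x. x \<in> B \<Longrightarrow> atom M \<pi> k x \<subseteq> B"
  shows "B \<in> sets M"
proof -
  have "B = \<pi> k -` (\<pi> k ` B) \<inter> space M"
    using assms by (fastforce simp: atom_def)
  also have "\<dots> \<in> sets M"
    using meas by (rule measurable_sets) auto
  finally show ?thesis .
qed

text \<open>A union of atoms of one level is a disjoint union over countably many labels, so a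
  comparison atom by atom adds up. This is the summation step of both stopping arguments
  below.\<close>

lemma emeasure_saturated_le:
  assumes \<mu>: "sets \<mu> = sets M" and \<nu>: "sets \<nu> = sets M"
    and B: "B \<subseteq> space M" "\<And>x. x \<in> B \<Longrightarrow> atom M \<pi> k x \<subseteq> B"
    and le: "\<And>x. x \<in> B \<Longrightarrow> emeasure \<mu> (atom M \<pi> k x) \<le> emeasure \<nu> (atom M \<pi> k x)"
  shows "emeasure \<mu> B \<le> emeasure \<nu> B"
proof -
  define X where "X i = {y \<in> space M. \<pi> k y = i}" for i
  have X: "X i \<in> sets M" for i unfolding X_def by measurable
  have eq: "B = (\<Union>i\<in>\<pi> k ` B. X i)"
    using B by (fastforce simp: atom_def X_def)
  have dis: "disjoint_family_on X (\<pi> k ` B)"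
    by (auto simp: disjoint_family_on_def X_def)
  have "emeasure \<mu> B = (\<integral>\<^sup>+i. emeasure \<mu> (X i) \<partial>count_space (\<pi> k ` B))"
    by (subst eq, rule emeasure_UN_countable) (auto simp: X \<mu> dis)
  also have "\<dots> \<le> (\<integral>\<^sup>+i. emeasure \<nu> (X i) \<partial>count_space (\<pi> k ` B))"
    by (intro nn_integral_mono) (use le in \<open>auto simp: atom_def X_def\<close>)
  also have "\<dots> = emeasure \<nu> B"
    by (subst (2) eq, rule emeasure_UN_countable[symmetric]) (auto simp: X \<nu> dis)
  finally show ?thesis .
qed

lemma atom_mean_cong: "y \<in> atom M \<pi> k x \<Longrightarrow> atom_mean M \<pi> k f y = atom_mean M \<pi> k f x"
  by (simp add: atom_mean_def atom_def)

lemma atom_mean_measurable [measurable]: "atom_mean M \<pi> k f \<in> borel_measurable M"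
proof -
  have "atom_mean M \<pi> k f = (\<lambda>x. (\<lambda>i. (\<integral>\<^sup>+y\<in>{y \<in> space M. \<pi> k y = i}. f y \<partial>M)
      / emeasure M {y \<in> space M. \<pi> k y = i}) (\<pi> k x))"
    by (simp add: atom_mean_def atom_def fun_eq_iff)
  also have "\<dots> \<in> borel_measurable M"
    by (rule measurable_compose[OF meas]) simp
  finally show ?thesis .
qed

lemma doob_max_measurable [measurable]: "doob_max M \<pi> f \<in> borel_measurable M"
  unfolding doob_max_def[abs_def] by measurable

lemma atom_mean_le_doob_max: "atom_mean M \<pi> k f x \<le> doob_max M \<pi> f x"
  unfolding doob_max_def by (rule SUP_upper) auto

text \<open>Stopping time argument. Since levels range over all integers there need not be a first
  level at which the mean exceeds \<open>t\<close>; so \<open>A n\<close> starts at level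
  \<open>- n\<close>, and \<open>n\<close> tends to infinity at the end. The set where the first
  passage happens at a given level is a union of atoms of that level, because means at coarser
  levels are constant on finer atoms, and on each such atom the mean of \<open>f\<close> exceeds
  \<open>t\<close>.\<close>

lemma doob_max_weak_type:
  assumes [measurable]: "f \<in> borel_measurable M"
  shows "t * emeasure M {x \<in> space M. t < doob_max M \<pi> f x}
    \<le> (\<integral>\<^sup>+x\<in>{x \<in> space M. t < doob_max M \<pi> f x}. f x \<partial>M)"
proof -
  define E where "E k = {x \<in> space M. t < atom_mean M \<pi> k f x}" for k
  have E [measurable]: "E k \<in> sets M" for k unfolding E_def by measurable
  define A where "A n j = E (int j - int n)" for n j :: nat
  define G where "G n = (\<Union>j. A n j)" for n
  define \<mu> where "\<mu> = density M (\<lambda>_. t)"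
  define \<nu> where "\<nu> = density M f"
  have sets: "sets \<mu> = sets M" "sets \<nu> = sets M" by (auto simp: \<mu>_def \<nu>_def)
  have GE: "{x \<in> space M. t < doob_max M \<pi> f x} = (\<Union>n. G n)"
  proof -
    have "x \<in> (\<Union>n. G n)" if "x \<in> E k" for x k
    proof -
      obtain n j where "k = int j - int n" using int_diff_cases by blast
      then have "x \<in> A n j" using that unfolding A_def by blast
      then show ?thesis by (auto simp: G_def)
    qed
    then show ?thesis
      by (auto simp: doob_max_def less_SUP_iff E_def G_def A_def)
  qed
  have step: "emeasure \<mu> (G n) \<le> emeasure \<nu> (G n)" for n
  proof -
    have rng: "range (A n) \<subseteq> sets M" by (auto simp: A_def)
    have "emeasure \<mu> (disjointed (A n) j) \<le> emeasure \<nu> (disjointed (A n) j)" for j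
    proof (rule emeasure_saturated_le[OF sets])
      have sat: "y \<in> A n i \<longleftrightarrow> x \<in> A n i"
        if "y \<in> atom M \<pi> (int j - int n) x" "i \<le> j" "x \<in> space M" for x y i
      proof -
        have "\<pi> (int i - int n) y = \<pi> (int i - int n) x"
          by (rule nested_le[of _ "int j - int n"]) (use that in \<open>auto simp: atom_def\<close>)
        then have "y \<in> atom M \<pi> (int i - int n) x"
          using that by (auto simp: atom_def)
        then show ?thesis
          using that(3) unfolding A_def E_def by (simp add: atom_mean_cong) (simp add: atom_def)
      qed
      show sub: "disjointed (A n) j \<subseteq> space M"
        by (auto simp: disjointed_def A_def E_def)
      show "atom M \<pi> (int j - int n) x \<subseteq> disjointed (A n) j" if "x \<in> disjointed (A n) j" for x
      proof
        fix y assume y: "y \<in> atom M \<pi> (int j - int n) x"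
        have "x \<in> space M" using that sub by blast
        then have "y \<in> A n i \<longleftrightarrow> x \<in> A n i" if "i \<le> j" for i
          using sat[OF y] that by blast
        then show "y \<in> disjointed (A n) j"
          using that by (auto simp: disjointed_def)
      qed
      show "emeasure \<mu> (atom M \<pi> (int j - int n) x) \<le> emeasure \<nu> (atom M \<pi> (int j - int n) x)"
        if "x \<in> disjointed (A n) j" for x
      proof -
        have "t < atom_mean M \<pi> (int j - int n) f x"
          using that by (auto simp: disjointed_def A_def E_def)
        then show ?thesis
          unfolding atom_mean_def \<mu>_def \<nu>_def
          by (auto simp: emeasure_density nn_integral_cmult_indicator dest: ennreal_mult_le_of_less_divide)
      qed
    qed
    then have "(\<Sum>j. emeasure \<mu> (disjointed (A n) j)) \<le> (\<Sum>j. emeasure \<nu> (disjointed (A n) j))"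
      by (intro suminf_le) auto
    moreover have "(\<Sum>j. emeasure m (disjointed (A n) j)) = emeasure m (G n)" if "sets m = sets M" for m
      using suminf_emeasure[of "disjointed (A n)" m] sets.range_disjointed_sets[OF rng] that
      by (simp add: UN_disjointed_eq disjoint_family_disjointed G_def)
    ultimately show ?thesis by (simp add: sets)
  qed
  have inc: "incseq G"
  proof (rule incseq_SucI)
    fix n
    have "A n j \<subseteq> A (Suc n) (Suc j)" for j by (simp add: A_def)
    then show "G n \<subseteq> G (Suc n)" by (force simp: G_def)
  qed
  have Gm: "range G \<subseteq> sets M" by (auto simp: G_def A_def)
  have "emeasure \<mu> (\<Union>n. G n) \<le> emeasure \<nu> (\<Union>n. G n)"
    using SUP_emeasure_incseq[of G \<mu>] SUP_emeasure_incseq[of G \<nu>] Gm inc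
      SUP_mono'[of "\<lambda>n. emeasure \<mu> (G n)" "\<lambda>n. emeasure \<nu> (G n)" UNIV, OF step] by (simp add: sets)
  moreover have "(\<Union>n. G n) \<in> sets M" using Gm by auto
  ultimately show ?thesis
    unfolding GE \<mu>_def \<nu>_def by (simp add: emeasure_density nn_integral_cmult_indicator)
qed

text \<open>The part of \<open>f\<close> below \<open>t\<close> contributes at most \<open>t\<close>
  to every mean, so a mean above \<open>2 * t\<close> needs mean above \<open>t\<close> from the
  part \<open>h\<close> of \<open>f\<close> above \<open>t\<close>. This form of the weak bound can
  be summed over heights in the strong-type estimate.\<close>

lemma doob_max_weak_type_truncated:
  assumes [measurable]: "f \<in> borel_measurable M"
  shows "t * emeasure M {x \<in> space M. 2 * t < doob_max M \<pi> f x}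
    \<le> (\<integral>\<^sup>+x. f x * indicator {x. t < f x} x \<partial>M)"
proof (cases "t = top")
  case False
  define h where "h x = f x * indicator {x \<in> space M. t < f x} x" for x
  have [measurable]: "h \<in> borel_measurable M" unfolding h_def by measurable
  have mean: "atom_mean M \<pi> k f x \<le> t + atom_mean M \<pi> k h x" for k x
  proof -
    have "(\<integral>\<^sup>+y\<in>atom M \<pi> k x. f y \<partial>M)
        \<le> (\<integral>\<^sup>+y. t * indicator (atom M \<pi> k x) y + h y * indicator (atom M \<pi> k x) y \<partial>M)"
      by (intro nn_integral_mono) (auto simp: h_def indicator_def not_less split: if_splits)
    also have "\<dots> = t * emeasure M (atom M \<pi> k x) + (\<integral>\<^sup>+y\<in>atom M \<pi> k x. h y \<partial>M)"
      by (subst nn_integral_add) (auto simp: nn_integral_cmult_indicator)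
    finally have "atom_mean M \<pi> k f x \<le> (t * emeasure M (atom M \<pi> k x)
        + (\<integral>\<^sup>+y\<in>atom M \<pi> k x. h y \<partial>M)) / emeasure M (atom M \<pi> k x)"
      unfolding atom_mean_def by (rule divide_right_mono_ennreal)
    also have "\<dots> = t * (emeasure M (atom M \<pi> k x) / emeasure M (atom M \<pi> k x)) + atom_mean M \<pi> k h x"
      unfolding atom_mean_def by (simp add: add_divide_distrib_ennreal ennreal_times_divide)
    \<comment> \<open>Only an inequality: for an atom of measure \<open>0\<close> or
      \<open>top\<close> the quotient is \<open>0\<close>, not 1.\<close>
    also have "\<dots> \<le> t * 1 + atom_mean M \<pi> k h x"
      by (intro add_mono mult_left_mono order_refl ennreal_divide_self_le_1) auto
    finally show ?thesis by simp
  qed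
  have "doob_max M \<pi> f x \<le> t + doob_max M \<pi> h x" for x
    unfolding doob_max_def[of _ _ f]
    by (rule SUP_least) (meson mean add_left_mono atom_mean_le_doob_max order_trans)
  then have "{x \<in> space M. 2 * t < doob_max M \<pi> f x} \<subseteq> {x \<in> space M. t < doob_max M \<pi> h x}"
    using False by (auto simp: mult_2) (metis ennreal_add_left_cancel_less order_less_le_trans)
  then have "t * emeasure M {x \<in> space M. 2 * t < doob_max M \<pi> f x}
      \<le> t * emeasure M {x \<in> space M. t < doob_max M \<pi> h x}"
    by (intro mult_left_mono emeasure_mono) auto
  also have "\<dots> \<le> (\<integral>\<^sup>+x\<in>{x \<in> space M. t < doob_max M \<pi> h x}. h x \<partial>M)"
    by (rule doob_max_weak_type) measurable
  also have "\<dots> \<le> (\<integral>\<^sup>+x. f x * indicator {x. t < f x} x \<partial>M)"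
    by (intro nn_integral_mono) (auto simp: h_def indicator_def)
  finally show ?thesis .
qed simp

end

section \<open>Doob's strong-type inequality by summation over dyadic heights\<close>

definition doob_const :: "real \<Rightarrow> real" where
  "doob_const p = 4 powr p / (1 - 2 powr (1 - p))"

lemma two_powr_minus_less_one: "0 < q \<Longrightarrow> 2 powr (- q) < (1::real)"
  using powr_less_mono[of "- q" 0 "2::real"] by simp

lemma doob_const_pos: "1 < p \<Longrightarrow> 0 < doob_const p"
  unfolding doob_const_def by (intro divide_pos_pos) (auto simp: powr_less_one)

text \<open>A discrete layer-cake bound: a single height comparable to \<open>y\<close> already
  carries \<open>y\<close> to the power \<open>p\<close>; for \<open>y = top\<close> all heights
  occur and the terms are unbounded.\<close>

lemma ennpow_le_dyadic_sum:
  assumes "0 < p"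
  shows "ennpow y p \<le> (\<integral>\<^sup>+k. ennreal (4 powr p * 2 powr (real_of_int k * p)) *
    indicator {k. 2 * ennreal (2 powr real_of_int k) < y} k \<partial>count_space (UNIV :: int set))" (is "_ \<le> (\<integral>\<^sup>+k. ?F k \<partial>_)")
proof -
  have single: "?F k \<le> (\<integral>\<^sup>+k. ?F k \<partial>count_space (UNIV :: int set))" for k
    using nn_integral_ge_point[of k UNIV ?F] by simp
  show ?thesis
  proof (cases y rule: ennreal_cases3)
    case (2 r)
    \<comment> \<open>The largest integer with \<open>2 * 2 powr k < r\<close>, hence
      \<open>r \<le> 4 * 2 powr k\<close>. The ceiling keeps the first inequality strict when
      \<open>r\<close> is a power of two.\<close>
    define k where "k = \<lceil>log 2 r\<rceil> - 2"
    have k: "real_of_int k + 1 < log 2 r" "log 2 r \<le> real_of_int k + 2"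
      unfolding k_def by linarith+
    have a: "2 * 2 powr k < r"
      using k(1) 2(2) by (simp add: less_log_iff powr_add mult.commute)
    have b: "r \<le> 4 * 2 powr k"
      using k(2) 2(2) by (simp add: log_le_iff powr_add mult.commute)
    have "r powr p \<le> (4 * 2 powr real_of_int k) powr p"
      using b 2 assms by (intro powr_mono2) auto
    also have "\<dots> = 4 powr p * 2 powr (real_of_int k * p)"
      by (simp add: powr_mult powr_powr)
    finally have "ennpow y p \<le> ?F k"
      using a 2 assms by (auto simp: ennpow_ennreal ennreal_leI simp flip: ennreal_numeral ennreal_mult
          simp: ennreal_less_iff)
    then show ?thesis using single order_trans by blast
  next
    case 3
    have "of_nat n \<le> (\<integral>\<^sup>+k. ?F k \<partial>count_space (UNIV :: int set))" for n :: nat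
    proof -
      define k where "k = \<lceil>log 2 (Suc n) / p\<rceil>"
      have "log 2 (Suc n) \<le> k * p"
        using assms unfolding k_def by (subst pos_divide_le_eq[symmetric]) (auto simp: le_of_int_ceiling)
      then have "real (Suc n) \<le> 2 powr (real_of_int k * p)" by (simp add: log_le_iff)
      also have "\<dots> \<le> 4 powr p * 2 powr (real_of_int k * p)"
        using mult_right_mono[of 1 "4 powr p" "2 powr (real_of_int k * p)"] assms
        by (simp add: ge_one_powr_ge_zero)
      finally have "real n \<le> 4 powr p * 2 powr (real_of_int k * p)" by simp
      then have "ennreal (real n) \<le> ?F k"
        using 3 by (auto intro!: ennreal_leI simp: ennreal_mult_less_top)
      then show ?thesis using single[of k] by (simp add: ennreal_of_nat_eq_real_of_nat)
    qed
    then have "(\<integral>\<^sup>+k. ?F k \<partial>count_space (UNIV :: int set)) = top"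
      by (meson ennreal_Ex_less_of_nat leD top.not_eq_extremum)
    then show ?thesis by simp
  qed (use assms in simp)
qed

lemma dyadic_sum_le_ennpow:
  assumes "0 < q"
  shows "(\<integral>\<^sup>+k. ennreal (2 powr (real_of_int k * q)) * indicator {k. ennreal (2 powr real_of_int k) < y} k \<partial>count_space (UNIV :: int set))
    \<le> ennreal (1 / (1 - 2 powr (- q))) * ennpow y q"
proof (cases y rule: ennreal_cases3)
  case (2 r)
  \<comment> \<open>The largest admissible height. Summing downwards from it gives a geometric
    series of ratio \<open>2 powr (- q)\<close>, which is where the constant comes from.\<close>
  define m where "m = \<lceil>log 2 r\<rceil> - 1"
  have m: "real_of_int m < log 2 r" unfolding m_def by linarith
  have km: "k \<le> m \<longleftrightarrow> ennreal (2 powr real_of_int k) < y" for k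
  proof -
    have "k \<le> m \<longleftrightarrow> real_of_int k < log 2 r" unfolding m_def by linarith
    also have "\<dots> \<longleftrightarrow> 2 powr k < r" using 2 by (simp add: less_log_iff)
    finally show ?thesis using 2 by (simp add: ennreal_less_iff)
  qed
  have "(\<integral>\<^sup>+k. ennreal (2 powr (real_of_int k * q)) * indicator {k. ennreal (2 powr real_of_int k) < y} k \<partial>count_space (UNIV :: int set))
      = (\<integral>\<^sup>+k. ennreal (2 powr (real_of_int k * q)) * indicator {..m} k \<partial>count_space (UNIV :: int set))"
    by (intro nn_integral_cong) (auto simp: km indicator_def)
  also have "\<dots> = (\<integral>\<^sup>+k. ennreal (2 powr (real_of_int k * q)) \<partial>count_space {..m})"
    by (simp add: nn_integral_count_space_indicator)
  also have "\<dots> = (\<integral>\<^sup>+j. ennreal (2 powr (real_of_int (m - int j) * q)) \<partial>count_space (UNIV :: nat set))"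
  proof (rule nn_integral_bij_count_space[symmetric])
    show "bij_betw (\<lambda>j::nat. m - int j) UNIV {..m}"
      by (rule bij_betwI[where g = "\<lambda>k. nat (m - k)"]) auto
  qed
  also have "\<dots> = (\<Sum>j. ennreal (2 powr (m * q) * (2 powr (- q)) ^ j))"
  proof -
    have "2 powr (real_of_int (m - int j) * q) = 2 powr (m * q) * (2 powr (- q)) ^ j" for j
    proof -
      have "real_of_int (m - int j) * q = m * q + - q * real j" by (simp add: algebra_simps)
      moreover have "(2 powr (- q)) ^ j = 2 powr (- q * real j)"
        using powr_realpow[of "2 powr (- q)" j] powr_powr[of 2 "- q" "real j"] by simp
      ultimately show ?thesis by (simp only: powr_add)
    qed
    then show ?thesis by (simp add: nn_integral_count_space_nat)
  qed
  also have "\<dots> = ennreal (2 powr (m * q) * (1 / (1 - 2 powr (- q))))"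
    using assms by (intro suminf_ennreal_eq sums_mult geometric_sums) (auto simp: powr_less_one)
  also have "\<dots> \<le> ennreal (r powr q * (1 / (1 - 2 powr (- q))))"
  proof (intro ennreal_leI mult_right_mono)
    have "2 powr m \<le> r" using m 2 by (simp add: less_log_iff less_imp_le)
    then have "(2 powr m) powr q \<le> r powr q" using assms by (intro powr_mono2) auto
    then show "2 powr (m * q) \<le> r powr q" by (simp add: powr_powr)
  qed (use assms in \<open>auto simp: powr_le_one_le powr_less_one less_imp_le\<close>)
  also have "\<dots> = ennreal (1 / (1 - 2 powr (- q))) * ennpow y q"
    using 2 assms by (subst mult.commute, subst ennreal_mult)
       (auto simp: ennpow_ennreal powr_less_one less_imp_le)
  finally show ?thesis .
next
  case 3
  then show ?thesis
    using assms two_powr_minus_less_one[of q] by (simp add: ennreal_mult_top ennreal_eq_0_iff not_le)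
qed simp

context partition_filtration
begin

text \<open>Marcinkiewicz interpolation with heights 2^k: insert the truncated weak bound at each
  height and interchange sum and integral. The factor \<open>4 powr p\<close> of
  \<open>doob_const\<close> comes from the layer-cake bound, the other factor from the geometric
  series with exponent \<open>p - 1\<close>, the remaining power being supplied by the
  \<open>f\<close> in the weak bound. The constant sees neither the measure nor the
  partition.\<close>

lemma doob_max_strong_type:
  assumes [measurable]: "f \<in> borel_measurable M" and p: "1 < p"
  shows "(\<integral>\<^sup>+x. ennpow (doob_max M \<pi> f x) p \<partial>M)
    \<le> ennreal (doob_const p) * (\<integral>\<^sup>+x. ennpow (f x) p \<partial>M)"
proof -
  let ?C = "count_space (UNIV :: int set)"
  have "(\<integral>\<^sup>+x. ennpow (doob_max M \<pi> f x) p \<partial>M)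
      \<le> (\<integral>\<^sup>+x. \<integral>\<^sup>+k. ennreal (4 powr p * 2 powr (real_of_int k * p)) *
           indicator {k. 2 * ennreal (2 powr real_of_int k) < doob_max M \<pi> f x} k \<partial>?C \<partial>M)"
    using p by (intro nn_integral_mono ennpow_le_dyadic_sum) auto
  also have "\<dots> = (\<integral>\<^sup>+x. \<integral>\<^sup>+k. ennreal (4 powr p * 2 powr (real_of_int k * p)) *
           indicator {x \<in> space M. 2 * ennreal (2 powr real_of_int k) < doob_max M \<pi> f x} x \<partial>?C \<partial>M)"
    by (intro nn_integral_cong) (auto simp: indicator_def)
  also have "\<dots> = (\<integral>\<^sup>+k. \<integral>\<^sup>+x. ennreal (4 powr p * 2 powr (real_of_int k * p)) *
           indicator {x \<in> space M. 2 * ennreal (2 powr real_of_int k) < doob_max M \<pi> f x} x \<partial>M \<partial>?C)"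
    by (intro nn_integral_count_space_nn_integral) auto
  also have "\<dots> = (\<integral>\<^sup>+k. ennreal (4 powr p * 2 powr (real_of_int k * (p - 1))) *
           (ennreal (2 powr real_of_int k) * emeasure M {x \<in> space M. 2 * ennreal (2 powr real_of_int k) < doob_max M \<pi> f x}) \<partial>?C)"
  proof (intro nn_integral_cong)
    fix k
    have "real_of_int k * p = real_of_int k * (p - 1) + real_of_int k" by (simp add: algebra_simps)
    then have "ennreal (4 powr p * 2 powr (real_of_int k * p))
        = ennreal (4 powr p * 2 powr (real_of_int k * (p - 1))) * ennreal (2 powr k)"
      by (simp add: powr_add mult.assoc ennreal_mult)
    then show "(\<integral>\<^sup>+x. ennreal (4 powr p * 2 powr (real_of_int k * p)) *
           indicator {x \<in> space M. 2 * ennreal (2 powr real_of_int k) < doob_max M \<pi> f x} x \<partial>M)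
      = ennreal (4 powr p * 2 powr (real_of_int k * (p - 1))) * (ennreal (2 powr k) *
         emeasure M {x \<in> space M. 2 * ennreal (2 powr real_of_int k) < doob_max M \<pi> f x})"
      by (subst nn_integral_cmult_indicator) (auto simp: mult.assoc)
  qed
  also have "\<dots> \<le> (\<integral>\<^sup>+k. ennreal (4 powr p * 2 powr (real_of_int k * (p - 1))) *
           (\<integral>\<^sup>+x. f x * indicator {x. ennreal (2 powr real_of_int k) < f x} x \<partial>M) \<partial>?C)"
    by (intro nn_integral_mono mult_left_mono doob_max_weak_type_truncated) auto
  also have "\<dots> = (\<integral>\<^sup>+k. \<integral>\<^sup>+x. ennreal (4 powr p * 2 powr (real_of_int k * (p - 1))) *
           (f x * indicator {x. ennreal (2 powr real_of_int k) < f x} x) \<partial>M \<partial>?C)"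
    by (intro nn_integral_cong nn_integral_cmult[symmetric]) (measurable)
  also have "\<dots> = (\<integral>\<^sup>+x. \<integral>\<^sup>+k. ennreal (4 powr p * 2 powr (real_of_int k * (p - 1))) *
           (f x * indicator {x. ennreal (2 powr real_of_int k) < f x} x) \<partial>?C \<partial>M)"
    by (intro nn_integral_count_space_nn_integral[symmetric]) (auto, measurable)
  also have "\<dots> = (\<integral>\<^sup>+x. ennreal (4 powr p) * f x * (\<integral>\<^sup>+k. ennreal (2 powr (real_of_int k * (p - 1))) *
           indicator {k. ennreal (2 powr real_of_int k) < f x} k \<partial>?C) \<partial>M)"
    by (intro nn_integral_cong)
       (subst nn_integral_cmult[symmetric], auto intro!: nn_integral_cong simp: ennreal_mult indicator_def mult_ac)
  also have "\<dots> \<le> (\<integral>\<^sup>+x. ennreal (4 powr p) * f x *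
       (ennreal (1 / (1 - 2 powr (- (p - 1)))) * ennpow (f x) (p - 1)) \<partial>M)"
    using p by (intro nn_integral_mono mult_left_mono dyadic_sum_le_ennpow) auto
  also have "\<dots> = (\<integral>\<^sup>+x. ennreal (doob_const p) * ennpow (f x) p \<partial>M)"
  proof (intro nn_integral_cong)
    fix x
    have "0 < 1 - 2 powr (1 - p)" using p by (simp add: powr_less_one)
    then have "ennreal (doob_const p) = ennreal (4 powr p) * ennreal (1 / (1 - 2 powr (- (p - 1))))"
      by (simp add: doob_const_def ennreal_mult[symmetric])
    moreover have "ennpow (f x) p = f x * ennpow (f x) (p - 1)"
      using ennpow_add[of 1 "p - 1" "f x"] p by simp
    ultimately show "ennreal (4 powr p) * f x * (ennreal (1 / (1 - 2 powr (- (p - 1)))) * ennpow (f x) (p - 1))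
        = ennreal (doob_const p) * ennpow (f x) p"
      by (simp add: mult_ac)
  qed
  also have "\<dots> = ennreal (doob_const p) * (\<integral>\<^sup>+x. ennpow (f x) p \<partial>M)"
    by (intro nn_integral_cmult) measurable
  finally show ?thesis .
qed

end

section \<open>Weighted bound for the maximal function of a filtration\<close>

lemma conjugate_exponent: "1 < p \<Longrightarrow> 1 - p / (p - 1) = - (1 / (p - 1))" for p :: real
  by (simp add: field_simps)

lemma AE_dual_weight:
  assumes p: "1 < p" and "AE x in M. 0 < w x \<and> w x < top"
  shows "AE x in M. 0 < ennpow (w x) (1 - p / (p - 1)) \<and> ennpow (w x) (1 - p / (p - 1)) < top"
  using assms(2)
proof eventually_elim
  case (elim x)
  then show ?case by (cases "w x" rule: ennreal_cases3) (auto simp: ennpow_ennreal)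
qed

context partition_filtration
begin

text \<open>
  Lerner's proof of the sharp weighted bound: the average of \<open>f\<close> over an atom is controlled by
  the composition of the maximal operators of the measures \<open>\<sigma>\<close> and \<open>w\<close>, both of which are bounded
  with constants independent of the weight.
\<close>

lemma doob_max_weighted:
  fixes w f :: "'a \<Rightarrow> ennreal" and p :: real
  defines "\<sigma> \<equiv> \<lambda>x. ennpow (w x) (1 - p / (p - 1))"
  assumes [measurable]: "w \<in> borel_measurable M" "f \<in> borel_measurable M" and p: "1 < p"
    and w: "AE x in M. 0 < w x \<and> w x < top"
    and fin: "\<And>k x. x \<in> space M \<Longrightarrow> emeasure M (atom M \<pi> k x) \<in> {0<..<top}"
      "\<And>k x. x \<in> space M \<Longrightarrow> (\<integral>\<^sup>+y\<in>atom M \<pi> k x. w y \<partial>M) \<in> {0<..<top}"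
      "\<And>k x. x \<in> space M \<Longrightarrow> (\<integral>\<^sup>+y\<in>atom M \<pi> k x. \<sigma> y \<partial>M) \<in> {0<..<top}"
    and A: "\<And>k x. x \<in> space M \<Longrightarrow>
      (\<integral>\<^sup>+y\<in>atom M \<pi> k x. w y \<partial>M) / emeasure M (atom M \<pi> k x) *
      ennpow ((\<integral>\<^sup>+y\<in>atom M \<pi> k x. \<sigma> y \<partial>M) / emeasure M (atom M \<pi> k x)) (p - 1) \<le> A"
  shows "(\<integral>\<^sup>+x. ennpow (doob_max M \<pi> f x) p * w x \<partial>M)
    \<le> ennreal (doob_const p * doob_const (p / (p - 1))) * ennpow A (p / (p - 1)) *
      (\<integral>\<^sup>+x. ennpow (f x) p * w x \<partial>M)"
proof -
  define q where "q = p / (p - 1)"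
  have q: "1 < q" using p by (simp add: q_def)
  have [measurable]: "\<sigma> \<in> borel_measurable M" unfolding \<sigma>_def by measurable
  define F where "F = doob_max (density M \<sigma>) \<pi> (\<lambda>x. f x / \<sigma> x)"
  define G where "G = doob_max (density M w) \<pi> (\<lambda>x. ennpow (F x) (p - 1) / w x)"
  interpret S: partition_filtration "density M \<sigma>" \<pi> by (rule density)
  interpret W: partition_filtration "density M w" \<pi> by (rule density)
  have [measurable]: "F \<in> borel_measurable M"
    using S.doob_max_measurable unfolding F_def by simp
  have [measurable]: "G \<in> borel_measurable M"
    using W.doob_max_measurable unfolding G_def by simp
  have \<sigma>: "AE x in M. 0 < \<sigma> x \<and> \<sigma> x < top"
    unfolding \<sigma>_def by (rule AE_dual_weight[OF p w])
  \<comment> \<open>On an atom write (I/m)^(p-1) as (W/m)(S/m)^(p-1) times (I/S)^(p-1) m/W. The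
    first product is at most \<open>A\<close>. In the second, I/S is the
    \<open>\<sigma>\<close>-mean of \<open>f / \<sigma>\<close>, hence at most \<open>F\<close> on
    the whole atom, so the second factor is at most a \<open>w\<close>-mean of
    \<open>ennpow (F y) (p - 1) / w y\<close>, that is, at most \<open>G\<close>.\<close>
  have pt: "doob_max M \<pi> f x \<le> ennpow (A * G x) (1 / (p - 1))" if x: "x \<in> space M" for x
    unfolding doob_max_def
  proof (rule SUP_least)
    fix k
    define D where "D = atom M \<pi> k x"
    have [measurable]: "D \<in> sets M" unfolding D_def by measurable
    define I where "I = (\<integral>\<^sup>+y\<in>D. f y \<partial>M)"
    define m where "m = emeasure M D"
    define W where "W = (\<integral>\<^sup>+y\<in>D. w y \<partial>M)"
    define S where "S = (\<integral>\<^sup>+y\<in>D. \<sigma> y \<partial>M)"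
    have pos: "m \<noteq> 0" "m \<noteq> top" "W \<noteq> 0" "W \<noteq> top" "S \<noteq> 0" "S \<noteq> top"
      using fin[OF x, of k] by (auto simp: D_def m_def W_def S_def)
    have le: "W / m * ennpow (S / m) (p - 1) \<le> A"
      using A[OF x, of k] by (simp add: D_def m_def W_def S_def)
    have r: "I / S \<le> F y" if y: "y \<in> D" for y
    proof -
      have D: "atom M \<pi> k y = D" using y by (auto simp: D_def atom_def)
      have "(\<integral>\<^sup>+z. \<sigma> z * (f z / \<sigma> z * indicator D z) \<partial>M) = I"
        unfolding I_def
      proof (rule nn_integral_cong_AE, use \<sigma> in eventually_elim)
        case (elim z)
        then have "\<sigma> z * (f z / \<sigma> z) = f z"
          by (simp add: mult.commute[of "\<sigma> z"] ennreal_divide_times zero_less_iff_neq_zero)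
        then show ?case by (simp add: mult.assoc[symmetric])
      qed
      then have "I / S = atom_mean (density M \<sigma>) \<pi> k (\<lambda>x. f x / \<sigma> x) y"
        unfolding atom_mean_def atom_density D
        by (simp add: nn_integral_density emeasure_density S_def)
      also have "\<dots> \<le> F y"
        unfolding F_def by (rule S.atom_mean_le_doob_max)
      finally show ?thesis .
    qed
    have "ennpow (I / S) (p - 1) * m = (\<integral>\<^sup>+y. ennpow (I / S) (p - 1) * indicator D y \<partial>M)"
      by (simp add: m_def nn_integral_cmult_indicator)
    also have "\<dots> \<le> (\<integral>\<^sup>+y. w y * (ennpow (F y) (p - 1) / w y * indicator D y) \<partial>M)"
    proof (rule nn_integral_mono_AE, use w in eventually_elim)
      case (elim y)
      then have "w y * (ennpow (F y) (p - 1) / w y) = ennpow (F y) (p - 1)"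
        by (simp add: mult.commute[of "w y"] ennreal_divide_times zero_less_iff_neq_zero)
      then show ?case
        using r[of y] p by (auto simp: mult.assoc[symmetric] indicator_def intro!: ennpow_mono)
    qed
    finally have "ennpow (I / S) (p - 1) * m / W \<le> \<dots> / W"
      by (rule divide_right_mono_ennreal)
    also have "\<dots> = atom_mean (density M w) \<pi> k (\<lambda>x. ennpow (F x) (p - 1) / w x) x"
      unfolding atom_mean_def atom_density D_def[symmetric]
      by (simp add: nn_integral_density emeasure_density W_def)
    also have "\<dots> \<le> G x"
      unfolding G_def by (rule W.atom_mean_le_doob_max)
    finally have G: "ennpow (I / S) (p - 1) * m / W \<le> G x" .
    have "I / m = (I / S) * (S / m)"
      using pos by (simp add: ennreal_times_divide ennreal_divide_times less_top)
    then have "ennpow (I / m) (p - 1) = ennpow (I / S) (p - 1) * ennpow (S / m) (p - 1)"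
      using p by (simp add: ennpow_mult)
    also have "\<dots> = (W / m * ennpow (S / m) (p - 1)) * (ennpow (I / S) (p - 1) * m / W)"
    proof -
      have "W / m * (m / W) = 1"
        using pos by (simp add: ennreal_times_divide ennreal_divide_times less_top)
      then show ?thesis
        by (metis (no_types, lifting) ennreal_times_divide mult.assoc mult.commute mult_1)
    qed
    also have "\<dots> \<le> A * G x"
      by (intro mult_mono le G) auto
    finally have "ennpow (ennpow (I / m) (p - 1)) (1 / (p - 1)) \<le> ennpow (A * G x) (1 / (p - 1))"
      using p by (intro ennpow_mono) auto
    then show "atom_mean M \<pi> k f x \<le> ennpow (A * G x) (1 / (p - 1))"
      using p by (simp add: ennpow_ennpow atom_mean_def I_def m_def D_def)
  qed
  have "(\<integral>\<^sup>+x. ennpow (doob_max M \<pi> f x) p * w x \<partial>M) \<le> (\<integral>\<^sup>+x. ennpow A q * (w x * ennpow (G x) q) \<partial>M)"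
  proof (rule nn_integral_mono)
    fix x assume "x \<in> space M"
    from pt[OF this] have "ennpow (doob_max M \<pi> f x) p \<le> ennpow (ennpow (A * G x) (1 / (p - 1))) p"
      using p by (intro ennpow_mono) auto
    also have "\<dots> = ennpow A q * ennpow (G x) q"
      using q by (simp add: ennpow_ennpow q_def[symmetric] ennpow_mult)
    finally have "ennpow (doob_max M \<pi> f x) p * w x \<le> ennpow A q * ennpow (G x) q * w x"
      by (rule mult_right_mono) simp
    then show "ennpow (doob_max M \<pi> f x) p * w x \<le> ennpow A q * (w x * ennpow (G x) q)"
      by (simp add: mult_ac)
  qed
  also have "\<dots> = ennpow A q * (\<integral>\<^sup>+x. ennpow (G x) q \<partial>density M w)"
    by (simp add: nn_integral_cmult nn_integral_density)
  also have "\<dots> \<le> ennpow A q * (ennreal (doob_const q) *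
      (\<integral>\<^sup>+x. ennpow (ennpow (F x) (p - 1) / w x) q \<partial>density M w))"
    unfolding G_def by (intro mult_left_mono W.doob_max_strong_type q) auto
  \<comment> \<open>The conjugate exponent \<open>q\<close> turns the density \<open>w\<close> into
    its dual: w^(1-q) = \<open>\<sigma>\<close> and (p-1)q = p. So the inequality for
    \<open>density M w\<close> hands over exactly to the one for
    \<open>density M \<sigma>\<close>.\<close>
  also have "(\<integral>\<^sup>+x. ennpow (ennpow (F x) (p - 1) / w x) q \<partial>density M w)
      = (\<integral>\<^sup>+x. \<sigma> x * ennpow (F x) p \<partial>M)"
  proof (subst nn_integral_density, simp, simp, rule nn_integral_cong_AE, use w in eventually_elim)
    case (elim x)
    then obtain r where r: "w x = ennreal r" "0 < r" by (cases "w x" rule: ennreal_cases3) auto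
    have "ennpow (ennpow (F x) (p - 1) / w x) q = ennpow (inverse (ennreal r)) q * ennpow (ennpow (F x) (p - 1)) q"
      using q r by (simp add: divide_ennreal_def ennpow_mult mult.commute)
    also have "ennpow (ennpow (F x) (p - 1)) q = ennpow (F x) p"
      using p by (simp add: ennpow_ennpow q_def)
    also have "ennpow (inverse (ennreal r)) q = ennreal (r powr (- q))"
      using r by (simp add: inverse_ennreal ennpow_ennreal powr_minus inverse_powr)
    finally have "w x * ennpow (ennpow (F x) (p - 1) / w x) q
        = ennreal r * ennreal (r powr (- q)) * ennpow (F x) p"
      using r by (simp add: mult.assoc)
    also have "ennreal r * ennreal (r powr (- q)) = \<sigma> x"
      using r powr_add[of r 1 "- q"]
      by (simp add: \<sigma>_def ennpow_ennreal q_def[symmetric] flip: ennreal_mult)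
    finally show ?case .
  qed
  also have "\<dots> = (\<integral>\<^sup>+x. ennpow (F x) p \<partial>density M \<sigma>)"
    by (simp add: nn_integral_density)
  also have "\<dots> \<le> ennreal (doob_const p) * (\<integral>\<^sup>+x. ennpow (f x / \<sigma> x) p \<partial>density M \<sigma>)"
    unfolding F_def by (intro S.doob_max_strong_type p) auto
  \<comment> \<open>The way back, since \<open>\<sigma>\<close> to the power 1-p is
    \<open>w\<close>.\<close>
  also have "(\<integral>\<^sup>+x. ennpow (f x / \<sigma> x) p \<partial>density M \<sigma>) = (\<integral>\<^sup>+x. ennpow (f x) p * w x \<partial>M)"
  proof (subst nn_integral_density, simp, simp, rule nn_integral_cong_AE, use w in eventually_elim)
    case (elim x)
    then obtain r where r: "w x = ennreal r" "0 < r" by (cases "w x" rule: ennreal_cases3) auto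
    have \<sigma>r: "\<sigma> x = ennreal (r powr (- (1 / (p - 1))))"
      using r by (simp add: \<sigma>_def ennpow_ennreal conjugate_exponent[OF p])
    have "ennpow (f x / \<sigma> x) p = ennpow (f x) p * ennpow (inverse (\<sigma> x)) p"
      using p by (simp add: divide_ennreal_def ennpow_mult)
    also have "inverse (\<sigma> x) = ennreal (r powr (1 / (p - 1)))"
      using r by (simp add: \<sigma>r inverse_ennreal powr_minus)
    also have "ennpow \<dots> p = ennreal (r powr (p / (p - 1)))"
      using r by (simp add: ennpow_ennreal powr_powr)
    finally have "\<sigma> x * ennpow (f x / \<sigma> x) p = ennpow (f x) p * (\<sigma> x * ennreal (r powr (p / (p - 1))))"
      by (simp add: mult_ac)
    also have "\<sigma> x * ennreal (r powr (p / (p - 1))) = ennreal (r powr (- (1 / (p - 1)) + p / (p - 1)))"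
      unfolding \<sigma>r by (subst powr_add) (simp add: ennreal_mult)
    also have "- (1 / (p - 1)) + p / (p - 1) = 1"
      using p diff_divide_distrib[of p 1 "p - 1"] by simp
    finally show ?case using r by simp
  qed
  finally have "(\<integral>\<^sup>+x. ennpow (doob_max M \<pi> f x) p * w x \<partial>M) \<le> ennpow A q * (ennreal (doob_const q) *
      (ennreal (doob_const p) * (\<integral>\<^sup>+x. ennpow (f x) p * w x \<partial>M)))"
    by (simp add: mult_left_mono)
  then show ?thesis
    using doob_const_pos[OF p] doob_const_pos[OF q]
    by (simp add: q_def[symmetric] ennreal_mult mult_ac)
qed

end

subsection \<open>Cubes and shifted dyadic grids\<close>

declare emeasure_completion [simp del]

text \<open>Half-open, so that the cells of a grid partition space exactly; the closed cubes of the
  statement differ only by a null set, and integrals and measures are transferred through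
  that.\<close>

definition hcube :: "real ^ 'n \<Rightarrow> real \<Rightarrow> (real ^ 'n) set" where
  "hcube a l = {x. \<forall>i. a $ i \<le> x $ i \<and> x $ i < a $ i + l}"

lemma mem_cube: "x \<in> cube a l \<longleftrightarrow> (\<forall>i. a $ i \<le> x $ i \<and> x $ i \<le> a $ i + l)"
  by (simp add: cube_def mem_box_cart)

lemma mem_hcube: "x \<in> hcube a l \<longleftrightarrow> (\<forall>i. a $ i \<le> x $ i \<and> x $ i < a $ i + l)"
  by (simp add: hcube_def)

lemma hcube_subset_cube: "hcube a l \<subseteq> cube a l"
  by (auto simp: mem_cube mem_hcube less_imp_le)

lemma compact_cube: "compact (cube a l)"
  by (simp add: cube_def)

lemma cube_sets [measurable]: "cube a l \<in> sets lebesgue"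
  by (simp add: cube_def)

lemma emeasure_cube: "0 \<le> l \<Longrightarrow> emeasure lebesgue (cube a l) = ennreal (l ^ CARD('n))"
  for a :: "real ^ 'n"
proof -
  assume l: "0 \<le> l"
  then have "a \<in> cbox a (\<chi> i. a $ i + l)" by (simp add: mem_box_cart)
  then have "cbox a (\<chi> i. a $ i + l) \<noteq> {}" by blast
  then have "measure lborel (cbox a (\<chi> i. a $ i + l)) = l ^ CARD('n)"
    by (simp add: content_cbox_cart)
  then show ?thesis
    using emeasure_eq_ennreal_measure[of lborel "cbox a (\<chi> i. a $ i + l)"] emeasure_lborel_cbox_finite[of a]
    by (simp add: cube_def emeasure_completion less_top)
qed

lemma emeasure_cube_pos: "0 < l \<Longrightarrow> emeasure lebesgue (cube a l) \<in> {0<..<top}"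
  by (simp add: emeasure_cube)

lemma negligible_cube_diff_hcube: "negligible (cube a l - hcube a l)"
proof (rule negligible_subset)
  show "cube a l - hcube a l \<subseteq> cbox a (\<chi> i. a $ i + l) - box a (\<chi> i. a $ i + l)"
    by (auto simp: cube_def mem_hcube mem_box_cart less_imp_le)
qed (rule negligible_frontier_interval)

lemma hcube_sets [measurable]: "hcube a l \<in> sets lebesgue"
proof -
  have "hcube a l = cube a l - (cube a l - hcube a l)"
    using hcube_subset_cube by blast
  moreover have "cube a l - hcube a l \<in> sets lebesgue"
    using negligible_cube_diff_hcube[of a l] by (simp add: negligible_iff_null_sets null_setsD2)
  ultimately show ?thesis
    using sets.Diff[OF cube_sets[of a l]] by metis
qed

lemma AE_hcube_iff_cube: "AE x in lebesgue. x \<in> hcube a l \<longleftrightarrow> x \<in> cube a l"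
  using AE_not_in[of "cube a l - hcube a l" lebesgue] negligible_cube_diff_hcube[of a l] hcube_subset_cube[of a l]
  by (auto simp: negligible_iff_null_sets elim!: eventually_mono)

lemma nn_integral_hcube: "(\<integral>\<^sup>+x\<in>hcube a l. f x \<partial>lebesgue) = (\<integral>\<^sup>+x\<in>cube a l. f x \<partial>lebesgue)"
  by (rule nn_integral_cong_AE, use AE_hcube_iff_cube[of a l] in eventually_elim) (auto simp: indicator_def)

lemma emeasure_hcube: "emeasure lebesgue (hcube a l) = emeasure lebesgue (cube a l)"
  by (rule emeasure_eq_AE) (auto simp: AE_hcube_iff_cube)

definition grid_index :: "real ^ 'n \<Rightarrow> real \<Rightarrow> (int \<Rightarrow> real ^ 'n) \<Rightarrow> int \<Rightarrow> real ^ 'n \<Rightarrow> int ^ 'n" where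
  "grid_index b s d k x = (\<chi> i. \<lfloor>(x $ i - b $ i) * 2 powr k / s + d k $ i\<rfloor>)"

text \<open>Cells of level \<open>k\<close> have side \<open>s / 2 powr k\<close>, and
  \<open>d k\<close> shifts them in units of that side. Passing to the next level doubles a shift
  measured in units, so an integer discrepancy between \<open>d (k + 1)\<close> and
  \<open>2 * d k\<close> says that endpoints of coarse cells are again endpoints of fine cells. The
  zero shift and the one-third shifts both qualify.\<close>

locale dyadic_grid =
  fixes b :: "real ^ 'n" and s :: real and d :: "int \<Rightarrow> real ^ 'n"
  assumes s_pos: "0 < s" and shift: "\<And>k i. d (k + 1) $ i - 2 * d k $ i \<in> \<int>"
begin

definition corner :: "int \<Rightarrow> int ^ 'n \<Rightarrow> real ^ 'n" where
  "corner k m = (\<chi> i. b $ i + (m $ i - d k $ i) * (s / 2 powr k))"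

lemma grid_index_eq_iff: "grid_index b s d k x = m \<longleftrightarrow> x \<in> hcube (corner k m) (s / 2 powr k)"
proof -
  have "\<lfloor>(x $ i - b $ i) * 2 powr k / s + d k $ i\<rfloor> = m $ i \<longleftrightarrow>
    b $ i + (m $ i - d k $ i) * (s / 2 powr k) \<le> x $ i \<and>
    x $ i < b $ i + (m $ i - d k $ i) * (s / 2 powr k) + s / 2 powr k" for i
    using s_pos by (simp add: floor_eq_iff field_simps)
  then show ?thesis
    by (simp add: grid_index_def mem_hcube corner_def vec_eq_iff)
qed

lemma atom_eq_hcube:
  "atom lebesgue (grid_index b s d) k x = hcube (corner k (grid_index b s d k x)) (s / 2 powr k)"
  by (auto simp: atom_def grid_index_eq_iff)

sublocale partition_filtration lebesgue "grid_index b s d"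
proof
  show "grid_index b s d k \<in> measurable lebesgue (count_space UNIV)" for k
  proof (subst measurable_count_space_eq2_countable, safe)
    fix m :: "int ^ 'n"
    have "grid_index b s d k -` {m} \<inter> space lebesgue = hcube (corner k m) (s / 2 powr k)"
      by (simp add: set_eq_iff grid_index_eq_iff)
    then show "grid_index b s d k -` {m} \<inter> space lebesgue \<in> sets lebesgue"
      by simp
  qed auto
next
  fix k :: int and x y :: "real ^ 'n"
  assume eq: "grid_index b s d (k + 1) x = grid_index b s d (k + 1) y"
  \<comment> \<open>The coarse label is computed from the fine one: remove the integer discrepancy
    of the shifts and halve, as floor(2t) div 2 = floor(t).\<close>
  have half: "\<lfloor>(z $ i - b $ i) * 2 powr k / s + d k $ i\<rfloor> =
      (\<lfloor>(z $ i - b $ i) * 2 powr (k + 1) / s + d (k + 1) $ i\<rfloor> - \<lfloor>d (k + 1) $ i - 2 * d k $ i\<rfloor>) div 2"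
    for z :: "real ^ 'n" and i
  proof -
    obtain j :: int where j: "d (k + 1) $ i - 2 * d k $ i = j"
      using shift[of k i] by (auto elim: Ints_cases)
    define t where "t = (z $ i - b $ i) * 2 powr k / s + d k $ i"
    have "(z $ i - b $ i) * 2 powr (k + 1) / s + d (k + 1) $ i = 2 * t + j"
      using j by (simp add: t_def powr_add field_simps)
    moreover have "\<lfloor>2 * t\<rfloor> div 2 = \<lfloor>t\<rfloor>"
      by linarith
    ultimately show ?thesis by (simp add: j flip: t_def)
  qed
  have "\<lfloor>(x $ i - b $ i) * 2 powr (k + 1) / s + d (k + 1) $ i\<rfloor>
      = \<lfloor>(y $ i - b $ i) * 2 powr (k + 1) / s + d (k + 1) $ i\<rfloor>" for i
    using eq by (simp add: grid_index_def vec_eq_iff)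
  then show "grid_index b s d k x = grid_index b s d k y"
    unfolding grid_index_def vec_eq_iff by (simp add: half)
qed

end

text \<open>
  The one-third trick: in every coordinate and at every scale, the endpoints of the two grids
  stay a third of the side length apart. The alternating sign makes consecutive levels nested.
\<close>

definition third_shift :: "('n \<Rightarrow> bool) \<Rightarrow> int \<Rightarrow> real ^ 'n" where
  "third_shift \<alpha> k = (\<chi> i. if \<alpha> i then (if even k then 1 / 3 else - 1 / 3) else 0)"

abbreviation third_grid :: "('n \<Rightarrow> bool) \<Rightarrow> int \<Rightarrow> real ^ 'n \<Rightarrow> int ^ 'n" where
  "third_grid \<alpha> \<equiv> grid_index 0 1 (third_shift \<alpha>)"

interpretation third: dyadic_grid 0 1 "third_shift \<alpha>" for \<alpha>
  by unfold_locales (auto simp: third_shift_def)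

text \<open>In one coordinate the side of the cube is less than a third of the cell side, so an
  endpoint of the shifted grid inside it keeps it clear of all endpoints of the unshifted grid. The
  choice between the two grids is made separately in each coordinate, which gives one grid for each
  function \<open>\<alpha>\<close>.\<close>

lemma cube_subset_third_grid_atom:
  fixes a :: "real ^ 'n"
  assumes l: "0 < l"
  obtains \<alpha> k where "2 powr (- real_of_int k) \<le> 6 * l"
    "\<And>x. x \<in> cube a l \<Longrightarrow> cube a l \<subseteq> atom lebesgue (third_grid \<alpha>) k x"
proof -
  \<comment> \<open>Puts the cell side into \<open>(3 * l, 6 * l]\<close>: the lower bound separates
    the endpoints, the upper bound is the price of enlarging the cube.\<close>
  define k where "k = \<lceil>- log 2 (6 * l)\<rceil>"
  have k: "- log 2 (6 * l) \<le> k" "k < - log 2 (6 * l) + 1" unfolding k_def by linarith+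
  have up: "2 powr (- real_of_int k) \<le> 6 * l"
    using k(1) l by (simp add: le_log_iff[symmetric])
  have "log 2 (6 * l) - 1 < - k" using k(2) by simp
  then have "2 powr (log 2 (6 * l) - 1) < 2 powr (- real_of_int k)" by (subst powr_less_cancel_iff) auto
  then have lo: "3 * l < 2 powr (- real_of_int k)"
    using l by (simp add: powr_diff)
  then have small: "l * 2 powr k < 1 / 3"
    by (simp add: powr_minus field_simps)
  define e :: real where "e = (if even k then 1 / 3 else - 1 / 3)"
  have ex: "\<exists>c. \<lfloor>a $ i * 2 powr k + (if c then e else 0)\<rfloor>
      = \<lfloor>(a $ i + l) * 2 powr k + (if c then e else 0)\<rfloor>" for i
  proof -
    define u where "u = a $ i * 2 powr k"
    define v where "v = (a $ i + l) * 2 powr k"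
    have uv: "u \<le> v" "v < u + 1 / 3" using small l by (auto simp: u_def v_def algebra_simps)
    have "\<lfloor>u\<rfloor> = \<lfloor>v\<rfloor> \<or> \<lfloor>u + e\<rfloor> = \<lfloor>v + e\<rfloor>"
    proof (rule disjCI)
      assume "\<lfloor>u + e\<rfloor> \<noteq> \<lfloor>v + e\<rfloor>"
      moreover have "\<lfloor>u + e\<rfloor> \<le> \<lfloor>v + e\<rfloor>" using uv by (intro floor_mono) simp
      ultimately have "\<lfloor>u + e\<rfloor> < \<lfloor>v + e\<rfloor>" by simp
      then obtain m :: int where m: "u + e < m" "m \<le> v + e"
        using of_int_floor_le[of "v + e"] by (auto simp: floor_less_iff)
      show "\<lfloor>u\<rfloor> = \<lfloor>v\<rfloor>"
      proof (cases "even k")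
        case True
        then have "\<lfloor>u\<rfloor> = m - 1" "\<lfloor>v\<rfloor> = m - 1"
          using uv m by (auto intro!: floor_unique simp: e_def)
        then show ?thesis by simp
      next
        case False
        then have "\<lfloor>u\<rfloor> = m" "\<lfloor>v\<rfloor> = m"
          using uv m by (auto intro!: floor_unique simp: e_def)
        then show ?thesis by simp
      qed
    qed
    then show ?thesis unfolding u_def v_def
      by (elim disjE) (rule exI[of _ False], simp, rule exI[of _ True], simp)
  qed
  then obtain \<alpha> where \<alpha>: "\<And>i. \<lfloor>a $ i * 2 powr k + (if \<alpha> i then e else 0)\<rfloor>
      = \<lfloor>(a $ i + l) * 2 powr k + (if \<alpha> i then e else 0)\<rfloor>"
    using choice[of "\<lambda>i c. \<lfloor>a $ i * 2 powr k + (if c then e else 0)\<rfloor>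
      = \<lfloor>(a $ i + l) * 2 powr k + (if c then e else 0)\<rfloor>"] by blast
  have same: "\<lfloor>x $ i * 2 powr k + (if \<alpha> i then e else 0)\<rfloor>
      = \<lfloor>a $ i * 2 powr k + (if \<alpha> i then e else 0)\<rfloor>" if "x \<in> cube a l" for x i
  proof (rule antisym)
    have "a $ i \<le> x $ i" "x $ i \<le> a $ i + l" using that by (auto simp: mem_cube)
    then show "\<lfloor>a $ i * 2 powr k + (if \<alpha> i then e else 0)\<rfloor> \<le> \<lfloor>x $ i * 2 powr k + (if \<alpha> i then e else 0)\<rfloor>"
      by (intro floor_mono add_right_mono mult_right_mono) auto
    have "\<lfloor>x $ i * 2 powr k + (if \<alpha> i then e else 0)\<rfloor> \<le> \<lfloor>(a $ i + l) * 2 powr k + (if \<alpha> i then e else 0)\<rfloor>"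
      using \<open>x $ i \<le> a $ i + l\<close> by (intro floor_mono add_right_mono mult_right_mono) auto
    then show "\<lfloor>x $ i * 2 powr k + (if \<alpha> i then e else 0)\<rfloor> \<le> \<lfloor>a $ i * 2 powr k + (if \<alpha> i then e else 0)\<rfloor>"
      by (simp only: \<alpha>)
  qed
  have "third_grid \<alpha> k x = third_grid \<alpha> k a" if "x \<in> cube a l" for x
    using same[OF that] by (simp add: grid_index_def vec_eq_iff third_shift_def e_def if_distrib cong: if_cong)
  then have "cube a l \<subseteq> atom lebesgue (third_grid \<alpha>) k x" if "x \<in> cube a l" for x
    using that by (auto simp: atom_def)
  then show ?thesis using up that by blast
qed

text \<open>Stands in for the Hardy-Littlewood operator over all cubes. It dominates every cube mean
  up to \<open>6 ^ CARD('n)\<close>, the volume ratio in the one-third trick, and as a supremum over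
  finitely many grids and countably many levels it is measurable.\<close>

definition cube_max :: "(real ^ 'n \<Rightarrow> ennreal) \<Rightarrow> real ^ 'n \<Rightarrow> ennreal" where
  "cube_max f x = (SUP \<alpha>. doob_max lebesgue (third_grid \<alpha>) f x)"

lemma cube_max_measurable [measurable]: "cube_max f \<in> borel_measurable lebesgue"
  unfolding cube_max_def[abs_def]
  by (rule borel_measurable_SUP) (auto intro: third.doob_max_measurable countable_finite)

lemma cube_mean_le_cube_max:
  fixes a :: "real ^ 'n"
  assumes l: "0 < l" and x: "x \<in> cube a l"
  shows "(\<integral>\<^sup>+y\<in>cube a l. f y \<partial>lebesgue) / emeasure lebesgue (cube a l) \<le> 6 ^ CARD('n) * cube_max f x"
proof -
  obtain \<alpha> k where k: "2 powr (- real_of_int k) \<le> 6 * l"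
    and sub: "\<And>x. x \<in> cube a l \<Longrightarrow> cube a l \<subseteq> atom lebesgue (third_grid \<alpha>) k x"
    using cube_subset_third_grid_atom[OF l, of a] by metis
  define D where "D = atom lebesgue (third_grid \<alpha>) k x"
  have sD: "cube a l \<subseteq> D" using sub[OF x] by (simp add: D_def)
  define L where "L = 2 powr (- real_of_int k)"
  have L: "0 < L" by (simp add: L_def)
  have D: "emeasure lebesgue D = ennreal (L ^ CARD('n))"
    by (simp add: D_def third.atom_eq_hcube emeasure_hcube emeasure_cube L_def powr_minus divide_inverse)
  let ?I = "(\<integral>\<^sup>+y\<in>cube a l. f y \<partial>lebesgue)"
  have "?I / emeasure lebesgue (cube a l) = ?I * ennreal (1 / l ^ CARD('n))"
    using l by (simp add: emeasure_cube divide_ennreal_def inverse_ennreal divide_inverse)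
  also have "\<dots> \<le> ?I * ennreal (6 ^ CARD('n) / L ^ CARD('n))"
  proof (intro mult_left_mono ennreal_leI)
    have "L ^ CARD('n) \<le> 6 ^ CARD('n) * l ^ CARD('n)"
      using power_mono[OF k, of "CARD('n)"] L by (simp add: L_def power_mult_distrib)
    then show "1 / l ^ CARD('n) \<le> 6 ^ CARD('n) / L ^ CARD('n)"
      using l L by (simp add: field_simps)
  qed simp
  also have "\<dots> \<le> (\<integral>\<^sup>+y\<in>D. f y \<partial>lebesgue) * ennreal (6 ^ CARD('n) / L ^ CARD('n))"
    using sD by (intro mult_right_mono nn_integral_mono) (auto simp: indicator_def)
  also have "\<dots> = 6 ^ CARD('n) * atom_mean lebesgue (third_grid \<alpha>) k f x"
  proof -
    have "ennreal (6 ^ CARD('n)) = 6 ^ CARD('n)"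
      using ennreal_power[of 6 "CARD('n)"] by simp
    then have "ennreal (6 ^ CARD('n) / L ^ CARD('n)) = 6 ^ CARD('n) * inverse (ennreal (L ^ CARD('n)))"
      using L by (simp add: divide_inverse inverse_ennreal ennreal_mult)
    then show ?thesis
      by (simp only: atom_mean_def D_def[symmetric] D divide_ennreal_def mult_ac)
  qed
  also have "\<dots> \<le> 6 ^ CARD('n) * cube_max f x"
    unfolding cube_max_def
    by (intro mult_left_mono SUP_upper2[of \<alpha>] third.atom_mean_le_doob_max) auto
  finally show ?thesis .
qed

text \<open>Countable subadditivity, from monotone convergence inside each mean; it lets the maximal
  operator act termwise on the Rubio de Francia series.\<close>

lemma cube_max_suminf_le:
  assumes [measurable]: "\<And>k::nat. h k \<in> borel_measurable lebesgue"
  shows "cube_max (\<lambda>x. \<Sum>k. h k x) x \<le> (\<Sum>k. cube_max (h k) x)"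
  unfolding cube_max_def[of "\<lambda>x. \<Sum>k. h k x"] doob_max_def
proof (intro SUP_least)
  fix \<alpha> :: "'a \<Rightarrow> bool" and j :: int
  let ?D = "atom lebesgue (third_grid \<alpha>) j x"
  have "atom_mean lebesgue (third_grid \<alpha>) j (\<lambda>x. \<Sum>k. h k x) x
      = (\<Sum>k. atom_mean lebesgue (third_grid \<alpha>) j (h k) x)"
  proof -
    have [measurable]: "?D \<in> sets lebesgue" by (rule third.atom_sets)
    have "(\<integral>\<^sup>+y\<in>?D. (\<Sum>k. h k y) \<partial>lebesgue) = (\<integral>\<^sup>+y. (\<Sum>k. h k y * indicator ?D y) \<partial>lebesgue)"
      by (simp only: ennreal_suminf_multc)
    also have "\<dots> = (\<Sum>k. \<integral>\<^sup>+y\<in>?D. h k y \<partial>lebesgue)"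
      by (intro nn_integral_suminf) measurable
    finally show ?thesis
      by (simp only: atom_mean_def divide_ennreal_def ennreal_suminf_multc)
  qed
  also have "\<dots> \<le> (\<Sum>k. cube_max (h k) x)"
    unfolding cube_max_def
    by (intro suminf_le SUP_upper2[of \<alpha>] third.atom_mean_le_doob_max) auto
  finally show "atom_mean lebesgue (third_grid \<alpha>) j (\<lambda>x. \<Sum>k. h k x) x \<le> (\<Sum>k. cube_max (h k) x)" .
qed

lemma cube_max_cmult:
  assumes [measurable]: "h \<in> borel_measurable lebesgue"
  shows "cube_max (\<lambda>x. c * h x) x = c * cube_max h x"
proof -
  have "atom_mean lebesgue (third_grid \<alpha>) j (\<lambda>x. c * h x) x = c * atom_mean lebesgue (third_grid \<alpha>) j h x"
    for \<alpha> j
    using third.atom_sets[of \<alpha> j x]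
    by (simp add: atom_mean_def mult.assoc nn_integral_cmult divide_ennreal_def)
  then show ?thesis
    by (simp add: cube_max_def doob_max_def SUP_mult_left_ennreal)
qed

subsection \<open>Muckenhoupt weights\<close>

lemma cubes_exhaust: "\<exists>m::nat. x \<in> cube (\<chi> i. - real m) (2 * real m)" for x :: "real ^ 'n"
proof -
  obtain m :: nat where m: "norm x \<le> m" using real_arch_simple by blast
  have "\<bar>x $ i\<bar> \<le> m" for i
    using component_le_norm_cart[of x i] m by simp
  then have "x \<in> cube (\<chi> i. - real m) (2 * real m)"
    by (auto simp: mem_cube abs_le_iff) (metis minus_le_iff)
  then show ?thesis by blast
qed

lemma cubes_mono: "m \<le> n \<Longrightarrow> cube (\<chi> i. - real m) (2 * real m) \<subseteq> cube (\<chi> i. - real n) (2 * real n)"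
  for m n :: nat
proof
  fix x :: "real ^ 'n" assume "m \<le> n" "x \<in> cube (\<chi> i. - real m) (2 * real m)"
  then have "- real m \<le> x $ i \<and> x $ i \<le> real m" "real m \<le> real n" for i
    by (auto simp: mem_cube)
  then show "x \<in> cube (\<chi> i. - real n) (2 * real n)"
    by (auto simp: mem_cube intro: order_trans[of _ "- real m"] order_trans[of _ "real m"])
qed

lemma bounded_subset_cube:
  fixes S :: "(real ^ 'n) set"
  assumes "bounded S" obtains m :: nat where "0 < m" "S \<subseteq> cube (\<chi> i. - real m) (2 * real m)"
proof -
  obtain r where r: "\<And>x. x \<in> S \<Longrightarrow> norm x \<le> r" using assms by (auto simp: bounded_iff)
  obtain m :: nat where m: "r \<le> m" using real_arch_simple by blast
  have "x \<in> cube (\<chi> i. - real (Suc m)) (2 * real (Suc m))" if "x \<in> S" for x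
  proof -
    have "\<bar>x $ i\<bar> \<le> Suc m" for i
      using component_le_norm_cart[of x i] m r[OF that] by simp
    then have "- real (Suc m) \<le> x $ i \<and> x $ i \<le> real (Suc m)" for i
      by (meson abs_le_iff minus_le_iff)
    then show ?thesis by (auto simp: mem_cube)
  qed
  then show ?thesis using that[of "Suc m"] by blast
qed

text \<open>Integrability is required on compact sets only; exhausting space by cubes exhibits
  \<open>f\<close> as a pointwise limit of measurable truncations.\<close>

lemma locally_integrable_measurable:
  fixes f :: "real ^ 'n \<Rightarrow> real"
  assumes "locally_integrable f" shows "f \<in> borel_measurable lebesgue"
proof (rule borel_measurable_LIMSEQ_real)
  let ?Q = "\<lambda>m::nat. cube (\<chi> i. - real m) (2 * real m) :: (real ^ 'n) set"
  show "(\<lambda>m. indicator (?Q m) x *\<^sub>R f x) \<longlonglongrightarrow> f x" for x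
  proof -
    obtain m where "x \<in> ?Q m" using cubes_exhaust by blast
    then have "\<forall>\<^sub>F k in sequentially. indicator (?Q k) x *\<^sub>R f x = f x"
      using cubes_mono by (intro eventually_sequentiallyI[of m]) (fastforce simp: indicator_def)
    then show ?thesis by (rule tendsto_eventually)
  qed
  show "(\<lambda>x. indicator (?Q m) x *\<^sub>R f x) \<in> borel_measurable lebesgue" for m
    using assms compact_cube unfolding locally_integrable_def set_integrable_def by blast
qed

lemma locally_integrable_nn_integral_finite:
  assumes "locally_integrable f"
  shows "(\<integral>\<^sup>+x\<in>cube a l. ennreal \<bar>f x\<bar> \<partial>lebesgue) < top"
proof -
  have "(\<integral>\<^sup>+x. ennreal (norm (indicator (cube a l) x *\<^sub>R f x)) \<partial>lebesgue) < \<infinity>"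
    using assms compact_cube[of a l]
    unfolding locally_integrable_def set_integrable_def integrable_iff_bounded by blast
  also have "(\<integral>\<^sup>+x. ennreal (norm (indicator (cube a l) x *\<^sub>R f x)) \<partial>lebesgue)
      = (\<integral>\<^sup>+x\<in>cube a l. ennreal \<bar>f x\<bar> \<partial>lebesgue)"
    by (intro nn_integral_cong) (simp add: indicator_def)
  finally show ?thesis by simp
qed

lemma locally_integrableI_cubes:
  fixes f :: "real ^ 'n \<Rightarrow> real"
  assumes [measurable]: "f \<in> borel_measurable lebesgue"
    and fin: "\<And>a l. 0 < l \<Longrightarrow> (\<integral>\<^sup>+x\<in>cube a l. ennreal \<bar>f x\<bar> \<partial>lebesgue) < top"
  shows "locally_integrable f"
  unfolding locally_integrable_def
proof safe
  fix K :: "(real ^ 'n) set" assume K: "compact K"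
  then obtain m :: nat where m: "0 < m" "K \<subseteq> cube (\<chi> i. - real m) (2 * real m)"
    using bounded_subset_cube compact_imp_bounded by metis
  have [measurable]: "K \<in> sets lebesgue"
    using K by (simp add: compact_imp_closed lmeasurable_compact fmeasurableD)
  have "(\<integral>\<^sup>+x. ennreal (norm (indicator K x *\<^sub>R f x)) \<partial>lebesgue)
      \<le> (\<integral>\<^sup>+x\<in>cube (\<chi> i. - real m) (2 * real m). ennreal \<bar>f x\<bar> \<partial>lebesgue)"
    using m by (intro nn_integral_mono) (auto simp: indicator_def)
  also have "\<dots> < \<infinity>" using fin m by simp
  finally show "set_integrable lebesgue K f"
    unfolding set_integrable_def by (intro integrableI_bounded) auto
qed

lemma nn_integral_indicator_pos:
  assumes [measurable]: "f \<in> borel_measurable M" "S \<in> sets M"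
    and "AE x in M. 0 < f x" "emeasure M S \<noteq> 0"
  shows "0 < (\<integral>\<^sup>+x\<in>S. f x \<partial>M)"
proof (rule ccontr)
  assume "\<not> 0 < (\<integral>\<^sup>+x\<in>S. f x \<partial>M)"
  then have "AE x in M. f x * indicator S x = 0"
    by (subst (asm) not_gr_zero, subst (asm) nn_integral_0_iff_AE) auto
  then have "AE x in M. x \<notin> S"
    using assms(3) by eventually_elim (auto simp: indicator_def split: if_splits)
  then have "S \<in> null_sets M" by (simp add: AE_iff_null_sets)
  then show False using assms(4) by auto
qed

lemma ennreal_mult_ennpow_less_topD:
  assumes "x * ennpow y a < top" "x \<noteq> 0" "0 < a" shows "y < top"
  using assms by (cases "y = top") (auto simp: ennreal_mult_top less_top[symmetric])

lemma ennreal_divide_less_topD: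
  fixes x m :: ennreal
  assumes "x / m < top" "m < top" shows "x < top"
  using assms by (cases "x = top") (auto simp: ennreal_top_divide less_top[symmetric])

lemma Ap_const_upper:
  assumes "0 < l"
  shows "wmeas w (cube a l) / emeasure lebesgue (cube a l) *
    ennpow ((\<integral>\<^sup>+x\<in>cube a l. ennpow (ennreal (w x)) (1 - p / (p - 1)) \<partial>lebesgue)
      / emeasure lebesgue (cube a l)) (p - 1) \<le> Ap_const p w"
  unfolding Ap_const_def using assms by (intro SUP_upper2[of "(a, l)"]) auto

lemma Ap_const_least:
  assumes "\<And>a l. 0 < l \<Longrightarrow> wmeas w (cube a l) / emeasure lebesgue (cube a l) *
    ennpow ((\<integral>\<^sup>+x\<in>cube a l. ennpow (ennreal (w x)) (1 - p / (p - 1)) \<partial>lebesgue)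
      / emeasure lebesgue (cube a l)) (p - 1) \<le> B"
  shows "Ap_const p w \<le> B"
  unfolding Ap_const_def using assms by (intro SUP_least) auto

lemma Ap_measurable: "w \<in> Ap p \<Longrightarrow> w \<in> borel_measurable lebesgue"
  by (simp add: Ap_def weight_def locally_integrable_measurable)

lemma Ap_nonneg: "w \<in> Ap p \<Longrightarrow> 0 \<le> w x"
  by (simp add: Ap_def weight_def)

lemma Ap_wmeas_finite:
  assumes "w \<in> Ap p" shows "wmeas w (cube a l) < top"
proof -
  have "locally_integrable w" using assms by (simp add: Ap_def weight_def)
  from locally_integrable_nn_integral_finite[OF this, of a l] show ?thesis
    using Ap_nonneg[OF assms] by (simp add: wmeas_def)
qed

text \<open>A zero of \<open>w\<close> gives the dual weight the value \<open>top\<close>, so zeros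
  of positive measure would make the dual integral infinite. A cube with positive mass excludes this
  through the finite product in \<open>Ap_const\<close>; with zero mass the convention
  \<open>0 * top = 0\<close> would hide the infinity.\<close>

lemma Ap_pos_AE_cube:
  assumes p: "1 < p" and w: "w \<in> Ap p" and l: "0 < l" and pos: "wmeas w (cube a l) \<noteq> 0"
  shows "AE x in lebesgue. x \<in> cube a l \<longrightarrow> 0 < w x"
proof -
  have [measurable]: "w \<in> borel_measurable lebesgue" using w by (rule Ap_measurable)
  let ?S = "\<integral>\<^sup>+x\<in>cube a l. ennpow (ennreal (w x)) (1 - p / (p - 1)) \<partial>lebesgue"
  have "Ap_const p w < top" using w by (simp add: Ap_def)
  with Ap_const_upper[OF l, of w a p]
  have "wmeas w (cube a l) / emeasure lebesgue (cube a l) *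
      ennpow (?S / emeasure lebesgue (cube a l)) (p - 1) < top"
    by (rule le_less_trans)
  moreover have "wmeas w (cube a l) / emeasure lebesgue (cube a l) \<noteq> 0"
    using pos emeasure_cube_pos[OF l, of a] by (auto simp: ennreal_divide_eq_0_iff)
  ultimately have "?S / emeasure lebesgue (cube a l) < top"
    by (rule ennreal_mult_ennpow_less_topD) (use p in simp)
  then have "?S < top"
    by (rule ennreal_divide_less_topD) (use emeasure_cube_pos[OF l, of a] in simp)
  then have "AE x in lebesgue. ennpow (ennreal (w x)) (1 - p / (p - 1)) * indicator (cube a l) x \<noteq> \<infinity>"
    by (intro nn_integral_noteq_infinite) auto
  then show ?thesis
  proof eventually_elim
    case (elim x)
    have "1 - p / (p - 1) < 0" using p by (simp add: conjugate_exponent)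
    then have "ennpow 0 (1 - p / (p - 1)) = top" by (simp add: ennpow_def)
    then show ?case
      using elim Ap_nonneg[OF w, of x] by (cases "w x = 0") auto
  qed
qed

text \<open>As \<open>w\<close> is not a.e. zero, one cube of the exhaustion has positive mass, and
  then so have all larger ones, which cover space.\<close>

lemma Ap_pos_AE:
  fixes w :: "real ^ 'n \<Rightarrow> real"
  assumes p: "1 < p" and w: "w \<in> Ap p"
  shows "AE x in lebesgue. 0 < w x"
proof -
  have [measurable]: "w \<in> borel_measurable lebesgue" using w by (rule Ap_measurable)
  let ?Q = "\<lambda>m::nat. cube (\<chi> i. - real m) (2 * real m) :: (real ^ 'n) set"
  have "\<exists>m. wmeas w (?Q m) \<noteq> 0"
  proof (rule ccontr)
    assume "\<nexists>m. wmeas w (?Q m) \<noteq> 0"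
    then have "AE x in lebesgue. ennreal (w x) * indicator (?Q m) x = 0" for m
      unfolding wmeas_def by (subst (asm) nn_integral_0_iff_AE) auto
    then have "AE x in lebesgue. \<forall>m. ennreal (w x) * indicator (?Q m) x = 0"
      by (intro AE_all_countable[THEN iffD2] allI)
    then have "AE x in lebesgue. w x = 0"
    proof eventually_elim
      case (elim x)
      obtain m where "x \<in> ?Q m" using cubes_exhaust by blast
      with elim[rule_format, of m] Ap_nonneg[OF w, of x] show ?case by simp
    qed
    then show False using w by (simp add: Ap_def)
  qed
  then obtain m0 where m0: "wmeas w (?Q m0) \<noteq> 0" by blast
  \<comment> \<open>\<open>Suc\<close> keeps the side positive even when \<open>m0\<close> and
    \<open>m\<close> are 0.\<close>
  have mono: "wmeas w (?Q m0) \<le> wmeas w (?Q (m0 + Suc m))" for m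
    unfolding wmeas_def using cubes_mono[of m0 "m0 + Suc m"]
    by (intro nn_integral_mono) (auto simp: indicator_def)
  have "AE x in lebesgue. x \<in> ?Q (m0 + Suc m) \<longrightarrow> 0 < w x" for m
    using mono[of m] m0 by (intro Ap_pos_AE_cube[OF p w]) auto
  then have "AE x in lebesgue. \<forall>m. x \<in> ?Q (m0 + Suc m) \<longrightarrow> 0 < w x"
    by (intro AE_all_countable[THEN iffD2] allI)
  then show ?thesis
  proof eventually_elim
    case (elim x)
    obtain m where "x \<in> ?Q m" using cubes_exhaust by blast
    then have "x \<in> ?Q (m0 + Suc m)" using cubes_mono[of m "m0 + Suc m"] by auto
    then show ?case using elim by blast
  qed
qed

lemma Ap_wmeas_pos:
  assumes "1 < p" "w \<in> Ap p" "0 < l" shows "0 < wmeas w (cube a l)"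
  unfolding wmeas_def
  using Ap_measurable[OF assms(2)] Ap_pos_AE[OF assms(1,2)] emeasure_cube_pos[OF assms(3), of a]
  by (intro nn_integral_indicator_pos) auto

lemma Ap_dual_cube:
  assumes p: "1 < p" and w: "w \<in> Ap p" and l: "0 < l"
  shows "(\<integral>\<^sup>+x\<in>cube a l. ennpow (ennreal (w x)) (1 - p / (p - 1)) \<partial>lebesgue) \<in> {0<..<top}" (is "?S \<in> _")
proof -
  have [measurable]: "w \<in> borel_measurable lebesgue" using w by (rule Ap_measurable)
  have "Ap_const p w < top" using w by (simp add: Ap_def)
  with Ap_const_upper[OF l, of w a p]
  have "wmeas w (cube a l) / emeasure lebesgue (cube a l) *
      ennpow (?S / emeasure lebesgue (cube a l)) (p - 1) < top"
    by (rule le_less_trans)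
  moreover have "wmeas w (cube a l) / emeasure lebesgue (cube a l) \<noteq> 0"
    using Ap_wmeas_pos[OF p w l, of a] emeasure_cube_pos[OF l, of a] by (auto simp: ennreal_divide_eq_0_iff)
  ultimately have "?S / emeasure lebesgue (cube a l) < top"
    by (rule ennreal_mult_ennpow_less_topD) (use p in simp)
  then have "?S < top"
    by (rule ennreal_divide_less_topD) (use emeasure_cube_pos[OF l, of a] in simp)
  moreover have "AE x in lebesgue. 0 < ennpow (ennreal (w x)) (1 - p / (p - 1))"
    using AE_dual_weight[OF p, of "\<lambda>x. ennreal (w x)" lebesgue] Ap_pos_AE[OF p w] by auto
  then have "0 < ?S"
    using emeasure_cube_pos[OF l, of a] by (intro nn_integral_indicator_pos) auto
  ultimately show ?thesis by simp
qed

text \<open>Hoelder applied to 1 = w^(1/p) \<open>\<sigma>\<close>^(1-1/p) on a single cube. The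
  bound keeps the arguments of \<open>\<phi>\<close> in \<open>{1..}\<close>, where it is known to
  be monotone and positive.\<close>

lemma Ap_const_ge_1:
  fixes w :: "real ^ 'n \<Rightarrow> real"
  assumes p: "1 < p" and [measurable]: "w \<in> borel_measurable lebesgue" and pos: "AE x in lebesgue. 0 < w x"
  shows "1 \<le> Ap_const p w"
proof -
  define Q :: "(real ^ 'n) set" where "Q = cube 0 1"
  have [measurable]: "Q \<in> sets lebesgue" by (simp add: Q_def)
  define m where "m = emeasure lebesgue Q"
  have m: "m \<noteq> 0" "m < top" using emeasure_cube_pos[of 1 "0::real ^ 'n"] by (auto simp: m_def Q_def)
  define \<sigma> where "\<sigma> x = ennpow (ennreal (w x)) (1 - p / (p - 1))" for x
  have [measurable]: "\<sigma> \<in> borel_measurable lebesgue" unfolding \<sigma>_def by measurable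
  define \<theta> where "\<theta> = 1 / p"
  have \<theta>: "0 < \<theta>" "\<theta> < 1" using p by (auto simp: \<theta>_def)
  let ?W = "\<integral>\<^sup>+x\<in>Q. ennreal (w x) \<partial>lebesgue" and ?S = "\<integral>\<^sup>+x\<in>Q. \<sigma> x \<partial>lebesgue"
  have "m = (\<integral>\<^sup>+x. indicator Q x \<partial>lebesgue)" by (simp add: m_def)
  also have "\<dots> \<le> (\<integral>\<^sup>+x. ennpow (ennreal (w x) * indicator Q x) \<theta> * ennpow (\<sigma> x * indicator Q x) (1 - \<theta>) \<partial>lebesgue)"
  proof (rule nn_integral_mono_AE, use pos in eventually_elim)
    case (elim x)
    have "(1 - p / (p - 1)) * (1 - \<theta>) = - \<theta>"
      using p by (simp add: conjugate_exponent \<theta>_def field_simps)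
    then have "ennpow (\<sigma> x) (1 - \<theta>) = ennpow (ennreal (w x)) (- \<theta>)"
      by (simp only: \<sigma>_def ennpow_ennpow)
    then have "ennpow (ennreal (w x)) \<theta> * ennpow (\<sigma> x) (1 - \<theta>) = 1"
      using elim by (simp add: ennpow_ennreal powr_minus flip: ennreal_mult)
    then show ?case by (auto simp: indicator_def)
  qed
  also have "\<dots> \<le> ennpow ?W \<theta> * ennpow ?S (1 - \<theta>)"
    by (intro nn_integral_Hoelder \<theta>) measurable
  finally have "m / m \<le> ennpow ?W \<theta> * ennpow ?S (1 - \<theta>) / m"
    by (rule divide_right_mono_ennreal)
  also have "\<dots> = ennpow (?W / m) \<theta> * ennpow (?S / m) (1 - \<theta>)"
  proof -
    have "inverse m = ennpow (inverse m) \<theta> * ennpow (inverse m) (1 - \<theta>)"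
      using \<theta> ennpow_add[of \<theta> "1 - \<theta>" "inverse m"] by simp
    then have "ennpow ?W \<theta> * ennpow ?S (1 - \<theta>) / m
        = ennpow ?W \<theta> * ennpow ?S (1 - \<theta>) * (ennpow (inverse m) \<theta> * ennpow (inverse m) (1 - \<theta>))"
      by (simp only: divide_ennreal_def)
    then show ?thesis
      using \<theta> by (simp add: divide_ennreal_def ennpow_mult mult_ac)
  qed
  finally have "ennpow 1 p \<le> ennpow (ennpow (?W / m) \<theta> * ennpow (?S / m) (1 - \<theta>)) p"
    using m p by (intro ennpow_mono) auto
  also have "\<dots> = ?W / m * ennpow (?S / m) (p - 1)"
  proof -
    have "\<theta> * p = 1" "(1 - \<theta>) * p = p - 1" using p by (auto simp: \<theta>_def field_simps)
    then show ?thesis using p by (simp add: ennpow_mult ennpow_ennpow)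
  qed
  also have "\<dots> \<le> Ap_const p w"
    using Ap_const_upper[of 1 w 0 p] by (simp add: wmeas_def Q_def m_def \<sigma>_def)
  finally show ?thesis by simp
qed

section \<open>Buckley's bound for the maximal function over cubes\<close>

definition hl_const :: "'n itself \<Rightarrow> real \<Rightarrow> real" where
  "hl_const _ p = 2 ^ CARD('n) * (doob_const p * doob_const (p / (p - 1)))"

lemma hl_const_pos: "1 < p \<Longrightarrow> 0 < hl_const TYPE('n::finite) p"
  unfolding hl_const_def by (intro mult_pos_pos doob_const_pos) auto

text \<open>The cells of every grid are cubes up to null sets, so the averages in
  \<open>Ap_const\<close> bound the constant of each filtration. A supremum over finitely many grids
  is at most the sum, whence the factor \<open>2 ^ CARD('n)\<close> in
  \<open>hl_const\<close>.\<close>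

lemma cube_max_weighted:
  fixes f :: "real ^ 'n \<Rightarrow> ennreal"
  assumes p: "1 < p" and w: "w \<in> Ap p" and [measurable]: "f \<in> borel_measurable lebesgue"
  shows "(\<integral>\<^sup>+x. ennpow (cube_max f x) p * ennreal (w x) \<partial>lebesgue)
    \<le> ennreal (hl_const TYPE('n) p) * ennpow (Ap_const p w) (p / (p - 1)) *
       (\<integral>\<^sup>+x. ennpow (f x) p * ennreal (w x) \<partial>lebesgue)"
proof -
  have [measurable]: "w \<in> borel_measurable lebesgue" using w by (rule Ap_measurable)
  have [measurable]: "doob_max lebesgue (third_grid \<alpha>) f \<in> borel_measurable lebesgue" for \<alpha>
    by (rule third.doob_max_measurable)
  have pos: "AE x in lebesgue. 0 < ennreal (w x) \<and> ennreal (w x) < top"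
    using Ap_pos_AE[OF p w] by simp
  let ?C = "ennreal (doob_const p * doob_const (p / (p - 1))) * ennpow (Ap_const p w) (p / (p - 1)) *
       (\<integral>\<^sup>+x. ennpow (f x) p * ennreal (w x) \<partial>lebesgue)"
  have one: "(\<integral>\<^sup>+x. ennpow (doob_max lebesgue (third_grid \<alpha>) f x) p * ennreal (w x) \<partial>lebesgue) \<le> ?C" for \<alpha>
  proof (rule third.doob_max_weighted[OF _ _ p pos])
    fix k and x :: "real ^ 'n"
    let ?D = "atom lebesgue (third_grid \<alpha>) k x"
    define a where "a = dyadic_grid.corner 0 1 (third_shift \<alpha>) k (third_grid \<alpha> k x)"
    define l where "l = 1 / 2 powr real_of_int k"
    have D: "?D = hcube a l" by (simp add: a_def l_def third.atom_eq_hcube)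
    have l: "0 < l" by (simp add: l_def)
    show "emeasure lebesgue ?D \<in> {0<..<top}"
      using emeasure_cube_pos[OF l] by (simp add: D emeasure_hcube)
    show "(\<integral>\<^sup>+y\<in>?D. ennreal (w y) \<partial>lebesgue) \<in> {0<..<top}"
      using Ap_wmeas_pos[OF p w l, of a] Ap_wmeas_finite[OF w, of a l]
      by (simp add: D nn_integral_hcube wmeas_def)
    show "(\<integral>\<^sup>+y\<in>?D. ennpow (ennreal (w y)) (1 - p / (p - 1)) \<partial>lebesgue) \<in> {0<..<top}"
      using Ap_dual_cube[OF p w l, of a] by (simp add: D nn_integral_hcube)
    show "(\<integral>\<^sup>+y\<in>?D. ennreal (w y) \<partial>lebesgue) / emeasure lebesgue ?D *
        ennpow ((\<integral>\<^sup>+y\<in>?D. ennpow (ennreal (w y)) (1 - p / (p - 1)) \<partial>lebesgue) / emeasure lebesgue ?D) (p - 1)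
        \<le> Ap_const p w"
      using Ap_const_upper[OF l, of w a p] by (simp add: D nn_integral_hcube emeasure_hcube wmeas_def)
  qed auto
  have "(\<integral>\<^sup>+x. ennpow (cube_max f x) p * ennreal (w x) \<partial>lebesgue)
      \<le> (\<integral>\<^sup>+x. (\<Sum>\<alpha>\<in>UNIV. ennpow (doob_max lebesgue (third_grid \<alpha>) f x) p * ennreal (w x)) \<partial>lebesgue)"
  proof (rule nn_integral_mono)
    fix x
    have "cube_max f x \<in> range (\<lambda>\<alpha>. doob_max lebesgue (third_grid \<alpha>) f x)"
      unfolding cube_max_def by (subst Max_Sup[symmetric]) (auto intro!: Max_in)
    then obtain \<alpha> where "cube_max f x = doob_max lebesgue (third_grid \<alpha>) f x" by blast
    then show "ennpow (cube_max f x) p * ennreal (w x)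
        \<le> (\<Sum>\<alpha>\<in>UNIV. ennpow (doob_max lebesgue (third_grid \<alpha>) f x) p * ennreal (w x))"
      by (simp add: member_le_sum[of \<alpha> UNIV "\<lambda>\<alpha>. ennpow (doob_max lebesgue (third_grid \<alpha>) f x) p * ennreal (w x)"])
  qed
  also have "\<dots> = (\<Sum>\<alpha>\<in>UNIV. \<integral>\<^sup>+x. ennpow (doob_max lebesgue (third_grid \<alpha>) f x) p * ennreal (w x) \<partial>lebesgue)"
    by (rule nn_integral_sum) measurable
  also have "\<dots> \<le> (\<Sum>\<alpha>\<in>(UNIV :: ('n \<Rightarrow> bool) set). ?C)"
    by (intro sum_mono one)
  also have "\<dots> = ennreal (2 ^ CARD('n)) * ?C"
    by (simp add: card_fun ennreal_power[symmetric] of_nat_power)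
  also have "\<dots> = ennreal (hl_const TYPE('n) p) * ennpow (Ap_const p w) (p / (p - 1)) *
       (\<integral>\<^sup>+x. ennpow (f x) p * ennreal (w x) \<partial>lebesgue)"
    using p doob_const_pos[of p] doob_const_pos[of "p / (p - 1)"]
    by (simp add: hl_const_def ennreal_mult mult.assoc)
  finally show ?thesis .
qed

subsection \<open>Extrapolation\<close>

text \<open>Takes the part of Minkowski's inequality for series: each \<open>b k\<close> is at most
  the p-th root of the sum on the right, and the geometric weights add up to 2. The weights must be
  supplied by the series to which it is applied.\<close>

lemma ennpow_suminf_geometric_le:
  fixes b :: "nat \<Rightarrow> ennreal"
  assumes p: "0 < p"
  shows "ennpow (\<Sum>k. ennreal ((1/2) ^ k) * b k) p \<le> ennreal (2 powr p) * (\<Sum>k. ennpow (b k) p)"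
proof -
  define T where "T = (\<Sum>k. ennpow (b k) p)"
  have "b k \<le> ennpow T (1 / p)" for k
  proof -
    have "ennpow (b k) p \<le> T"
      unfolding T_def using sum_le_suminf[of "\<lambda>k. ennpow (b k) p" "{k}"] by simp
    then have "ennpow (ennpow (b k) p) (1 / p) \<le> ennpow T (1 / p)"
      using p by (intro ennpow_mono) auto
    then show ?thesis using p by (simp add: ennpow_ennpow)
  qed
  then have "(\<Sum>k. ennreal ((1/2) ^ k) * b k) \<le> (\<Sum>k. ennreal ((1/2) ^ k) * ennpow T (1 / p))"
    by (intro suminf_le mult_left_mono) auto
  also have "\<dots> = ennreal 2 * ennpow T (1 / p)"
  proof -
    have "(\<Sum>k. ennreal ((1/2) ^ k)) = ennreal 2"
      using geometric_sums[of "1/2::real"] by (intro suminf_ennreal_eq) auto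
    then show ?thesis by (simp only: ennreal_suminf_multc)
  qed
  finally have "ennpow (\<Sum>k. ennreal ((1/2) ^ k) * b k) p \<le> ennpow (ennreal 2 * ennpow T (1 / p)) p"
    using p by (intro ennpow_mono) auto
  also have "\<dots> = ennpow (ennreal 2) p * ennpow (ennpow T (1 / p)) p"
    using p by (intro ennpow_mult) simp
  also have "\<dots> = ennreal (2 powr p) * T"
    using p ennpow_ennreal[of 2 p] by (simp add: ennpow_ennpow del: ennreal_numeral)
  finally show ?thesis by (simp add: T_def)
qed

text \<open>A bound for the operator norm of \<open>cube_max\<close> on L^p(w), the p-th root of the
  constant in \<open>cube_max_weighted\<close>; as a function of the weight it is a multiple of the
  constant to the power 1/(p-1).\<close>

definition hl_norm :: "real \<Rightarrow> (real ^ 'n \<Rightarrow> real) \<Rightarrow> ennreal" where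
  "hl_norm p w = ennpow (ennreal (hl_const TYPE('n) p) * ennpow (Ap_const p w) (p / (p - 1))) (1 / p)"

lemma Ap_const_bounds:
  assumes "1 < p" "w \<in> Ap p" shows "1 \<le> Ap_const p w" "Ap_const p w < top"
  using assms Ap_const_ge_1[OF assms(1) Ap_measurable Ap_pos_AE] by (auto simp: Ap_def)

lemma hl_norm_eq:
  fixes w :: "real ^ 'n \<Rightarrow> real"
  assumes p: "1 < p"
  shows "hl_norm p w = ennreal (hl_const TYPE('n) p powr (1 / p)) * ennpow (Ap_const p w) (1 / (p - 1))"
proof -
  have "p / (p - 1) * (1 / p) = 1 / (p - 1)" using p by simp
  then show ?thesis
    unfolding hl_norm_def using p hl_const_pos[OF p, where 'n = 'n]
    by (simp add: ennpow_mult ennpow_ennreal ennpow_ennpow)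
qed

lemma hl_norm_bounds:
  fixes w :: "real ^ 'n \<Rightarrow> real"
  assumes p: "1 < p" and w: "w \<in> Ap p"
  shows "hl_norm p w \<noteq> 0" "hl_norm p w \<noteq> top"
proof -
  have "Ap_const p w \<noteq> 0" "Ap_const p w \<noteq> top"
    using Ap_const_bounds[OF p w] by (auto simp: top_unique)
  moreover have "hl_const TYPE('n) p powr (1 / p) > 0" using hl_const_pos[OF p, where 'n = 'n] by simp
  ultimately show "hl_norm p w \<noteq> 0" "hl_norm p w \<noteq> top"
    unfolding hl_norm_eq[OF p] using p
    by (simp_all add: ennpow_eq_0_iff ennpow_eq_top_iff ennreal_mult_eq_top_iff ennreal_eq_0_iff not_le)
qed

lemma Rubio_de_Francia:
  fixes w :: "real ^ 'n \<Rightarrow> real" and h :: "real ^ 'n \<Rightarrow> ennreal"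
  assumes p: "1 < p" and w: "w \<in> Ap p" and [measurable]: "h \<in> borel_measurable lebesgue"
  obtains R where "R \<in> borel_measurable lebesgue" "\<And>x. h x \<le> R x"
    "\<And>x. cube_max R x \<le> 4 * hl_norm p w * R x"
    "(\<integral>\<^sup>+x. ennpow (R x) p * ennreal (w x) \<partial>lebesgue)
      \<le> ennreal (2 powr (p + 1)) * (\<integral>\<^sup>+x. ennpow (h x) p * ennreal (w x) \<partial>lebesgue)"
proof -
  have [measurable]: "w \<in> borel_measurable lebesgue" using w by (rule Ap_measurable)
  define K where "K = hl_norm p w"
  have K: "K \<noteq> 0" "K \<noteq> top" using hl_norm_bounds[OF p w] by (auto simp: K_def)
  have Kp: "ennpow K p = ennreal (hl_const TYPE('n) p) * ennpow (Ap_const p w) (p / (p - 1))"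
    using p by (simp add: K_def hl_norm_def ennpow_ennpow)
  obtain k where k: "K = ennreal k" "0 < k" using K by (cases K rule: ennreal_cases3) auto
  have K4: "4 * K = ennreal (4 * k)" using k by (simp add: ennreal_mult)
  \<comment> \<open>The usual series divides the iterates by powers of 2K. Here one factor 2 pays
    for the geometric weights in \<open>ennpow_suminf_geometric_le\<close>; the other leaves (2cK)^p
    = 2^(-p), at most 1/2, so the integrals of the terms are summable with sum 2. Hence the exponent
    p+1 in the norm bound.\<close>
  define c where "c = inverse (4 * K)"
  have c: "c = ennreal (1 / (4 * k))"
    unfolding c_def K4 using k by (subst inverse_ennreal) (auto simp: field_simps)
  have cK: "c * (4 * K) = 1"
    unfolding c K4 using k by (subst ennreal_mult[symmetric]) auto
  define M where "M j = (cube_max ^^ j) h" for j :: nat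
  have Mm [measurable]: "M j \<in> borel_measurable lebesgue" for j
    by (cases j) (auto simp: M_def)
  define R where "R x = (\<Sum>j. c ^ j * M j x)" for x
  have [measurable]: "R \<in> borel_measurable lebesgue" unfolding R_def by measurable
  define H where "H = (\<integral>\<^sup>+x. ennpow (h x) p * ennreal (w x) \<partial>lebesgue)"
  have Mp: "(\<integral>\<^sup>+x. ennpow (M j x) p * ennreal (w x) \<partial>lebesgue) \<le> ennpow K p ^ j * H" for j
  proof (induction j)
    case 0
    show ?case by (simp add: M_def H_def)
  next
    case (Suc j)
    have "(\<integral>\<^sup>+x. ennpow (M (Suc j) x) p * ennreal (w x) \<partial>lebesgue)
        \<le> ennpow K p * (\<integral>\<^sup>+x. ennpow (M j x) p * ennreal (w x) \<partial>lebesgue)"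
      using cube_max_weighted[OF p w Mm[of j]] by (simp add: M_def Kp)
    also have "\<dots> \<le> ennpow K p * (ennpow K p ^ j * H)"
      by (intro mult_left_mono Suc) simp
    finally show ?case by (simp add: mult.assoc)
  qed
  show ?thesis
  proof (rule that[of R])
    show "R \<in> borel_measurable lebesgue" by measurable
    show "h x \<le> R x" for x
      unfolding R_def using sum_le_suminf[of "\<lambda>j. c ^ j * M j x" "{0}"] by (simp add: M_def)
    show "cube_max R x \<le> 4 * hl_norm p w * R x" for x
    proof -
      have "cube_max R x \<le> (\<Sum>j. cube_max (\<lambda>x. c ^ j * M j x) x)"
        unfolding R_def by (rule cube_max_suminf_le) measurable
      \<comment> \<open>One application of the maximal operator shifts the series by one index at
        the cost of 4K; only the term with index 0 is lost.\<close>
      also have "\<dots> = (\<Sum>j. 4 * K * (c ^ Suc j * M (Suc j) x))"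
      proof (rule suminf_cong)
        fix j
        have "c ^ j * cube_max (M j) x = (c * (4 * K)) * (c ^ j * M (Suc j) x)"
          by (simp add: cK M_def)
        then show "cube_max (\<lambda>x. c ^ j * M j x) x = 4 * K * (c ^ Suc j * M (Suc j) x)"
          by (subst cube_max_cmult) (simp_all add: mult.assoc mult.left_commute)
      qed
      also have "\<dots> = 4 * K * (\<Sum>j. c ^ Suc j * M (Suc j) x)"
        by (rule ennreal_suminf_cmult)
      also have "\<dots> \<le> 4 * K * R x"
        unfolding R_def using suminf_offset[of "\<lambda>j. c ^ j * M j x" 1]
        by (intro mult_left_mono) auto
      finally show ?thesis by (simp add: K_def)
    qed
    have "(\<integral>\<^sup>+x. ennpow (R x) p * ennreal (w x) \<partial>lebesgue)
        \<le> (\<integral>\<^sup>+x. (\<Sum>j. ennreal (2 powr p) * (ennpow ((2 * c) ^ j) p * (ennpow (M j x) p * ennreal (w x)))) \<partial>lebesgue)"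
    proof (rule nn_integral_mono)
      fix x
      have "c ^ j * M j x = ennreal ((1/2) ^ j) * ((2 * c) ^ j * M j x)" for j
      proof -
        have "ennreal ((1/2) ^ j) * ennreal (2 ^ j) = 1"
          by (subst ennreal_mult[symmetric]) (auto simp: power_one_over)
        moreover have "ennreal (2 ^ j) = 2 ^ j"
          using ennreal_power[of 2 j] by simp
        ultimately have "ennreal ((1/2) ^ j) * 2 ^ j = 1" by simp
        then show ?thesis by (simp only: power_mult_distrib mult.assoc[symmetric] mult_1)
      qed
      then have "ennpow (R x) p \<le> ennreal (2 powr p) * (\<Sum>j. ennpow ((2 * c) ^ j * M j x) p)"
        unfolding R_def using p ennpow_suminf_geometric_le[of p "\<lambda>j. (2 * c) ^ j * M j x"] by simp
      then have "ennpow (R x) p * ennreal (w x)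
          \<le> ennreal (2 powr p) * (\<Sum>j. ennpow ((2 * c) ^ j * M j x) p) * ennreal (w x)"
        by (rule mult_right_mono) simp
      also have "\<dots> = (\<Sum>j. ennreal (2 powr p) * (ennpow ((2 * c) ^ j * M j x) p * ennreal (w x)))"
        by (simp only: ennreal_suminf_multc ennreal_suminf_cmult mult.assoc)
      finally show "ennpow (R x) p * ennreal (w x)
          \<le> (\<Sum>j. ennreal (2 powr p) * (ennpow ((2 * c) ^ j) p * (ennpow (M j x) p * ennreal (w x))))"
        using p by (simp add: ennpow_mult mult.assoc)
    qed
    also have "\<dots> = (\<Sum>j. ennreal (2 powr p) * (ennpow ((2 * c) ^ j) p *
        (\<integral>\<^sup>+x. ennpow (M j x) p * ennreal (w x) \<partial>lebesgue)))"
      by (subst nn_integral_suminf) (auto simp: nn_integral_cmult intro!: suminf_cong)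
    also have "\<dots> \<le> (\<Sum>j. ennreal ((1/2) ^ j) * (ennreal (2 powr p) * H))"
    proof (intro suminf_le)
      fix j
      have "ennpow (2 * c) p * ennpow K p = ennpow (2 * c * K) p"
        using p by (simp add: ennpow_mult)
      also have "2 * c * K = ennreal (1 / 2)"
      proof -
        have "c * K = ennreal (1 / 4)"
          unfolding c k using k by (subst ennreal_mult[symmetric]) auto
        then have "2 * c * K = ennreal 2 * ennreal (1 / 4)" by (simp only: mult.assoc ennreal_numeral)
        also have "\<dots> = ennreal (1 / 2)" by (subst ennreal_mult[symmetric]) auto
        finally show ?thesis .
      qed
      also have "ennpow (ennreal (1 / 2)) p = ennreal ((1 / 2) powr p)"
        by (rule ennpow_ennreal) simp
      also have "\<dots> \<le> ennreal (1 / 2)"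
        by (rule ennreal_leI) (use p powr_mono'[of 1 p "1 / 2 :: real"] in simp)
      finally have half: "ennpow (2 * c) p * ennpow K p \<le> ennreal (1 / 2)" .
      have pw: "ennpow (y ^ j) p = ennpow y p ^ j" for y :: ennreal
        by (induction j) (use p in \<open>auto simp: ennpow_mult\<close>)
      have "ennpow ((2 * c) ^ j) p * (\<integral>\<^sup>+x. ennpow (M j x) p * ennreal (w x) \<partial>lebesgue)
          \<le> ennpow (2 * c) p ^ j * (ennpow K p ^ j * H)"
        unfolding pw by (intro mult_left_mono Mp) simp
      also have "\<dots> = (ennpow (2 * c) p * ennpow K p) ^ j * H"
        by (simp add: power_mult_distrib mult.assoc)
      also have "\<dots> \<le> ennreal (1 / 2) ^ j * H"
        by (intro mult_right_mono power_mono half) auto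
      also have "ennreal (1 / 2) ^ j = ennreal ((1 / 2) ^ j)"
        by (rule ennreal_power) simp
      finally have "ennreal (2 powr p) * (ennpow ((2 * c) ^ j) p *
          (\<integral>\<^sup>+x. ennpow (M j x) p * ennreal (w x) \<partial>lebesgue)) \<le> ennreal (2 powr p) * (ennreal ((1/2) ^ j) * H)"
        by (rule mult_left_mono) simp
      then show "ennreal (2 powr p) * (ennpow ((2 * c) ^ j) p *
          (\<integral>\<^sup>+x. ennpow (M j x) p * ennreal (w x) \<partial>lebesgue)) \<le> ennreal ((1/2) ^ j) * (ennreal (2 powr p) * H)"
        by (simp only: mult.left_commute)
    qed auto
    also have "\<dots> = ennreal 2 * (ennreal (2 powr p) * H)"
    proof -
      have "(\<Sum>k. ennreal ((1/2) ^ k)) = ennreal 2"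
        using geometric_sums[of "1/2::real"] by (intro suminf_ennreal_eq) auto
      then show ?thesis by (simp only: ennreal_suminf_multc)
    qed
    also have "\<dots> = ennreal (2 powr (p + 1)) * H"
    proof -
      have "ennreal (2 powr (p + 1)) = ennreal 2 * ennreal (2 powr p)"
        by (subst ennreal_mult[symmetric]) (auto simp: powr_add)
      then show ?thesis by (simp only: mult.assoc)
    qed
    finally show "(\<integral>\<^sup>+x. ennpow (R x) p * ennreal (w x) \<partial>lebesgue)
      \<le> ennreal (2 powr (p + 1)) * (\<integral>\<^sup>+x. ennpow (h x) p * ennreal (w x) \<partial>lebesgue)"
      by (simp add: H_def)
  qed
qed

text \<open>
  The lower bound of \<open>R\<close> on a cube by its mean handles the average of \<open>w R\<^bsup>p-p\<^sub>0\<^esup>\<close>, Hoelder's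
  inequality handles the average of its dual weight.
\<close>

lemma Ap_times_A1_power:
  fixes w :: "real ^ 'n \<Rightarrow> real"
  assumes p: "1 < p" "p < p0" and w: "w \<in> Ap p"
    and [measurable]: "R \<in> borel_measurable lebesgue"
    and R: "\<And>x. 0 < R x" "AE x in lebesgue. R x < top"
    and A1: "\<And>a l x. 0 < l \<Longrightarrow> x \<in> cube a l \<Longrightarrow>
      (\<integral>\<^sup>+y\<in>cube a l. R y \<partial>lebesgue) / emeasure lebesgue (cube a l) \<le> K * R x"
    and K: "K < top"
  defines "v \<equiv> \<lambda>x. w x * enn2real (R x) powr (p - p0)"
  shows "v \<in> Ap p0" "Ap_const p0 v \<le> ennpow K (p0 - p) * Ap_const p w"
    "AE x in lebesgue. ennreal (v x) = ennreal (w x) * ennpow (R x) (p - p0)"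
proof -
  have [measurable]: "w \<in> borel_measurable lebesgue" using w by (rule Ap_measurable)
  have [measurable]: "v \<in> borel_measurable lebesgue" unfolding v_def by measurable
  have v0: "0 \<le> v x" for x using Ap_nonneg[OF w] by (simp add: v_def)
  have wpos: "AE x in lebesgue. 0 < w x" by (rule Ap_pos_AE[OF p(1) w])
  \<comment> \<open>\<open>v\<close> is real-valued by construction. Where \<open>R\<close> is
    infinite, \<open>enn2real\<close> returns 0 and so \<open>v = 0\<close>, which affects only a
    null set.\<close>
  show v: "AE x in lebesgue. ennreal (v x) = ennreal (w x) * ennpow (R x) (p - p0)"
    using R(2)
  proof eventually_elim
    case (elim x)
    then obtain r where "R x = ennreal r" "0 < r"
      using R(1)[of x] by (cases "R x" rule: ennreal_cases3) auto
    then show ?case using Ap_nonneg[OF w, of x] by (simp add: v_def ennpow_ennreal ennreal_mult)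
  qed
  have vpos: "AE x in lebesgue. 0 < v x"
    using wpos R(2)
  proof eventually_elim
    case (elim x)
    then have "enn2real (R x) \<noteq> 0" using R(1)[of x] by (auto simp: enn2real_eq_0_iff)
    then show ?case using elim by (simp add: v_def)
  qed
  define m where "m a l = emeasure lebesgue (cube a l)" for a :: "real ^ 'n" and l
  define \<rho> where "\<rho> a l = (\<integral>\<^sup>+y\<in>cube a l. R y \<partial>lebesgue) / m a l" for a :: "real ^ 'n" and l
  have m: "m a l \<noteq> 0" "m a l \<noteq> top" if "0 < l" for a l
    using emeasure_cube_pos[OF that, of a] by (auto simp: m_def)
  have \<rho>: "0 < \<rho> a l" "\<rho> a l < top" if l: "0 < l" for a l
  proof -
    have "0 < (\<integral>\<^sup>+y\<in>cube a l. R y \<partial>lebesgue)"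
      using m[OF l, of a] R(1) by (intro nn_integral_indicator_pos) (auto simp: m_def)
    then show "0 < \<rho> a l"
      using m[OF l, of a] by (simp add: \<rho>_def zero_less_iff_neq_zero ennreal_divide_eq_0_iff)
    show "\<rho> a l < top"
    \<comment> \<open>An infinite mean would force \<open>R = top\<close> at every point of the
      cube, by the pointwise lower bound with finite \<open>K\<close>.\<close>
    proof (rule ccontr)
      assume "\<not> \<rho> a l < top"
      then have top: "\<rho> a l = top" by (simp add: less_top[symmetric])
      have "R x = top" if "x \<in> cube a l" for x
        using A1[OF l that] K unfolding m_def[symmetric] \<rho>_def[symmetric] top
        by (auto simp: top_unique ennreal_mult_eq_top_iff)
      then have "AE x in lebesgue. x \<notin> cube a l"
        using R(2) by (auto elim: eventually_mono)
      then have "cube a l \<in> null_sets lebesgue" by (simp add: AE_iff_null_sets)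
      then show False using m[OF l, of a] by (simp add: m_def null_setsD1)
    qed
  qed
  have K0: "K \<noteq> 0"
    using A1[of 1 0 0] \<rho>(1)[of 1 0] by (auto simp: \<rho>_def m_def mem_cube)
  have V: "(\<integral>\<^sup>+x\<in>cube a l. ennreal (v x) \<partial>lebesgue) \<le> ennpow (\<rho> a l / K) (p - p0) * wmeas w (cube a l)"
    if l: "0 < l" for a l
  proof -
    have "(\<integral>\<^sup>+x\<in>cube a l. ennreal (v x) \<partial>lebesgue)
        \<le> (\<integral>\<^sup>+x. ennpow (\<rho> a l / K) (p - p0) * (ennreal (w x) * indicator (cube a l) x) \<partial>lebesgue)"
    proof (rule nn_integral_mono_AE, use v in eventually_elim)
      case (elim x)
      have "ennpow (R x) (p - p0) \<le> ennpow (\<rho> a l / K) (p - p0)" if "x \<in> cube a l"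
      proof -
        have "\<rho> a l / K \<le> K * R x / K"
          using A1[OF l that] by (intro divide_right_mono_ennreal) (simp add: \<rho>_def m_def)
        also have "\<dots> = R x"
          using K0 K by (simp add: mult.commute[of K] mult_divide_eq_ennreal less_top)
        finally show ?thesis using p by (intro ennpow_antimono) auto
      qed
      then show ?case
        using elim by (auto simp: indicator_def mult.commute intro!: mult_left_mono)
    qed
    then show ?thesis by (simp add: nn_integral_cmult wmeas_def)
  qed
  have "weight v"
    unfolding weight_def
  proof (intro conjI allI v0 locally_integrableI_cubes)
    fix a :: "real ^ 'n" and l :: real assume l: "0 < l"
    have "\<rho> a l / K \<noteq> 0" "\<rho> a l / K \<noteq> top"
      using \<rho>[OF l, of a] K0 K by (auto simp: ennreal_divide_eq_0_iff ennreal_divide_eq_top_iff)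
    then have "ennpow (\<rho> a l / K) (p - p0) < top"
      by (cases "\<rho> a l / K" rule: ennreal_cases3) (auto simp: ennpow_ennreal)
    then have "ennpow (\<rho> a l / K) (p - p0) * wmeas w (cube a l) < top"
      using Ap_wmeas_finite[OF w, of a l] by (simp add: ennreal_mult_less_top)
    with V[OF l, of a] have "(\<integral>\<^sup>+x\<in>cube a l. ennreal (v x) \<partial>lebesgue) < top"
      by (rule le_less_trans)
    then show "(\<integral>\<^sup>+x\<in>cube a l. ennreal \<bar>v x\<bar> \<partial>lebesgue) < top"
      using v0 by simp
  qed measurable
  moreover have "\<not> (AE x in lebesgue. v x = 0)"
  proof
    assume "AE x in lebesgue. v x = 0"
    with vpos have "AE x in lebesgue. x \<notin> cube (0 :: real ^ 'n) 1" by eventually_elim simp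
    then have "cube (0 :: real ^ 'n) 1 \<in> null_sets lebesgue" by (simp add: AE_iff_null_sets)
    then show False using m[of 1 0] by (simp add: m_def null_setsD1)
  qed
  moreover show Ap: "Ap_const p0 v \<le> ennpow K (p0 - p) * Ap_const p w"
  proof (rule Ap_const_least)
    fix a :: "real ^ 'n" and l :: real assume l: "0 < l"
    \<comment> \<open>Chosen so that the dual weight of \<open>v\<close> for the exponent
      \<open>p0\<close> is \<open>\<sigma>\<close> to the power \<open>\<theta>\<close> times
      \<open>R\<close> to the power \<open>1 - \<theta>\<close>, which is the shape Hoelder's
      inequality wants.\<close>
    define \<theta> where "\<theta> = (p - 1) / (p0 - 1)"
    have \<theta>: "0 < \<theta>" "\<theta> < 1" using p by (auto simp: \<theta>_def)
    have \<theta>1: "\<theta> * (p0 - 1) = p - 1" "(1 - \<theta>) * (p0 - 1) = p0 - p"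
      using p by (auto simp: \<theta>_def field_simps)
    define \<sigma> where "\<sigma> x = ennpow (ennreal (w x)) (1 - p / (p - 1))" for x
    have [measurable]: "\<sigma> \<in> borel_measurable lebesgue" unfolding \<sigma>_def by measurable
    let ?Q = "cube a l" and ?m = "m a l"
    let ?S = "\<integral>\<^sup>+x\<in>?Q. \<sigma> x \<partial>lebesgue"
    have "(\<integral>\<^sup>+x\<in>?Q. ennpow (ennreal (v x)) (1 - p0 / (p0 - 1)) \<partial>lebesgue)
        \<le> (\<integral>\<^sup>+x. ennpow (\<sigma> x * indicator ?Q x) \<theta> * ennpow (R x * indicator ?Q x) (1 - \<theta>) \<partial>lebesgue)"
    proof (rule nn_integral_mono_AE, use v wpos R(2) in eventually_elim)
      case (elim x)
      obtain r where r: "R x = ennreal r" "0 < r"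
        using elim R(1)[of x] by (cases "R x" rule: ennreal_cases3) auto
      have e: "1 - p / (p - 1) = - (1 / (p - 1))" "1 - p0 / (p0 - 1) = - (1 / (p0 - 1))"
        using p by (auto simp: conjugate_exponent)
      have e1: "- (1 / (p - 1)) * \<theta> = - (1 / (p0 - 1))" "(p - p0) * (- (1 / (p0 - 1))) = 1 - \<theta>"
        using p by (auto simp: \<theta>_def field_simps)
      have "ennpow (ennreal (v x)) (1 - p0 / (p0 - 1))
          = ennreal ((w x * r powr (p - p0)) powr (- (1 / (p0 - 1))))"
        unfolding elim e r using elim r by (simp add: ennpow_ennreal flip: ennreal_mult)
      also have "(w x * r powr (p - p0)) powr (- (1 / (p0 - 1)))
          = w x powr (- (1 / (p0 - 1))) * r powr (1 - \<theta>)"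
        using elim r by (simp only: powr_mult powr_powr e1)
      also have "ennreal \<dots> = ennpow (\<sigma> x) \<theta> * ennpow (R x) (1 - \<theta>)"
        unfolding \<sigma>_def ennpow_ennpow e e1 using elim r by (simp add: ennpow_ennreal ennreal_mult)
      finally show ?case using \<theta> by (auto simp: indicator_def)
    qed
    also have "\<dots> \<le> ennpow ?S \<theta> * ennpow (\<integral>\<^sup>+x\<in>?Q. R x \<partial>lebesgue) (1 - \<theta>)"
      by (intro nn_integral_Hoelder \<theta>) measurable
    finally have "(\<integral>\<^sup>+x\<in>?Q. ennpow (ennreal (v x)) (1 - p0 / (p0 - 1)) \<partial>lebesgue) / ?m
        \<le> ennpow ?S \<theta> * ennpow (\<integral>\<^sup>+x\<in>?Q. R x \<partial>lebesgue) (1 - \<theta>) / ?m"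
      by (rule divide_right_mono_ennreal)
    also have "\<dots> = ennpow (?S / ?m) \<theta> * ennpow (\<rho> a l) (1 - \<theta>)"
    proof -
      have "inverse ?m = ennpow (inverse ?m) \<theta> * ennpow (inverse ?m) (1 - \<theta>)"
        using \<theta> ennpow_add[of \<theta> "1 - \<theta>" "inverse ?m"] by simp
      then have "ennpow ?S \<theta> * ennpow (\<integral>\<^sup>+x\<in>?Q. R x \<partial>lebesgue) (1 - \<theta>) / ?m = ennpow ?S \<theta> *
          ennpow (\<integral>\<^sup>+x\<in>?Q. R x \<partial>lebesgue) (1 - \<theta>) * (ennpow (inverse ?m) \<theta> * ennpow (inverse ?m) (1 - \<theta>))"
        by (simp only: divide_ennreal_def)
      then show ?thesis
        using \<theta> by (simp add: divide_ennreal_def ennpow_mult mult_ac \<rho>_def)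
    qed
    finally have "ennpow ((\<integral>\<^sup>+x\<in>?Q. ennpow (ennreal (v x)) (1 - p0 / (p0 - 1)) \<partial>lebesgue) / ?m) (p0 - 1)
        \<le> ennpow (ennpow (?S / ?m) \<theta> * ennpow (\<rho> a l) (1 - \<theta>)) (p0 - 1)"
      using p by (intro ennpow_mono) auto
    also have "\<dots> = ennpow (?S / ?m) (p - 1) * ennpow (\<rho> a l) (p0 - p)"
      using p by (simp add: ennpow_mult ennpow_ennpow \<theta>1)
    finally have dual: "ennpow ((\<integral>\<^sup>+x\<in>?Q. ennpow (ennreal (v x)) (1 - p0 / (p0 - 1)) \<partial>lebesgue) / ?m) (p0 - 1)
        \<le> ennpow (?S / ?m) (p - 1) * ennpow (\<rho> a l) (p0 - p)" .
    \<comment> \<open>The mean of \<open>R\<close> enters the two averages with opposite exponents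
      and drops out; only the power of \<open>K\<close> is left.\<close>
    have cancel: "ennpow (\<rho> a l / K) (p - p0) * ennpow (\<rho> a l) (p0 - p) = ennpow K (p0 - p)"
    proof -
      obtain r where r: "\<rho> a l = ennreal r" "0 < r"
        using \<rho>[OF l, of a] by (cases "\<rho> a l" rule: ennreal_cases3) auto
      obtain s where s: "K = ennreal s" "0 < s"
        using K0 K by (cases K rule: ennreal_cases3) auto
      have "(r / s) powr (p - p0) * r powr (p0 - p) = s powr (p0 - p)"
        using r s powr_minus[of "r / s" "p0 - p"] by (simp add: powr_divide)
      then show ?thesis using r s by (simp add: divide_ennreal ennpow_ennreal flip: ennreal_mult)
    qed
    have "wmeas v ?Q / ?m * ennpow ((\<integral>\<^sup>+x\<in>?Q. ennpow (ennreal (v x)) (1 - p0 / (p0 - 1)) \<partial>lebesgue) / ?m) (p0 - 1)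
        \<le> ennpow (\<rho> a l / K) (p - p0) * wmeas w ?Q / ?m * (ennpow (?S / ?m) (p - 1) * ennpow (\<rho> a l) (p0 - p))"
      using V[OF l, of a] by (intro mult_mono dual divide_right_mono_ennreal) (auto simp: wmeas_def)
    also have "\<dots> = (ennpow (\<rho> a l / K) (p - p0) * ennpow (\<rho> a l) (p0 - p)) *
        (wmeas w ?Q / ?m * ennpow (?S / ?m) (p - 1))"
      by (simp only: divide_ennreal_def mult_ac)
    also have "\<dots> \<le> ennpow K (p0 - p) * Ap_const p w"
      unfolding cancel using Ap_const_upper[OF l, of w a p]
      by (intro mult_left_mono) (auto simp: m_def \<sigma>_def)
    finally show "wmeas v ?Q / emeasure lebesgue ?Q *
       ennpow ((\<integral>\<^sup>+x\<in>?Q. ennpow (ennreal (v x)) (1 - p0 / (p0 - 1)) \<partial>lebesgue) / emeasure lebesgue ?Q) (p0 - 1)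
        \<le> ennpow K (p0 - p) * Ap_const p w"
      by (simp add: m_def)
  qed
  moreover have "ennpow K (p0 - p) * Ap_const p w < top"
  proof -
    have "ennpow K (p0 - p) < top" using K p by (simp add: less_top[symmetric] ennpow_eq_top_iff)
    then show ?thesis using w by (simp add: Ap_def ennreal_mult_less_top)
  qed
  ultimately show "v \<in> Ap p0"
    by (auto simp: Ap_def intro: le_less_trans)
qed

text \<open>Lebesgue measure is the test weight for cubes on which \<open>g\<close> vanishes a.e.,
  where the majorant of the algorithm may degenerate to 0.\<close>

lemma one_in_Ap:
  assumes p: "1 < p" shows "(\<lambda>_. 1 :: real) \<in> (Ap p :: (real ^ 'n \<Rightarrow> real) set)"
proof -
  have "locally_integrable (\<lambda>_ :: real ^ 'n. 1)"
    using emeasure_cube_pos by (intro locally_integrableI_cubes) auto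
  moreover have "\<not> (AE x :: real ^ 'n in lebesgue. (1::real) = 0)"
  proof
    assume "AE x :: real ^ 'n in lebesgue. (1::real) = 0"
    then have "AE x in lebesgue. x \<notin> cube (0 :: real ^ 'n) 1" by eventually_elim simp
    then have "cube (0 :: real ^ 'n) 1 \<in> null_sets lebesgue" by (simp add: AE_iff_null_sets)
    then show False using emeasure_cube_pos[of 1 "0 :: real ^ 'n"] by (simp add: null_setsD1)
  qed
  moreover have "Ap_const p (\<lambda>_ :: real ^ 'n. 1) \<le> 1"
  proof (rule Ap_const_least)
    fix a :: "real ^ 'n" and l :: real assume "0 < l"
    then have "emeasure lebesgue (cube a l) / emeasure lebesgue (cube a l) = 1"
      using emeasure_cube_pos[of l a] by (intro ennreal_divide_self) auto
    then show "wmeas (\<lambda>_. 1) (cube a l) / emeasure lebesgue (cube a l) *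
       ennpow ((\<integral>\<^sup>+x\<in>cube a l. ennpow (ennreal 1) (1 - p / (p - 1)) \<partial>lebesgue)
         / emeasure lebesgue (cube a l)) (p - 1) \<le> 1"
      by (simp add: wmeas_def)
  qed
  ultimately show ?thesis
    by (auto simp: Ap_def weight_def intro: le_less_trans)
qed

text \<open>The weight-independent part of \<open>K\<close> raised to the power
  \<open>p0 - p\<close>, where \<open>K\<close> is the lower-bound constant of the majorant:
  \<open>6 ^ CARD('n)\<close> from the grids, 4 from the algorithm, the rest from the maximal
  operator. The maximum with 1 keeps the argument of \<open>\<phi>\<close> in its domain.\<close>

definition extrapol_const :: "'n itself \<Rightarrow> real \<Rightarrow> real \<Rightarrow> real" where
  "extrapol_const T p p0 = max 1 ((6 ^ CARD('n) * 4 * hl_const T p powr (1 / p)) powr (p0 - p))"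

text \<open>Extrapolation acts on the right-hand side alone, so the oscillation is an arbitrary
  number \<open>X\<close> and the cube is fixed. The side length is meant to be part of
  \<open>\<psi>\<close>.\<close>

lemma Ap_extrapolation_cube:
  fixes w :: "real ^ 'n \<Rightarrow> real" and g :: "real ^ 'n \<Rightarrow> ennreal" and \<psi> :: "real \<Rightarrow> real"
  assumes p: "1 < p" "p < p0" and w: "w \<in> Ap p" and l: "0 < l"
    and g [measurable]: "g \<in> borel_measurable lebesgue"
    and \<psi>: "mono_on {1..} \<psi>" "\<And>t. 1 \<le> t \<Longrightarrow> 0 < \<psi> t"
    and hyp: "\<And>v. v \<in> Ap p0 \<Longrightarrow> X \<le> ennreal (\<psi> (enn2real (Ap_const p0 v))) *
      ennpow ((\<integral>\<^sup>+x\<in>cube a l. ennpow (g x) p0 * ennreal (v x) \<partial>lebesgue) / wmeas v (cube a l)) (1 / p0)"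
  shows "X \<le> ennreal (2 powr ((p + 1) * (1 / p - 1 / p0)) *
        \<psi> (extrapol_const TYPE('n) p p0 * enn2real (Ap_const p w) powr ((p0 - 1) / (p - 1)))) *
      ennpow ((\<integral>\<^sup>+x\<in>cube a l. ennpow (g x) p * ennreal (w x) \<partial>lebesgue) / wmeas w (cube a l)) (1 / p)"
proof -
  have [measurable]: "w \<in> borel_measurable lebesgue" using w by (rule Ap_measurable)
  define Q where "Q = cube a l"
  have [measurable]: "Q \<in> sets lebesgue" by (simp add: Q_def)
  define \<Phi> where "\<Phi> = (\<integral>\<^sup>+x\<in>Q. ennpow (g x) p * ennreal (w x) \<partial>lebesgue)"
  define C where "C = extrapol_const TYPE('n) p p0"
  have C: "1 \<le> C" by (simp add: C_def extrapol_const_def)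
  define c where "c = 2 powr ((p + 1) * (1 / p - 1 / p0))"
  have c: "0 < c" by (simp add: c_def)
  obtain A where A: "Ap_const p w = ennreal A" "1 \<le> A"
    using Ap_const_bounds[OF p(1) w] by (cases "Ap_const p w" rule: ennreal_cases3) auto
  define t where "t = C * A powr ((p0 - 1) / (p - 1))"
  have "1 \<le> A powr ((p0 - 1) / (p - 1))" using A p by (intro ge_one_powr_ge_zero) auto
  then have t: "1 \<le> t" unfolding t_def using C mult_mono[of 1 C 1] by fastforce
  have wQ: "0 < wmeas w Q" "wmeas w Q < top"
    using Ap_wmeas_pos[OF p(1) w l] Ap_wmeas_finite[OF w] by (auto simp: Q_def)
  have wpos: "AE x in lebesgue. 0 < w x" by (rule Ap_pos_AE[OF p(1) w])
  have "X \<le> ennreal (c * \<psi> t) * ennpow (\<Phi> / wmeas w Q) (1 / p)"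
  proof -
    consider "\<Phi> = 0" | "\<Phi> = top" | "0 < \<Phi>" "\<Phi> < top"
      using less_top zero_less_iff_neq_zero by blast
    then show ?thesis
    proof cases
      case 1
      \<comment> \<open>Since \<open>w > 0\<close> a.e., \<open>g\<close> vanishes a.e. on the cube,
        and the hypothesis for the constant weight gives \<open>X = 0\<close>.\<close>
      then have "AE x in lebesgue. ennpow (g x) p * ennreal (w x) * indicator Q x = 0"
        unfolding \<Phi>_def by (subst (asm) nn_integral_0_iff_AE) auto
      then have "AE x in lebesgue. ennpow (g x) p0 * ennreal 1 * indicator Q x = 0"
        using wpos by eventually_elim (use p in \<open>auto simp: ennpow_eq_0_iff\<close>)
      then have "(\<integral>\<^sup>+x\<in>Q. ennpow (g x) p0 * ennreal 1 \<partial>lebesgue) = 0"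
        by (subst nn_integral_0_iff_AE) auto
      then have "X \<le> 0"
        using hyp[OF one_in_Ap[of p0]] p by (simp add: Q_def)
      then show ?thesis by (simp add: order_trans)
    next
      case 2
      have "\<Phi> / wmeas w Q = top" using 2 wQ by (simp add: ennreal_top_divide)
      moreover have "0 < c * \<psi> t" using \<psi>(2)[OF t] c by simp
      ultimately show ?thesis using p by (simp add: ennreal_mult_top ennreal_eq_0_iff not_le)
    next
      case 3
      define h where "h x = g x * indicator Q x" for x
      have [measurable]: "h \<in> borel_measurable lebesgue" unfolding h_def by measurable
      have hp: "(\<integral>\<^sup>+x. ennpow (h x) p * ennreal (w x) \<partial>lebesgue) = \<Phi>"
        unfolding \<Phi>_def h_def using p by (intro nn_integral_cong) (auto simp: indicator_def)
      obtain R where [measurable]: "R \<in> borel_measurable lebesgue" and R: "\<And>x. h x \<le> R x"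
        "\<And>x. cube_max R x \<le> 4 * hl_norm p w * R x"
        and Rp: "(\<integral>\<^sup>+x. ennpow (R x) p * ennreal (w x) \<partial>lebesgue) \<le> ennreal (2 powr (p + 1)) * \<Phi>"
        using Rubio_de_Francia[OF p(1) w, of h] unfolding hp by auto
      define k where "k = 6 ^ CARD('n) * 4 * hl_const TYPE('n) p powr (1 / p)"
      have k: "0 < k" using hl_const_pos[OF p(1), where 'n = 'n] by (simp add: k_def)
      define K where "K = 6 ^ CARD('n) * (4 * hl_norm p w)"
      have K: "K = ennreal (k * A powr (1 / (p - 1)))"
      proof -
        have "ennreal (6 ^ CARD('n)) = 6 ^ CARD('n)" using ennreal_power[of 6 "CARD('n)"] by simp
        then show ?thesis
          unfolding K_def hl_norm_eq[OF p(1)] k_def using A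
          by (simp add: ennreal_mult ennpow_ennreal mult.assoc)
      qed
      have A1: "(\<integral>\<^sup>+y\<in>cube b s. R y \<partial>lebesgue) / emeasure lebesgue (cube b s) \<le> K * R x"
        if "0 < s" "x \<in> cube b s" for b s x
      proof -
        have "(\<integral>\<^sup>+y\<in>cube b s. R y \<partial>lebesgue) / emeasure lebesgue (cube b s) \<le> 6 ^ CARD('n) * cube_max R x"
          by (rule cube_mean_le_cube_max[OF that])
        also have "\<dots> \<le> 6 ^ CARD('n) * (4 * hl_norm p w * R x)"
          by (intro mult_left_mono R) auto
        finally show ?thesis by (simp add: K_def mult.assoc)
      qed
      \<comment> \<open>A zero of \<open>R\<close> at one point forces mean 0 on every cube
        containing that point. Taking a cube that also contains \<open>Q\<close> gives
        \<open>h = 0\<close> a.e., against \<open>0 < \<Phi>\<close>.\<close>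
      have Rpos: "0 < R x" for x
      proof (rule ccontr)
        assume "\<not> 0 < R x"
        then have R0: "R x = 0" by simp
        have "bounded (insert x Q)" by (simp add: Q_def compact_imp_bounded compact_cube)
        then obtain m :: nat where m: "0 < m" "insert x Q \<subseteq> cube (\<chi> i. - real m) (2 * real m)"
          using bounded_subset_cube by metis
        let ?D = "cube (\<chi> i. - real m) (2 * real m) :: (real ^ 'n) set"
        have "(\<integral>\<^sup>+y\<in>?D. R y \<partial>lebesgue) / emeasure lebesgue ?D \<le> K * R x"
          using m by (intro A1) auto
        then have "(\<integral>\<^sup>+y\<in>?D. R y \<partial>lebesgue) = 0"
          using emeasure_cube_pos[of "2 * real m" "\<chi> i. - real m"] m R0
          by (auto simp: ennreal_divide_eq_0_iff less_top[symmetric])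
        then have "AE y in lebesgue. R y * indicator ?D y = 0"
          by (subst (asm) nn_integral_0_iff_AE) auto
        then have "AE y in lebesgue. ennpow (h y) p * ennreal (w y) = 0"
        proof eventually_elim
          case (elim y)
          have "h y = 0"
            using elim R(1)[of y] m(2) by (cases "y \<in> Q") (auto simp: h_def)
          then show ?case using p by simp
        qed
        then have "\<Phi> = 0" unfolding hp[symmetric] by (subst nn_integral_0_iff_AE) auto
        then show False using 3 by simp
      qed
      have Rfin: "AE x in lebesgue. R x < top"
      proof -
        have "ennreal (2 powr (p + 1)) * \<Phi> < top" using 3 by (simp add: ennreal_mult_less_top)
        with Rp have "(\<integral>\<^sup>+x. ennpow (R x) p * ennreal (w x) \<partial>lebesgue) < top" by (rule le_less_trans)
        then have "AE x in lebesgue. ennpow (R x) p * ennreal (w x) \<noteq> \<infinity>"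
          by (intro nn_integral_noteq_infinite) auto
        then show ?thesis
          using wpos by eventually_elim
            (use p in \<open>auto simp: less_top[symmetric] ennreal_top_mult ennreal_eq_0_iff\<close>)
      qed
      define v where "v x = w x * enn2real (R x) powr (p - p0)" for x
      have Kfin: "K < top" by (simp add: K)
      have v: "v \<in> Ap p0" "Ap_const p0 v \<le> ennpow K (p0 - p) * Ap_const p w"
        "AE x in lebesgue. ennreal (v x) = ennreal (w x) * ennpow (R x) (p - p0)"
        using Ap_times_A1_power[OF p w _ Rpos Rfin A1 Kfin] unfolding v_def by auto
      have [measurable]: "v \<in> borel_measurable lebesgue" using v(1) by (rule Ap_measurable)
      have p0: "1 < p0" using p by simp
      have vQ: "0 < wmeas v Q" "wmeas v Q < top"
        using Ap_wmeas_pos[OF p0 v(1) l] Ap_wmeas_finite[OF v(1)] by (auto simp: Q_def)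
      have "enn2real (Ap_const p0 v) \<le> t"
      proof -
        have "ennpow K (p0 - p) * Ap_const p w = ennreal ((k * A powr (1 / (p - 1))) powr (p0 - p) * A)"
        proof -
          have "0 < k * A powr (1 / (p - 1))" using k A by simp
          then show ?thesis
            unfolding K A(1) using A by (subst ennpow_ennreal) (auto simp: ennreal_mult)
        qed
        also have "(k * A powr (1 / (p - 1))) powr (p0 - p) * A
            = k powr (p0 - p) * A powr ((p0 - 1) / (p - 1))"
        proof -
          \<comment> \<open>The origin of the exponent in the theorem: the maximal operator
            contributes 1/(p-1), raised to the power \<open>p0 - p\<close>, and one more factor is
            the constant of \<open>w\<close> itself.\<close>
          have "(p0 - 1) / (p - 1) = 1 / (p - 1) * (p0 - p) + 1" using p by (simp add: field_simps)
          then have "A powr ((p0 - 1) / (p - 1)) = A powr (1 / (p - 1) * (p0 - p)) * A"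
            using A by (simp only: powr_add) simp
          then show ?thesis using k A by (simp add: powr_mult powr_powr)
        qed
        also have "ennreal \<dots> \<le> ennreal t"
          unfolding t_def C_def extrapol_const_def k_def
          by (intro ennreal_leI mult_right_mono) auto
        finally have "Ap_const p0 v \<le> ennreal t" using v(2) by simp
        then show ?thesis using t by (simp add: enn2real_leI)
      qed
      moreover have "1 \<le> enn2real (Ap_const p0 v)"
      proof -
        have b: "1 \<le> Ap_const p0 v" "Ap_const p0 v < top" by (rule Ap_const_bounds[OF p0 v(1)])+
        then show ?thesis by (cases "Ap_const p0 v" rule: ennreal_cases3) auto
      qed
      ultimately have \<psi>t: "\<psi> (enn2real (Ap_const p0 v)) \<le> \<psi> t"
        using t by (intro mono_onD[OF \<psi>(1)]) auto
      \<comment> \<open>As \<open>g \<le> R\<close> on \<open>Q\<close>, the surplus power of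
        \<open>g\<close> is absorbed by the negative power of \<open>R\<close> in
        \<open>v\<close>.\<close>
      have num: "(\<integral>\<^sup>+x\<in>Q. ennpow (g x) p0 * ennreal (v x) \<partial>lebesgue) \<le> \<Phi>"
        unfolding \<Phi>_def
      proof (rule nn_integral_mono_AE, use v(3) Rfin in eventually_elim)
        case (elim x)
        obtain r where r: "R x = ennreal r" "0 < r"
          using elim Rpos[of x] by (cases "R x" rule: ennreal_cases3) auto
        have "ennpow (g x) p0 * ennreal (v x) \<le> ennpow (g x) p * ennreal (w x)" if "x \<in> Q"
        proof -
          have "g x \<le> R x" using R(1)[of x] that by (simp add: h_def)
          then have "ennpow (g x) (p0 - p) * ennpow (R x) (p - p0)
              \<le> ennpow (R x) (p0 - p) * ennpow (R x) (p - p0)"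
            using p by (intro mult_right_mono ennpow_mono) auto
          also have "\<dots> = 1"
            using r powr_add[of r "p0 - p" "p - p0"] by (simp add: ennpow_ennreal flip: ennreal_mult)
          finally have le: "ennpow (g x) (p0 - p) * ennpow (R x) (p - p0) \<le> 1" .
          have "ennpow (g x) p0 = ennpow (g x) p * ennpow (g x) (p0 - p)"
            using ennpow_add[of p "p0 - p" "g x"] p by simp
          then have "ennpow (g x) p0 * ennreal (v x)
              = (ennpow (g x) p * ennreal (w x)) * (ennpow (g x) (p0 - p) * ennpow (R x) (p - p0))"
            by (simp add: elim mult_ac)
          also have "\<dots> \<le> (ennpow (g x) p * ennreal (w x)) * 1"
            by (intro mult_left_mono le) simp
          finally show ?thesis by simp
        qed
        then show ?case by (auto simp: indicator_def)
      qed
      \<comment> \<open>The denominator needs a lower bound for the \<open>v\<close>-mass of the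
        cube. It comes from writing \<open>w\<close> as v^\<open>\<theta>\<close> (R^p
        w)^(1-\<open>\<theta>\<close>), in which the powers of \<open>R\<close> cancel, and from the
        norm bound for \<open>R\<close>. The factor \<open>2 powr (p + 1)\<close> there becomes
        \<open>c\<close> after the powers \<open>1 - \<theta>\<close> and
        \<open>1 / p\<close>.\<close>
      define \<theta> where "\<theta> = p / p0"
      have \<theta>: "0 < \<theta>" "\<theta> < 1" using p by (auto simp: \<theta>_def)
      have "wmeas w Q \<le> (\<integral>\<^sup>+x. ennpow (ennreal (v x) * indicator Q x) \<theta> *
          ennpow (ennpow (R x) p * ennreal (w x)) (1 - \<theta>) \<partial>lebesgue)"
        unfolding wmeas_def
      proof (rule nn_integral_mono_AE, use v(3) Rfin wpos in eventually_elim)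
        case (elim x)
        obtain r where r: "R x = ennreal r" "0 < r"
          using elim Rpos[of x] by (cases "R x" rule: ennreal_cases3) auto
        have e: "(p - p0) * \<theta> + p * (1 - \<theta>) = 0" using p by (simp add: \<theta>_def field_simps)
        have "ennpow (ennreal (v x)) \<theta> * ennpow (ennpow (R x) p * ennreal (w x)) (1 - \<theta>)
            = ennreal ((w x powr \<theta> * w x powr (1 - \<theta>)) * (r powr ((p - p0) * \<theta>) * r powr (p * (1 - \<theta>))))"
          using elim r \<theta> by (simp add: ennpow_ennreal powr_mult powr_powr mult_ac flip: ennreal_mult)
        also have "\<dots> = ennreal (w x)"
          using elim r by (simp add: e flip: powr_add)
        finally show ?case by (auto simp: indicator_def)
      qed
      also have "\<dots> \<le> ennpow (\<integral>\<^sup>+x\<in>Q. ennreal (v x) \<partial>lebesgue) \<theta> *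
          ennpow (\<integral>\<^sup>+x. ennpow (R x) p * ennreal (w x) \<partial>lebesgue) (1 - \<theta>)"
        by (intro nn_integral_Hoelder \<theta>) measurable
      also have "\<dots> \<le> ennpow (wmeas v Q) \<theta> * ennpow (ennreal (2 powr (p + 1)) * \<Phi>) (1 - \<theta>)"
        unfolding wmeas_def using \<theta> by (intro mult_left_mono ennpow_mono Rp) auto
      finally have main: "wmeas w Q \<le> ennpow (wmeas v Q) \<theta> * ennpow (ennreal (2 powr (p + 1)) * \<Phi>) (1 - \<theta>)" .
      obtain F where F: "\<Phi> = ennreal F" "0 < F" using 3 by (cases \<Phi> rule: ennreal_cases3) auto
      obtain \<omega> where \<omega>: "wmeas w Q = ennreal \<omega>" "0 < \<omega>" using wQ by (cases "wmeas w Q" rule: ennreal_cases3) auto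
      obtain \<nu> where \<nu>: "wmeas v Q = ennreal \<nu>" "0 < \<nu>" using vQ by (cases "wmeas v Q" rule: ennreal_cases3) auto
      have "\<omega> \<le> \<nu> powr \<theta> * (2 powr (p + 1) * F) powr (1 - \<theta>)"
        using main F \<omega> \<nu> \<theta> by (simp add: ennpow_ennreal flip: ennreal_mult)
      then have "\<omega> powr (1 / p) \<le> (\<nu> powr \<theta> * (2 powr (p + 1) * F) powr (1 - \<theta>)) powr (1 / p)"
        using p \<omega> by (intro powr_mono2) auto
      also have "\<dots> = \<nu> powr (1 / p0) * (c * F powr (1 / p - 1 / p0))"
      proof -
        have "\<theta> * (1 / p) = 1 / p0" "(1 - \<theta>) * (1 / p) = 1 / p - 1 / p0"
          using p by (auto simp: \<theta>_def field_simps)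
        then show ?thesis by (simp only: powr_mult powr_powr c_def mult.assoc)
      qed
      finally have "F powr (1 / p0) * \<omega> powr (1 / p)
          \<le> F powr (1 / p0) * (\<nu> powr (1 / p0) * (c * F powr (1 / p - 1 / p0)))"
        by (intro mult_left_mono) auto
      also have "\<dots> = c * F powr (1 / p) * \<nu> powr (1 / p0)"
        using F powr_add[of F "1 / p0" "1 / p - 1 / p0"] by simp
      finally have "(F / \<nu>) powr (1 / p0) \<le> c * (F / \<omega>) powr (1 / p)"
        using F \<omega> \<nu> by (simp add: powr_divide field_simps)
      then have avg: "ennpow (\<Phi> / wmeas v Q) (1 / p0) \<le> ennreal c * ennpow (\<Phi> / wmeas w Q) (1 / p)"
        using F \<omega> \<nu> c by (simp add: divide_ennreal ennpow_ennreal flip: ennreal_mult)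
      have "X \<le> ennreal (\<psi> (enn2real (Ap_const p0 v))) *
          ennpow ((\<integral>\<^sup>+x\<in>Q. ennpow (g x) p0 * ennreal (v x) \<partial>lebesgue) / wmeas v Q) (1 / p0)"
        using hyp[OF v(1)] by (simp add: Q_def)
      also have "\<dots> \<le> ennreal (\<psi> t) * ennpow (\<Phi> / wmeas v Q) (1 / p0)"
        using p by (intro mult_mono ennreal_leI \<psi>t ennpow_mono divide_right_mono_ennreal num) auto
      also have "\<dots> \<le> ennreal (\<psi> t) * (ennreal c * ennpow (\<Phi> / wmeas w Q) (1 / p))"
        by (intro mult_left_mono avg) simp
      also have "\<dots> = ennreal (c * \<psi> t) * ennpow (\<Phi> / wmeas w Q) (1 / p)"
        using c \<psi>(2)[OF t] by (simp add: ennreal_mult mult_ac)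
      finally show ?thesis .
    qed
  qed
  then show ?thesis
    using A by (simp add: t_def C_def c_def \<Phi>_def Q_def)
qed

subsection \<open>Self-improvement of oscillation estimates\<close>

text \<open>
  Outer regularity takes the place of the Lebesgue differentiation theorem in the
  Calderon-Zygmund decomposition.
\<close>

lemma null_set_of_cover_le:
  fixes U :: "real ^ 'n \<Rightarrow> ennreal"
  assumes [measurable]: "U \<in> borel_measurable lebesgue" "A \<in> sets lebesgue"
    and fin: "emeasure lebesgue A < top" and t: "t < top"
    and cover: "\<And>T. open T \<Longrightarrow> A \<subseteq> T \<Longrightarrow>
      \<exists>N. N \<in> sets lebesgue \<and> A \<subseteq> N \<and> N \<subseteq> T \<and> (\<integral>\<^sup>+x\<in>N. U x \<partial>lebesgue) \<le> t * emeasure lebesgue N"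
    and e: "0 < e" "\<And>x. x \<in> A \<Longrightarrow> t + ennreal e \<le> U x"
  shows "A \<in> null_sets lebesgue"
proof (rule ccontr)
  assume "A \<notin> null_sets lebesgue"
  then have "emeasure lebesgue A \<noteq> 0" by (auto simp: null_sets_def)
  with fin obtain \<alpha> where \<alpha>: "emeasure lebesgue A = ennreal \<alpha>" "0 < \<alpha>"
    by (cases "emeasure lebesgue A" rule: ennreal_cases3) auto
  obtain \<tau> where \<tau>: "t = ennreal \<tau>" "0 \<le> \<tau>" using t by (cases t) auto
  \<comment> \<open>The excess \<open>e * \<alpha>\<close> on \<open>A\<close> has to be paid by
    \<open>\<tau> * \<delta>\<close>, which this choice makes at most half of it. The
    \<open>+ 1\<close> covers \<open>\<tau> = 0\<close>.\<close>
  define \<delta> where "\<delta> = e * \<alpha> / (2 * (\<tau> + 1))"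
  have \<delta>: "0 < \<delta>" using e \<alpha> \<tau> by (simp add: \<delta>_def)
  obtain T where T: "open T" "A \<subseteq> T" "T - A \<in> lmeasurable" "emeasure lebesgue (T - A) < ennreal \<delta>"
    using sets_lebesgue_outer_open[OF assms(2) \<delta>] by metis
  obtain N where N [measurable]: "N \<in> sets lebesgue" and N': "A \<subseteq> N" "N \<subseteq> T"
    "(\<integral>\<^sup>+x\<in>N. U x \<partial>lebesgue) \<le> t * emeasure lebesgue N"
    using cover[OF T(1,2)] by blast
  have "ennreal ((\<tau> + e) * \<alpha>) = (t + ennreal e) * emeasure lebesgue A"
    using \<tau> \<alpha> e by (simp add: ennreal_mult ennreal_plus)
  also have "\<dots> = (\<integral>\<^sup>+x. (t + ennreal e) * indicator A x \<partial>lebesgue)"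
    by (simp add: nn_integral_cmult_indicator)
  also have "\<dots> \<le> (\<integral>\<^sup>+x\<in>N. U x \<partial>lebesgue)"
    using e(2) N'(1) by (intro nn_integral_mono) (auto simp: indicator_def)
  also have "\<dots> \<le> t * emeasure lebesgue N" by (rule N')
  also have "\<dots> \<le> t * (emeasure lebesgue A + emeasure lebesgue (T - A))"
  proof (intro mult_left_mono)
    have "emeasure lebesgue N \<le> emeasure lebesgue (A \<union> (T - A))"
      using N' T by (intro emeasure_mono) auto
    also have "\<dots> \<le> emeasure lebesgue A + emeasure lebesgue (T - A)"
      using T by (intro emeasure_subadditive) (auto simp: fmeasurableD)
    finally show "emeasure lebesgue N \<le> emeasure lebesgue A + emeasure lebesgue (T - A)" .
  qed simp
  also have "\<dots> \<le> t * (ennreal \<alpha> + ennreal \<delta>)"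
    using T \<alpha> by (intro mult_left_mono add_mono) auto
  also have "\<dots> = ennreal (\<tau> * (\<alpha> + \<delta>))"
    using \<tau> \<alpha> \<delta> by (simp add: ennreal_mult ennreal_plus)
  finally have "(\<tau> + e) * \<alpha> \<le> \<tau> * (\<alpha> + \<delta>)"
    using \<tau> \<alpha> \<delta> by (subst (asm) ennreal_le_iff) auto
  then have "e * \<alpha> \<le> \<tau> * \<delta>" by (simp add: algebra_simps)
  also have "\<dots> \<le> (\<tau> + 1) * \<delta>" using \<delta> by simp
  also have "\<dots> = e * \<alpha> / 2" using \<tau> by (simp add: \<delta>_def field_simps)
  finally have "e * \<alpha> \<le> e * \<alpha> / 2" .
  moreover have "0 < e * \<alpha>" using e \<alpha> by simp
  ultimately show False by linarith
qed

text \<open>The selected cubes are the maximal dyadic subcubes with mean above \<open>t\<close>,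
  found as first passages by \<open>disjointed\<close>. Their parents have mean at most
  \<open>t\<close>, which costs the factor \<open>2 ^ CARD('n)\<close>.\<close>

lemma Calderon_Zygmund:
  fixes a :: "real ^ 'n" and u :: "real ^ 'n \<Rightarrow> ennreal"
  assumes l: "0 < l" and [measurable]: "u \<in> borel_measurable lebesgue" and t: "t < top"
    and int: "(\<integral>\<^sup>+x\<in>hcube a l. u x \<partial>lebesgue) \<le> t * emeasure lebesgue (hcube a l)"
  obtains S :: "((real ^ 'n) \<times> real) set" where "countable S"
    "\<And>b s. (b, s) \<in> S \<Longrightarrow> 0 < s \<and> hcube b s \<subseteq> hcube a l"
    "disjoint_family_on (\<lambda>(b, s). hcube b s) S"
    "\<And>b s. (b, s) \<in> S \<Longrightarrow> t * emeasure lebesgue (hcube b s) \<le> (\<integral>\<^sup>+x\<in>hcube b s. u x \<partial>lebesgue)"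
    "\<And>b s. (b, s) \<in> S \<Longrightarrow>
      (\<integral>\<^sup>+x\<in>hcube b s. u x \<partial>lebesgue) \<le> 2 ^ CARD('n) * t * emeasure lebesgue (hcube b s)"
    "AE x in lebesgue. x \<in> hcube a l \<longrightarrow> x \<notin> (\<Union>(b, s)\<in>S. hcube b s) \<longrightarrow> u x \<le> t"
proof -
  \<comment> \<open>Based at \<open>a\<close> with scale \<open>l\<close> and no shift, so the given
    cube is exactly one cell of level 0 and only non-negative levels matter.\<close>
  interpret dyadic_grid a l "\<lambda>_. 0" by unfold_locales (use l in auto)
  define ix where "ix = grid_index a l (\<lambda>_. 0)"
  define cell where "cell k x = atom lebesgue ix (int k) x" for k :: nat and x
  define H where "H = hcube a l"
  have [measurable]: "H \<in> sets lebesgue" by (simp add: H_def)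
  have [measurable]: "cell k x \<in> sets lebesgue" for k x unfolding cell_def ix_def by (rule atom_sets)
  have cell: "cell k x = hcube (corner k (ix k x)) (l / 2 ^ k)" for k x
    by (simp add: cell_def ix_def atom_eq_hcube powr_realpow)
  have cell_self: "x \<in> cell k x" for k x by (simp add: cell_def atom_def)
  have cell_eq: "cell k y = cell k x" if "y \<in> cell k x" for k x y
    using that by (auto simp: cell_def atom_def)
  have cell_mono: "cell j x \<subseteq> cell k x" if "k \<le> j" for j k x
  proof
    fix y assume "y \<in> cell j x"
    then have "ix (int j) y = ix (int j) x" by (simp add: cell_def atom_def)
    then have "ix (int k) y = ix (int k) x"
      using that unfolding ix_def by (intro nested_le[of "int k" "int j" y x]) auto
    then show "y \<in> cell k x" by (simp add: cell_def atom_def)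
  qed
  have ix0: "ix 0 x = 0" if "x \<in> H" for x
  proof -
    have "corner 0 0 = a" by (simp add: corner_def vec_eq_iff)
    then show ?thesis using that by (simp add: ix_def grid_index_eq_iff H_def)
  qed
  have at0: "cell 0 x = H" if "x \<in> H" for x
  proof -
    have "corner 0 0 = a" by (simp add: corner_def vec_eq_iff)
    then show ?thesis using ix0[OF that] by (simp add: cell H_def)
  qed
  have cell_sub: "cell k x \<subseteq> H" if "x \<in> H" for k x
    using cell_mono[of 0 k x] at0[OF that] by simp
  have em: "emeasure lebesgue (cell k x) = ennreal ((l / 2 ^ k) ^ CARD('n))" for k x
    using l by (simp add: cell emeasure_hcube emeasure_cube)
  define avg where "avg k x = (\<integral>\<^sup>+y\<in>cell k x. u y \<partial>lebesgue) / emeasure lebesgue (cell k x)" for k x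
  have avg_eq: "avg k y = avg k x" if "y \<in> cell k x" for k x y
    using cell_eq[OF that] by (simp add: avg_def)
  have avg_le: "(\<integral>\<^sup>+y\<in>cell k x. u y \<partial>lebesgue) \<le> t * emeasure lebesgue (cell k x)" if "avg k x \<le> t" for k x
  proof -
    have "(\<integral>\<^sup>+y\<in>cell k x. u y \<partial>lebesgue) = avg k x * emeasure lebesgue (cell k x)"
      unfolding avg_def em using l by (simp add: ennreal_divide_times ennreal_divide_self ennreal_eq_0_iff not_le)
    then show ?thesis using that by (simp add: mult_right_mono)
  qed
  define E where "E k = {x \<in> H. t < avg k x}" for k
  define F where "F = disjointed E"
  \<comment> \<open>The assumption on the whole cube says that it is never selected; hence every
    selected cube has a parent inside it.\<close>
  have E0: "E 0 = {}"
  proof -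
    have "avg 0 x \<le> t" if "x \<in> H" for x
    proof -
      have "avg 0 x \<le> t * emeasure lebesgue H / emeasure lebesgue H"
        unfolding avg_def at0[OF that] using int by (intro divide_right_mono_ennreal) (simp add: H_def)
      also have "\<dots> = t"
        using emeasure_cube_pos[OF l, of a] unfolding H_def emeasure_hcube
        by (intro mult_divide_eq_ennreal) auto
      finally show ?thesis .
    qed
    then show ?thesis by (auto simp: E_def not_less)
  qed
  have sat: "cell k x \<subseteq> F k" if "x \<in> F k" for k x
  proof
    fix y assume y: "y \<in> cell k x"
    have xH: "x \<in> H" using that by (auto simp: F_def disjointed_def E_def)
    have "y \<in> E i \<longleftrightarrow> x \<in> E i" if "i \<le> k" for i
    proof -
      have "y \<in> cell i x" using cell_mono[OF that] y by blast
      then show ?thesis using cell_sub[OF xH] xH by (auto simp: E_def avg_eq)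
    qed
    then show "y \<in> F k" using that by (auto simp: F_def disjointed_def)
  qed
  \<comment> \<open>All points of a cell yield the same pair, so \<open>S\<close> indexes cells
    rather than points, and it is countable because the labels are.\<close>
  define S where "S = {(corner k (ix k x), l / 2 ^ k) | k x. x \<in> F k}"
  have S: "\<exists>k x. x \<in> F k \<and> b = corner k (ix k x) \<and> s = l / 2 ^ k \<and> hcube b s = cell k x" if "(b, s) \<in> S" for b s
    using that by (auto simp: S_def cell)
  have US: "(\<Union>(b, s)\<in>S. hcube b s) = (\<Union>k. E k)"
  proof -
    have "(\<Union>(b, s)\<in>S. hcube b s) = (\<Union>k. F k)"
    proof (intro equalityI subsetI)
      fix z assume "z \<in> (\<Union>(b, s)\<in>S. hcube b s)"
      then obtain k x where "x \<in> F k" "z \<in> cell k x" using S by fastforce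
      then show "z \<in> (\<Union>k. F k)" using sat by blast
    next
      fix z assume "z \<in> (\<Union>k. F k)"
      then obtain k where "z \<in> F k" by blast
      then have "(corner k (ix k z), l / 2 ^ k) \<in> S" "z \<in> hcube (corner k (ix k z)) (l / 2 ^ k)"
        using cell_self[of z k] by (auto simp: S_def cell)
      then show "z \<in> (\<Union>(b, s)\<in>S. hcube b s)" by blast
    qed
    then show ?thesis by (simp add: F_def UN_disjointed_eq)
  qed
  show ?thesis
  proof (rule that[of S])
    have "S \<subseteq> range (\<lambda>(k :: nat, m). (corner k m, l / 2 ^ k))"
      by (auto simp: S_def)
    then show "countable S" by (rule countable_subset) auto
  next
    fix b s assume "(b, s) \<in> S"
    then obtain k x where k: "x \<in> F k" "s = l / 2 ^ k" "hcube b s = cell k x" using S by blast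
    have x: "x \<in> H" "x \<in> E k" "\<And>j. j < k \<Longrightarrow> x \<notin> E j"
      using k(1) by (auto simp: F_def disjointed_def E_def)
    show "0 < s \<and> hcube b s \<subseteq> hcube a l"
      using k cell_sub[OF x(1)] l by (simp add: H_def)
    show "t * emeasure lebesgue (hcube b s) \<le> (\<integral>\<^sup>+x\<in>hcube b s. u x \<partial>lebesgue)"
      using x(2) unfolding k(3) E_def avg_def by (auto intro: ennreal_mult_le_of_less_divide)
    have "k \<noteq> 0" using x(2) E0 by (cases k) auto
    then obtain j where j: "k = Suc j" by (cases k) auto
    have "avg j x \<le> t" using x(1) x(3)[of j] j by (auto simp: E_def)
    have "(\<integral>\<^sup>+y\<in>cell k x. u y \<partial>lebesgue) \<le> (\<integral>\<^sup>+y\<in>cell j x. u y \<partial>lebesgue)"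
      using cell_mono[of j k x] j by (intro nn_integral_mono) (auto simp: indicator_def)
    also have "\<dots> \<le> t * emeasure lebesgue (cell j x)" by (rule avg_le) fact
    also have "emeasure lebesgue (cell j x) = 2 ^ CARD('n) * emeasure lebesgue (cell k x)"
    proof -
      have "(l / 2 ^ j) ^ CARD('n) = 2 ^ CARD('n) * (l / 2 ^ k) ^ CARD('n)"
        by (simp add: j flip: power_mult_distrib)
      moreover have "ennreal (2 ^ CARD('n)) = 2 ^ CARD('n)"
        using ennreal_power[of 2 "CARD('n)"] by simp
      ultimately show ?thesis using l unfolding em by (simp add: ennreal_mult)
    qed
    finally show "(\<integral>\<^sup>+x\<in>hcube b s. u x \<partial>lebesgue) \<le> 2 ^ CARD('n) * t * emeasure lebesgue (hcube b s)"
      unfolding k(3) by (simp only: mult_ac)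
  next
    show "disjoint_family_on (\<lambda>(b, s). hcube b s) S"
      unfolding disjoint_family_on_def
    proof (intro ballI impI)
      fix P P' assume P: "P \<in> S" "P' \<in> S" "P \<noteq> P'"
      obtain k x where k: "x \<in> F k" "P = (corner k (ix k x), l / 2 ^ k)" using P(1) by (auto simp: S_def)
      obtain j y where j: "y \<in> F j" "P' = (corner j (ix j y), l / 2 ^ j)" using P(2) by (auto simp: S_def)
      have False if z: "z \<in> cell k x" "z \<in> cell j y" for z
      proof -
        have "z \<in> F k" "z \<in> F j" using sat[OF k(1)] sat[OF j(1)] z by auto
        then have kj: "k = j"
          using disjoint_family_disjointed[of E] by (auto simp: F_def disjoint_family_on_def)
        have "ix k z = ix k x" "ix j z = ix j y" using z by (auto simp: cell_def atom_def)
        then show False using kj k j P(3) by simp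
      qed
      then show "(case P of (b, s) \<Rightarrow> hcube b s) \<inter> (case P' of (b, s) \<Rightarrow> hcube b s) = {}"
        unfolding k(2) j(2) by (auto simp: cell[symmetric])
    qed
  next
    define B where "B = {x \<in> H. \<forall>k. avg k x \<le> t}"
    have avg_meas [measurable]: "avg k \<in> borel_measurable lebesgue" for k
    proof -
      have "avg k = atom_mean lebesgue (grid_index a l (\<lambda>_. 0)) (int k) u"
        by (simp add: avg_def atom_mean_def cell_def ix_def fun_eq_iff)
      then show ?thesis using atom_mean_measurable by simp
    qed
    have [measurable]: "B \<in> sets lebesgue"
    proof -
      have "B = H \<inter> {x \<in> space lebesgue. \<forall>k. avg k x \<le> t}" by (auto simp: B_def)
      also have "\<dots> \<in> sets lebesgue" by measurable
      finally show ?thesis .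
    qed
    define A where "A j = {x \<in> B. t + ennreal (1 / Suc j) \<le> u x}" for j :: nat
    have Am [measurable]: "A j \<in> sets lebesgue" for j
    proof -
      have "A j = B \<inter> {x \<in> space lebesgue. t + ennreal (1 / Suc j) \<le> u x}" by (auto simp: A_def)
      also have "\<dots> \<in> sets lebesgue" by measurable
      finally show ?thesis .
    qed
    have "A j \<in> null_sets lebesgue" for j
    proof (rule null_set_of_cover_le[of u "A j" t "1 / Suc j"])
      have "emeasure lebesgue (A j) \<le> emeasure lebesgue H"
        by (intro emeasure_mono) (auto simp: A_def B_def)
      then show "emeasure lebesgue (A j) < top"
        using emeasure_cube_pos[OF l, of a] unfolding H_def emeasure_hcube by (auto intro: le_less_trans)
      fix T assume T: "open T" "A j \<subseteq> T"
      \<comment> \<open>Level-k cells inside \<open>T\<close> with mean at most \<open>t\<close>.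
        They cover \<open>A j\<close>, since all means at points of \<open>B\<close> are small and
        cells shrink to points; made disjoint level by level, they keep the mean bound for their
        union.\<close>
      define N where "N k = {x \<in> H. avg k x \<le> t \<and> cell k x \<subseteq> T}" for k
      have satN: "y \<in> N i" if "x \<in> N i" "y \<in> cell i x" for x y i
        using that cell_sub[of x i] cell_eq[of y i x] avg_eq[of y i x] by (auto simp: N_def)
      have satN': "y \<in> N i \<longleftrightarrow> x \<in> N i" if "y \<in> cell k x" "i \<le> k" for x y i k
      proof -
        have "y \<in> cell i x" using cell_mono[of i k x] that by blast
        moreover from this have "x \<in> cell i y" using cell_eq[of y i x] cell_self[of x i] by simp
        ultimately show ?thesis using satN by blast
      qed
      have satG: "cell k x \<subseteq> disjointed N k" if "x \<in> disjointed N k" for x k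
        using that satN'[of _ k x] by (auto simp: disjointed_def)
      have Nm [measurable]: "N k \<in> sets lebesgue" for k
        by (rule sets_saturated[where k = "int k"]) (use satN in \<open>auto simp: cell_def ix_def\<close>)
      have "emeasure (density lebesgue u) (disjointed N k) \<le> emeasure (density lebesgue (\<lambda>_. t)) (disjointed N k)" for k
      proof (rule emeasure_saturated_le[where k = "int k"])
        fix x assume x: "x \<in> disjointed N k"
        then show "atom lebesgue (grid_index a l (\<lambda>_. 0)) (int k) x \<subseteq> disjointed N k"
          using satG by (simp add: cell_def ix_def)
        have "avg k x \<le> t" using x by (auto simp: disjointed_def N_def)
        from avg_le[OF this]
        show "emeasure (density lebesgue u) (atom lebesgue (grid_index a l (\<lambda>_. 0)) (int k) x)
            \<le> emeasure (density lebesgue (\<lambda>_. t)) (atom lebesgue (grid_index a l (\<lambda>_. 0)) (int k) x)"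
          unfolding cell_def ix_def
          by (simp add: emeasure_density nn_integral_cmult_indicator)
      qed auto
      then have "(\<Sum>k. emeasure (density lebesgue u) (disjointed N k))
          \<le> (\<Sum>k. emeasure (density lebesgue (\<lambda>_. t)) (disjointed N k))"
        by (intro suminf_le) auto
      moreover have "(\<Sum>k. emeasure m (disjointed N k)) = emeasure m (\<Union>k. N k)" if "sets m = sets lebesgue" for m
        using suminf_emeasure[of "disjointed N" m] sets.range_disjointed_sets[of N lebesgue] Nm that
        by (simp add: UN_disjointed_eq disjoint_family_disjointed image_subset_iff)
      ultimately have le: "(\<integral>\<^sup>+x\<in>(\<Union>k. N k). u x \<partial>lebesgue) \<le> t * emeasure lebesgue (\<Union>k. N k)"
        by (simp add: emeasure_density nn_integral_cmult_indicator)
      have "A j \<subseteq> (\<Union>k. N k)"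
      proof
        fix x assume x: "x \<in> A j"
        then have "x \<in> T" using T by blast
        then obtain r where r: "0 < r" "ball x r \<subseteq> T" using T(1) open_contains_ball by metis
        \<comment> \<open>The distance within a cell is bounded by the sum of its sides, hence the
          factor \<open>CARD('n)\<close>.\<close>
        obtain k :: nat where k: "real CARD('n) * l / r < 2 ^ k"
          using real_arch_pow[of 2 "real CARD('n) * l / r"] by auto
        have "cell k x \<subseteq> ball x r"
        proof
          fix y assume y: "y \<in> cell k x"
          have "\<bar>(x - y) $ i\<bar> \<le> l / 2 ^ k" for i
          proof -
            have "x \<in> cell k x" by (rule cell_self)
            with y show ?thesis unfolding cell mem_hcube by (auto simp: abs_le_iff dest!: spec[of _ i])
          qed
          then have "norm (x - y) \<le> (\<Sum>i\<in>(UNIV :: 'n set). l / 2 ^ k)"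
            by (intro order_trans[OF norm_le_l1_cart] sum_mono)
          also have "\<dots> < r" using k r by (simp add: field_simps)
          finally show "y \<in> ball x r" by (simp add: dist_norm)
        qed
        then have "x \<in> N k" using r x by (auto simp: N_def A_def B_def)
        then show "x \<in> (\<Union>k. N k)" by blast
      qed
      moreover have "(\<Union>k. N k) \<in> sets lebesgue" by measurable
      moreover have "(\<Union>k. N k) \<subseteq> T" using cell_self by (auto simp: N_def)
      ultimately show "\<exists>N. N \<in> sets lebesgue \<and> A j \<subseteq> N \<and> N \<subseteq> T \<and>
          (\<integral>\<^sup>+x\<in>N. u x \<partial>lebesgue) \<le> t * emeasure lebesgue N"
        using le by blast
    qed (use t in \<open>auto simp: A_def\<close>)
    then have "(\<Union>j. A j) \<in> null_sets lebesgue" by blast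
    then have "AE x in lebesgue. x \<notin> (\<Union>j. A j)" by (rule AE_not_in)
    then show "AE x in lebesgue. x \<in> hcube a l \<longrightarrow> x \<notin> (\<Union>(b, s)\<in>S. hcube b s) \<longrightarrow> u x \<le> t"
    proof eventually_elim
      case (elim x)
      show ?case
      proof (intro impI, rule ccontr)
        assume x: "x \<in> hcube a l" "x \<notin> (\<Union>(b, s)\<in>S. hcube b s)" "\<not> u x \<le> t"
        then have "x \<in> B" unfolding US by (auto simp: B_def E_def H_def not_less)
        have "\<exists>j. t + ennreal (1 / Suc j) \<le> u x"
        proof -
          obtain \<tau> where \<tau>: "t = ennreal \<tau>" "0 \<le> \<tau>" using t by (cases t) auto
          show ?thesis
          proof (cases "u x" rule: ennreal_cases3)
            case (2 r)
            then have "\<tau> < r" using x(3) \<tau> by (simp add: not_le ennreal_less_iff)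
            then obtain j :: nat where "1 / Suc j < r - \<tau>" using nat_approx_posE[of "r - \<tau>"] by auto
            then have "ennreal (\<tau> + 1 / Suc j) \<le> ennreal r" by (intro ennreal_leI) simp
            then show ?thesis using 2 \<tau> by (intro exI[of _ j]) (simp add: ennreal_plus[symmetric] del: ennreal_plus)
          qed (use x(3) in auto)
        qed
        then show False using \<open>x \<in> B\<close> elim by (auto simp: A_def)
      qed
    qed
  qed
qed

section \<open>From mean oscillation to weighted p-th powers\<close>

lemma avg_diff_le:
  fixes f :: "real ^ 'n \<Rightarrow> real"
  assumes "locally_integrable f" and l: "0 < l"
  shows "ennreal \<bar>avg f (cube a l) - c\<bar> * emeasure lebesgue (cube a l)
    \<le> (\<integral>\<^sup>+x\<in>cube a l. ennreal \<bar>f x - c\<bar> \<partial>lebesgue)"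
proof -
  let ?Q = "cube a l"
  have f: "set_integrable lebesgue ?Q f"
    using assms(1) compact_cube by (auto simp: locally_integrable_def)
  have em: "emeasure lebesgue ?Q = ennreal (measure lebesgue ?Q)" and m: "0 < measure lebesgue ?Q"
    using l by (simp_all add: measure_def emeasure_cube)
  have c: "set_integrable lebesgue ?Q (\<lambda>_. c)"
    using emeasure_cube_pos[OF l, of a]
    by (auto simp: set_integrable_def intro!: integrable_mult_left integrable_real_indicator)
  have "(LINT x:?Q|lebesgue. f x - c) = (LINT x:?Q|lebesgue. f x) - measure lebesgue ?Q * c"
    using set_integral_diff(2)[OF f c] by (simp add: set_lebesgue_integral_def)
  also have "\<dots> = (avg f ?Q - c) * measure lebesgue ?Q"
    using m by (simp add: avg_def field_simps)
  finally have eq: "(LINT x:?Q|lebesgue. f x - c) = (avg f ?Q - c) * measure lebesgue ?Q" .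
  have "ennreal \<bar>avg f ?Q - c\<bar> * emeasure lebesgue ?Q = ennreal (norm (LINT x:?Q|lebesgue. f x - c))"
    using m by (simp add: eq em abs_mult ennreal_mult)
  also have "\<dots> \<le> (\<integral>\<^sup>+x. ennreal (norm (indicator ?Q x *\<^sub>R (f x - c))) \<partial>lebesgue)"
    using set_integral_diff(1)[OF f c] unfolding set_lebesgue_integral_def set_integrable_def
    by (rule integral_norm_bound_ennreal)
  also have "\<dots> = (\<integral>\<^sup>+x\<in>?Q. ennreal \<bar>f x - c\<bar> \<partial>lebesgue)"
    by (intro nn_integral_cong) (auto simp: indicator_def)
  finally show ?thesis .
qed

lemma nn_integral_disjoint_le:
  assumes [measurable]: "\<phi> \<in> borel_measurable M" and S: "countable S" "disjoint_family_on D S"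
    and D: "\<And>i. i \<in> S \<Longrightarrow> D i \<in> sets M" "\<And>i. i \<in> S \<Longrightarrow> D i \<subseteq> Q" "Q \<in> sets M"
  shows "(\<integral>\<^sup>+i. (\<integral>\<^sup>+x\<in>D i. \<phi> x \<partial>M) \<partial>count_space S) \<le> (\<integral>\<^sup>+x\<in>Q. \<phi> x \<partial>M)"
proof -
  have "(\<integral>\<^sup>+i. (\<integral>\<^sup>+x\<in>D i. \<phi> x \<partial>M) \<partial>count_space S)
      = (\<integral>\<^sup>+i. emeasure (density M \<phi>) (D i) \<partial>count_space S)"
    using D by (intro nn_integral_cong) (simp add: emeasure_density)
  also have "\<dots> = emeasure (density M \<phi>) (\<Union>i\<in>S. D i)"
    using S D by (intro emeasure_UN_countable[symmetric]) auto
  also have "\<dots> \<le> emeasure (density M \<phi>) Q"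
    using D by (intro emeasure_mono) auto
  also have "\<dots> = (\<integral>\<^sup>+x\<in>Q. \<phi> x \<partial>M)"
    using D by (simp add: emeasure_density)
  finally show ?thesis .
qed

lemma borel_measurable_nn_integral_count_space:
  fixes f :: "'i \<Rightarrow> 'a \<Rightarrow> ennreal"
  assumes "countable I" and [measurable]: "\<And>i. i \<in> I \<Longrightarrow> f i \<in> borel_measurable M"
  shows "(\<lambda>x. \<integral>\<^sup>+i. f i x \<partial>count_space I) \<in> borel_measurable M"
proof (cases "finite I")
  case True
  then show ?thesis by (simp add: nn_integral_count_space_finite)
next
  case False
  then have "I \<noteq> {}" by auto
  have "(\<integral>\<^sup>+i. g i \<partial>count_space I) = (\<Sum>n. g (from_nat_into I n))" for g :: "'i \<Rightarrow> ennreal"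
    by (simp add: nn_integral_bij_count_space[symmetric, OF bij_betw_from_nat_into[OF assms(1) False]]
      nn_integral_count_space_nat)
  moreover have [measurable]: "f (from_nat_into I n) \<in> borel_measurable M" for n
    using \<open>I \<noteq> {}\<close> by (intro assms(2) from_nat_into)
  ultimately show ?thesis by simp
qed

text \<open>The fixed point of \<open>Y = (4 ^ CARD('n)) powr p + Y / 2 + 2 powr p * (8 ^ CARD('n))
  powr p\<close>: the part below the stopping height, the halved contribution of the stopping cubes,
  and the jumps of the averages. Being a fixed point, it survives every generation
  unchanged.\<close>

definition self_improvement_const :: "'n itself \<Rightarrow> real \<Rightarrow> real" where
  "self_improvement_const _ p = 2 * ((4 ^ CARD('n)) powr p + 2 powr p * (8 ^ CARD('n)) powr p)"

text \<open>One Calderon-Zygmund generation, with the inductive bound used on every stopping cube.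
  Leaving out an exceptional set replaces any a priori integrability of the p-th power; the step
  halves the measure of this set and reproduces the constant.\<close>

lemma self_improvement_step:
  fixes f w :: "real ^ 'n \<Rightarrow> real" and G :: "real ^ 'n \<Rightarrow> ennreal" and p \<kappa> :: real
  defines "Y \<equiv> self_improvement_const TYPE('n) p"
  assumes p: "1 < p" and f: "locally_integrable f" and w0: "\<And>x. 0 \<le> w x"
    and [measurable]: "w \<in> borel_measurable lebesgue" "G \<in> borel_measurable lebesgue"
    and w: "\<And>a l. 0 < l \<Longrightarrow> wmeas w (cube a l) \<in> {0<..<top}" and \<kappa>: "0 < \<kappa>"
    and osc: "\<And>a l. 0 < l \<Longrightarrow>
      (\<integral>\<^sup>+x\<in>cube a l. ennreal \<bar>f x - avg f (cube a l)\<bar> \<partial>lebesgue) / emeasure lebesgue (cube a l)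
      \<le> ennreal (\<kappa> * l) * ennpow ((\<integral>\<^sup>+x\<in>cube a l. G x \<partial>lebesgue) / wmeas w (cube a l)) (1 / p)"
    and IH: "\<And>b s. 0 < s \<Longrightarrow> \<exists>\<Omega>\<in>sets lebesgue.
      emeasure lebesgue \<Omega> \<le> ennreal ((1/2) ^ k) * emeasure lebesgue (cube b s) \<and>
      (\<integral>\<^sup>+x\<in>cube b s - \<Omega>. ennreal (\<bar>f x - avg f (cube b s)\<bar> powr p * w x) \<partial>lebesgue)
      \<le> ennreal (Y * (\<kappa> * s) powr p) * (\<integral>\<^sup>+x\<in>cube b s. G x \<partial>lebesgue)"
    and l: "0 < l"
  shows "\<exists>\<Omega>\<in>sets lebesgue.
      emeasure lebesgue \<Omega> \<le> ennreal ((1/2) ^ Suc k) * emeasure lebesgue (cube a l) \<and>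
      (\<integral>\<^sup>+x\<in>cube a l - \<Omega>. ennreal (\<bar>f x - avg f (cube a l)\<bar> powr p * w x) \<partial>lebesgue)
      \<le> ennreal (Y * (\<kappa> * l) powr p) * (\<integral>\<^sup>+x\<in>cube a l. G x \<partial>lebesgue)"
proof -
  have [measurable]: "f \<in> borel_measurable lebesgue" using f by (rule locally_integrable_measurable)
  define Q where "Q = cube a l"
  define c where "c = avg f Q"
  define \<Phi> where "\<Phi> = (\<integral>\<^sup>+x\<in>Q. G x \<partial>lebesgue)"
  define h where "h x = ennreal (\<bar>f x - c\<bar> powr p * w x)" for x
  have [measurable]: "h \<in> borel_measurable lebesgue" "Q \<in> sets lebesgue"
    unfolding h_def Q_def by measurable
  have Y: "0 < Y" by (simp add: Y_def self_improvement_const_def add_pos_pos)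
  have Qm: "emeasure lebesgue Q = ennreal (l ^ CARD('n))" using l by (simp add: Q_def emeasure_cube)
  have osc': "(\<integral>\<^sup>+x\<in>Q. ennreal \<bar>f x - c\<bar> \<partial>lebesgue) / emeasure lebesgue Q
      \<le> ennreal (\<kappa> * l) * ennpow (\<Phi> / wmeas w Q) (1 / p)"
    using osc[OF l, of a] by (simp add: Q_def c_def \<Phi>_def)
  have empty: ?thesis if "(\<integral>\<^sup>+x\<in>Q. h x \<partial>lebesgue) \<le> ennreal (Y * (\<kappa> * l) powr p) * \<Phi>"
    using that by (intro bexI[of _ "{}"]) (auto simp: Q_def c_def \<Phi>_def h_def)
  consider "\<Phi> = 0" | "\<Phi> = top" | "0 < \<Phi>" "\<Phi> < top"
    using less_top zero_less_iff_neq_zero by blast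
  then show ?thesis
  proof cases
    case 1
    \<comment> \<open>With \<open>\<Phi> = 0\<close> the oscillation vanishes and
      \<open>f = c\<close> a.e. on the cube. The case is separate because the stopping height below
      would be 0.\<close>
    then have "(\<integral>\<^sup>+x\<in>Q. ennreal \<bar>f x - c\<bar> \<partial>lebesgue) = 0"
      using osc' p Qm by (auto simp: ennreal_divide_eq_0_iff)
    then have "AE x in lebesgue. ennreal \<bar>f x - c\<bar> * indicator Q x = 0"
      by (subst (asm) nn_integral_0_iff_AE) auto
    then have "AE x in lebesgue. h x * indicator Q x = 0"
      by eventually_elim (auto simp: h_def indicator_def)
    then have "(\<integral>\<^sup>+x\<in>Q. h x \<partial>lebesgue) = 0"
      by (subst nn_integral_0_iff_AE) auto
    then show ?thesis by (intro empty) simp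
  next
    case 2
    have "0 < Y * (\<kappa> * l) powr p" using Y \<kappa> l by simp
    then show ?thesis using 2 by (intro empty) (simp add: ennreal_mult_top ennreal_eq_0_iff not_le)
  next
    case 3
    obtain F where F: "\<Phi> = ennreal F" "0 < F" using 3 by (cases \<Phi> rule: ennreal_cases3) auto
    obtain \<omega> where \<omega>: "wmeas w Q = ennreal \<omega>" "0 < \<omega>"
      using w[OF l, of a] by (cases "wmeas w Q" rule: ennreal_cases3) (auto simp: Q_def)
    \<comment> \<open>The given bound for the mean oscillation over \<open>Q\<close>. Its p-th power
      times the mass of \<open>Q\<close> is the target quantity without constant, so every term of
      the form (constant times A)^p w(Q) is harmless.\<close>
    define A where "A = \<kappa> * l * (F / \<omega>) powr (1 / p)"
    have A: "0 < A" using \<kappa> l F \<omega> by (simp add: A_def)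
    have Ap: "A powr p * \<omega> = (\<kappa> * l) powr p * F"
      using \<kappa> l F \<omega> p by (simp add: A_def powr_mult powr_powr)
    define u where "u x = ennreal \<bar>f x - c\<bar>" for x
    have [measurable]: "u \<in> borel_measurable lebesgue" unfolding u_def by measurable
    have uQ: "(\<integral>\<^sup>+x\<in>Q. u x \<partial>lebesgue) \<le> ennreal A * emeasure lebesgue Q"
    proof -
      have "(\<integral>\<^sup>+x\<in>Q. u x \<partial>lebesgue) / emeasure lebesgue Q \<le> ennreal A"
        using osc' F \<omega> \<kappa> l by (simp add: u_def A_def divide_ennreal ennpow_ennreal ennreal_mult)
      then have "(\<integral>\<^sup>+x\<in>Q. u x \<partial>lebesgue) / emeasure lebesgue Q * emeasure lebesgue Q
          \<le> ennreal A * emeasure lebesgue Q"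
        by (rule mult_right_mono) simp
      then show ?thesis
        unfolding Qm using l by (simp add: ennreal_divide_times ennreal_divide_self ennreal_eq_0_iff not_le)
    qed
    \<comment> \<open>A stopping cube satisfies t|D| \<le> A|Q|; the factor
      \<open>4 ^ CARD('n)\<close> thus forces its side below \<open>l / 4\<close>, and it also makes
      the total measure of the stopping cubes at most half of that of \<open>Q\<close>.\<close>
    define t where "t = 4 ^ CARD('n) * A"
    have t: "0 < t" "A \<le> t" using A by (auto simp: t_def)
    have CZ: "(\<integral>\<^sup>+x\<in>hcube a l. u x \<partial>lebesgue) \<le> ennreal t * emeasure lebesgue (hcube a l)"
      using uQ t unfolding nn_integral_hcube emeasure_hcube Q_def[symmetric]
      by (elim order_trans) (intro mult_right_mono ennreal_leI, auto)
    obtain S :: "((real ^ 'n) \<times> real) set" where S: "countable S"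
      "\<And>b s. (b, s) \<in> S \<Longrightarrow> 0 < s \<and> hcube b s \<subseteq> hcube a l"
      "disjoint_family_on (\<lambda>(b, s). hcube b s) S"
      "\<And>b s. (b, s) \<in> S \<Longrightarrow> ennreal t * emeasure lebesgue (hcube b s) \<le> (\<integral>\<^sup>+x\<in>hcube b s. u x \<partial>lebesgue)"
      "\<And>b s. (b, s) \<in> S \<Longrightarrow>
        (\<integral>\<^sup>+x\<in>hcube b s. u x \<partial>lebesgue) \<le> 2 ^ CARD('n) * ennreal t * emeasure lebesgue (hcube b s)"
      "AE x in lebesgue. x \<in> hcube a l \<longrightarrow> x \<notin> (\<Union>(b, s)\<in>S. hcube b s) \<longrightarrow> u x \<le> ennreal t"
      using Calderon_Zygmund[OF l _ _ CZ] by auto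
    define D where "D P = hcube (fst P) (snd P)" for P :: "(real ^ 'n) \<times> real"
    have Dm [measurable]: "D P \<in> sets lebesgue" for P by (simp add: D_def)
    have SD: "0 < snd P" "D P \<subseteq> hcube a l" "D P \<subseteq> Q"
      "ennreal t * emeasure lebesgue (D P) \<le> (\<integral>\<^sup>+x\<in>D P. u x \<partial>lebesgue)"
      "(\<integral>\<^sup>+x\<in>D P. u x \<partial>lebesgue) \<le> 2 ^ CARD('n) * ennreal t * emeasure lebesgue (D P)" if "P \<in> S" for P
      using S(2,4,5)[of "fst P" "snd P"] that hcube_subset_cube[of a l] by (auto simp: D_def Q_def)
    have Sdis: "disjoint_family_on D S"
      using S(3) by (simp add: D_def[abs_def] case_prod_unfold)
    have Dem: "emeasure lebesgue (D P) = ennreal (snd P ^ CARD('n))" if "P \<in> S" for P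
      using SD(1)[OF that] by (simp add: D_def emeasure_hcube emeasure_cube)
    have small: "snd P \<le> l / 4" if "P \<in> S" for P
    proof -
      have "ennreal t * emeasure lebesgue (D P) \<le> (\<integral>\<^sup>+x\<in>Q. u x \<partial>lebesgue)"
        using SD(3)[OF that]
        by (intro order_trans[OF SD(4)[OF that]] nn_integral_mono) (auto simp: indicator_def)
      also have "\<dots> \<le> ennreal A * emeasure lebesgue Q" by (rule uQ)
      finally have "t * snd P ^ CARD('n) \<le> A * l ^ CARD('n)"
        unfolding Dem[OF that] Qm using t A l SD(1)[OF that]
        by (simp flip: ennreal_mult) 
      then have "(4 * snd P) ^ CARD('n) \<le> l ^ CARD('n)"
        using A by (simp add: t_def power_mult_distrib)
      then have "4 * snd P \<le> l"
        using l SD(1)[OF that] by (subst (asm) power_mono_iff) auto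
      then show ?thesis by simp
    qed
    have total: "(\<integral>\<^sup>+P. emeasure lebesgue (D P) \<partial>count_space S) \<le> ennreal (1 / 2) * emeasure lebesgue Q"
    proof -
      have "ennreal t * (\<integral>\<^sup>+P. emeasure lebesgue (D P) \<partial>count_space S)
          = (\<integral>\<^sup>+P. ennreal t * emeasure lebesgue (D P) \<partial>count_space S)"
        by (simp add: nn_integral_cmult)
      also have "\<dots> \<le> (\<integral>\<^sup>+P. (\<integral>\<^sup>+x\<in>D P. u x \<partial>lebesgue) \<partial>count_space S)"
        by (intro nn_integral_mono) (auto intro: SD(4))
      also have "\<dots> \<le> (\<integral>\<^sup>+x\<in>Q. u x \<partial>lebesgue)"
        using SD(3) by (intro nn_integral_disjoint_le S(1) Sdis) auto
      also have "\<dots> \<le> ennreal A * emeasure lebesgue Q" by (rule uQ)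
      also have "\<dots> \<le> ennreal (t / 2) * emeasure lebesgue Q"
      proof (intro mult_right_mono ennreal_leI)
        have "(2::real) \<le> 4 ^ CARD('n)"
          using self_le_power[of "4::real" "CARD('n)"] by simp
        then have "2 * A \<le> 4 ^ CARD('n) * A" using A by (intro mult_right_mono) auto
        then show "A \<le> t / 2" by (simp add: t_def)
      qed simp
      finally have "ennreal (1 / t) * (ennreal t * (\<integral>\<^sup>+P. emeasure lebesgue (D P) \<partial>count_space S))
          \<le> ennreal (1 / t) * (ennreal (t / 2) * emeasure lebesgue Q)"
        by (rule mult_left_mono) simp
      moreover have "ennreal (1 / t) * ennreal t = 1" "ennreal (1 / t) * ennreal (t / 2) = ennreal (1 / 2)"
        using t by (simp_all flip: ennreal_mult)
      ultimately show ?thesis by (simp only: mult.assoc[symmetric] mult_1)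
    qed
    \<comment> \<open>The upper mean bound on stopping cubes, \<open>2 ^ CARD('n) * t\<close>; it
      controls how far the average jumps from \<open>Q\<close> to such a cube.\<close>
    define B where "B = 8 ^ CARD('n) * A"
    have Bt: "B = 2 ^ CARD('n) * t"
      using power_mult_distrib[of "2::real" 4 "CARD('n)"] by (simp add: B_def t_def)
    have B: "0 < B" using A by (simp add: B_def)
    define fD where "fD P = avg f (cube (fst P) (snd P))" for P :: "(real ^ 'n) \<times> real"
    have fD: "\<bar>fD P - c\<bar> \<le> B" if P: "P \<in> S" for P
    proof -
      have "ennreal \<bar>fD P - c\<bar> * emeasure lebesgue (D P) \<le> (\<integral>\<^sup>+x\<in>D P. u x \<partial>lebesgue)"
        using avg_diff_le[OF f SD(1)[OF P], of "fst P" c]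
        by (simp add: fD_def D_def emeasure_hcube nn_integral_hcube u_def)
      also have "\<dots> \<le> 2 ^ CARD('n) * ennreal t * emeasure lebesgue (D P)" by (rule SD(5)[OF P])
      also have "2 ^ CARD('n) * ennreal t = ennreal B"
      proof -
        have "ennreal (2 ^ CARD('n)) = 2 ^ CARD('n)"
          using ennreal_power[of 2 "CARD('n)"] by simp
        then show ?thesis using t by (simp add: Bt ennreal_mult)
      qed
      finally have "\<bar>fD P - c\<bar> * snd P ^ CARD('n) \<le> B * snd P ^ CARD('n)"
        unfolding Dem[OF P] using B SD(1)[OF P] by (simp flip: ennreal_mult)
      then show ?thesis using SD(1)[OF P] by simp
    qed
    define good where "good P \<Omega> \<longleftrightarrow> \<Omega> \<in> sets lebesgue \<and>
      emeasure lebesgue \<Omega> \<le> ennreal ((1/2) ^ k) * emeasure lebesgue (D P) \<and>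
      (\<integral>\<^sup>+x\<in>D P - \<Omega>. ennreal (\<bar>f x - fD P\<bar> powr p * w x) \<partial>lebesgue)
      \<le> ennreal (Y * (\<kappa> * snd P) powr p) * (\<integral>\<^sup>+x\<in>D P. G x \<partial>lebesgue)" for P \<Omega>
    have "\<exists>\<Omega>. good P \<Omega>" if P: "P \<in> S" for P
    proof -
      obtain \<Omega> where \<Omega>: "\<Omega> \<in> sets lebesgue"
        "emeasure lebesgue \<Omega> \<le> ennreal ((1/2) ^ k) * emeasure lebesgue (cube (fst P) (snd P))"
        "(\<integral>\<^sup>+x\<in>cube (fst P) (snd P) - \<Omega>. ennreal (\<bar>f x - fD P\<bar> powr p * w x) \<partial>lebesgue)
          \<le> ennreal (Y * (\<kappa> * snd P) powr p) * (\<integral>\<^sup>+x\<in>cube (fst P) (snd P). G x \<partial>lebesgue)"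
        using IH[OF SD(1)[OF P], of "fst P"] unfolding fD_def by blast
      have "(\<integral>\<^sup>+x\<in>D P - \<Omega>. ennreal (\<bar>f x - fD P\<bar> powr p * w x) \<partial>lebesgue)
          \<le> (\<integral>\<^sup>+x\<in>cube (fst P) (snd P) - \<Omega>. ennreal (\<bar>f x - fD P\<bar> powr p * w x) \<partial>lebesgue)"
        using hcube_subset_cube[of "fst P" "snd P"]
        by (intro nn_integral_mono) (auto simp: D_def indicator_def)
      from order_trans[OF this \<Omega>(3)] have "good P \<Omega>"
        using \<Omega>(1,2) unfolding good_def D_def emeasure_hcube nn_integral_hcube by blast
      then show ?thesis by blast
    qed
    then have "\<forall>P\<in>S. \<exists>\<Omega>. good P \<Omega>" by blast
    from bchoice[OF this] obtain \<Omega>' where "\<forall>P\<in>S. good P (\<Omega>' P)" by blast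
    then have \<Omega>': "\<And>P. P \<in> S \<Longrightarrow> \<Omega>' P \<in> sets lebesgue"
      "\<And>P. P \<in> S \<Longrightarrow> emeasure lebesgue (\<Omega>' P) \<le> ennreal ((1/2) ^ k) * emeasure lebesgue (D P)"
      "\<And>P. P \<in> S \<Longrightarrow> (\<integral>\<^sup>+x\<in>D P - \<Omega>' P. ennreal (\<bar>f x - fD P\<bar> powr p * w x) \<partial>lebesgue)
        \<le> ennreal (Y * (\<kappa> * snd P) powr p) * (\<integral>\<^sup>+x\<in>D P. G x \<partial>lebesgue)"
      unfolding good_def by blast+
    \<comment> \<open>Intersecting with \<open>D P\<close> keeps the pieces disjoint. Each is at
      most the fraction 2^(-k) of its stopping cube, and these cubes fill at most half of
      \<open>Q\<close>.\<close>
    define \<Omega> where "\<Omega> = (\<Union>P\<in>S. \<Omega>' P \<inter> D P)"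
    have \<Omega>m [measurable]: "\<Omega> \<in> sets lebesgue"
      unfolding \<Omega>_def using S(1) \<Omega>'(1) by (intro sets.countable_UN') auto
    have "emeasure lebesgue \<Omega> \<le> ennreal ((1/2) ^ Suc k) * emeasure lebesgue Q"
    proof -
      have "emeasure lebesgue \<Omega> = (\<integral>\<^sup>+P. emeasure lebesgue (\<Omega>' P \<inter> D P) \<partial>count_space S)"
      proof -
        have "disjoint_family_on (\<lambda>P. \<Omega>' P \<inter> D P) S"
          using Sdis unfolding disjoint_family_on_def by blast
        then show ?thesis
          unfolding \<Omega>_def using S(1) \<Omega>'(1) by (intro emeasure_UN_countable) auto
      qed
      also have "\<dots> \<le> (\<integral>\<^sup>+P. ennreal ((1/2) ^ k) * emeasure lebesgue (D P) \<partial>count_space S)"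
        by (intro nn_integral_mono order_trans[OF emeasure_mono \<Omega>'(2)]) (auto intro: \<Omega>'(1))
      also have "\<dots> \<le> ennreal ((1/2) ^ k) * (ennreal (1 / 2) * emeasure lebesgue Q)"
        unfolding nn_integral_cmult[OF borel_measurable_count_space] by (intro mult_left_mono total) simp
      also have "\<dots> = ennreal ((1/2) ^ Suc k) * emeasure lebesgue Q"
      proof -
        have "ennreal ((1/2) ^ Suc k) = ennreal ((1/2) ^ k) * ennreal (1 / 2)"
          by (subst ennreal_mult[symmetric]) auto
        then show ?thesis by (simp only: mult.assoc)
      qed
      finally show ?thesis .
    qed
    moreover have "(\<integral>\<^sup>+x\<in>Q - \<Omega>. h x \<partial>lebesgue) \<le> ennreal (Y * (\<kappa> * l) powr p) * \<Phi>"
    proof -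
      \<comment> \<open>The majorant on one stopping cube, from
        \<open>\<bar>f x - c\<bar> \<le> \<bar>f x - fD P\<bar> + B\<close> and the bound of (y+B)^p
        by 2^p (y^p + B^p). Only the first term must avoid the exceptional set; the jumps sum to at
        most a multiple of B^p w(Q).\<close>
      define e where "e P x = ennreal (2 powr p) *
        (ennreal (\<bar>f x - fD P\<bar> powr p * w x) * indicator (D P - \<Omega>' P) x +
         ennreal (B powr p) * (ennreal (w x) * indicator (D P) x))" for P x
      have em: "e P \<in> borel_measurable lebesgue" if "P \<in> S" for P
        using \<Omega>'(1)[OF that] unfolding e_def by measurable
      have "(\<integral>\<^sup>+x\<in>Q - \<Omega>. h x \<partial>lebesgue) \<le> (\<integral>\<^sup>+x. ennreal (t powr p) * (ennreal (w x) * indicator Q x) +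
          (\<integral>\<^sup>+P. e P x \<partial>count_space S) \<partial>lebesgue)"
      proof (rule nn_integral_mono_AE, use S(6) AE_hcube_iff_cube[of a l] in eventually_elim)
        case (elim x)
        show ?case
        proof (cases "x \<in> Q - \<Omega>")
          case True
          show ?thesis
          proof (cases "x \<in> (\<Union>(b, s)\<in>S. hcube b s)")
            case False
            then have "\<bar>f x - c\<bar> \<le> t"
              using elim True t by (auto simp: Q_def u_def)
            then have "h x \<le> ennreal (t powr p * w x)"
              unfolding h_def using p w0[of x] by (intro ennreal_leI mult_right_mono powr_mono2) auto
            also have "\<dots> = ennreal (t powr p) * (ennreal (w x) * indicator Q x)"
              using True w0[of x] by (simp add: ennreal_mult)
            finally show ?thesis using True by (auto intro: add_increasing2)
          next
            case inD: True
            then obtain P where P: "P \<in> S" "x \<in> D P" by (auto simp: D_def)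
            then have x\<Omega>: "x \<in> D P - \<Omega>' P" using True by (auto simp: \<Omega>_def)
            have "\<bar>f x - c\<bar> powr p \<le> 2 powr p * (\<bar>f x - fD P\<bar> powr p + B powr p)"
            proof -
              define y where "y = \<bar>f x - fD P\<bar>"
              have "\<bar>f x - c\<bar> \<le> y + B"
                using fD[OF P(1)] unfolding y_def by linarith
              also have "\<dots> \<le> 2 * max y B" by (simp add: max_def)
              finally have "\<bar>f x - c\<bar> \<le> 2 * max y B" .
              then have "\<bar>f x - c\<bar> powr p \<le> (2 * max y B) powr p"
                using p by (intro powr_mono2) auto
              also have "\<dots> = 2 powr p * max y B powr p" using B by (simp add: powr_mult)
              also have "\<dots> \<le> 2 powr p * (y powr p + B powr p)"
                by (intro mult_left_mono) (auto simp: max_def)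
              finally show ?thesis by (simp add: y_def)
            qed
            then have "h x \<le> ennreal (2 powr p * (\<bar>f x - fD P\<bar> powr p + B powr p) * w x)"
              unfolding h_def using w0[of x] by (intro ennreal_leI mult_right_mono) auto
            also have "\<dots> = e P x"
              using x\<Omega> w0[of x] unfolding e_def
              by (simp add: distrib_left distrib_right ennreal_mult ennreal_plus mult.assoc)
            also have "\<dots> \<le> (\<integral>\<^sup>+P. e P x \<partial>count_space S)"
              using nn_integral_ge_point[of P S "\<lambda>P. e P x"] P(1) by simp
            finally show ?thesis using True by (auto intro: add_increasing)
          qed
        qed simp
      qed
      also have "\<dots> = ennreal (t powr p) * wmeas w Q + (\<integral>\<^sup>+x. (\<integral>\<^sup>+P. e P x \<partial>count_space S) \<partial>lebesgue)"
      proof -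
        have "(\<lambda>x. \<integral>\<^sup>+P. e P x \<partial>count_space S) \<in> borel_measurable lebesgue"
          using S(1) em by (rule borel_measurable_nn_integral_count_space)
        then show ?thesis
          by (subst nn_integral_add) (auto simp: wmeas_def nn_integral_cmult)
      qed
      also have "(\<integral>\<^sup>+x. (\<integral>\<^sup>+P. e P x \<partial>count_space S) \<partial>lebesgue) = (\<integral>\<^sup>+P. (\<integral>\<^sup>+x. e P x \<partial>lebesgue) \<partial>count_space S)"
        using S(1) em by (rule nn_integral_count_space_nn_integral)
      also have "\<dots> \<le> (\<integral>\<^sup>+P. ennreal (Y / 2 * (\<kappa> * l) powr p) * (\<integral>\<^sup>+x\<in>D P. G x \<partial>lebesgue) +
          ennreal (2 powr p * B powr p) * (\<integral>\<^sup>+x\<in>D P. ennreal (w x) \<partial>lebesgue) \<partial>count_space S)"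
      proof (rule nn_integral_mono)
        fix P assume "P \<in> space (count_space S)"
        then have P: "P \<in> S" by simp
        have [measurable]: "\<Omega>' P \<in> sets lebesgue" by (rule \<Omega>'(1)[OF P])
        have "(\<integral>\<^sup>+x. e P x \<partial>lebesgue) = ennreal (2 powr p) *
            ((\<integral>\<^sup>+x\<in>D P - \<Omega>' P. ennreal (\<bar>f x - fD P\<bar> powr p * w x) \<partial>lebesgue) +
             ennreal (B powr p) * (\<integral>\<^sup>+x\<in>D P. ennreal (w x) \<partial>lebesgue))"
          unfolding e_def by (simp add: nn_integral_cmult nn_integral_add)
        also have "\<dots> \<le> ennreal (2 powr p) * (ennreal (Y * (\<kappa> * snd P) powr p) * (\<integral>\<^sup>+x\<in>D P. G x \<partial>lebesgue) +
             ennreal (B powr p) * (\<integral>\<^sup>+x\<in>D P. ennreal (w x) \<partial>lebesgue))"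
          by (intro mult_left_mono add_right_mono \<Omega>'(3)[OF P]) simp
        also have "\<dots> = ennreal (2 powr p * (Y * (\<kappa> * snd P) powr p)) * (\<integral>\<^sup>+x\<in>D P. G x \<partial>lebesgue) +
             ennreal (2 powr p * B powr p) * (\<integral>\<^sup>+x\<in>D P. ennreal (w x) \<partial>lebesgue)"
          using Y by (simp add: distrib_left ennreal_mult mult.assoc)
        also have "\<dots> \<le> ennreal (Y / 2 * (\<kappa> * l) powr p) * (\<integral>\<^sup>+x\<in>D P. G x \<partial>lebesgue) +
             ennreal (2 powr p * B powr p) * (\<integral>\<^sup>+x\<in>D P. ennreal (w x) \<partial>lebesgue)"
        proof (intro add_right_mono mult_right_mono ennreal_leI)
          \<comment> \<open>The quarter side beats the triangle inequality: 2^p 4^(-p) = 2^(-p),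
            which is at most 1/2 because \<open>p > 1\<close>.\<close>
          have "(\<kappa> * snd P) powr p \<le> (\<kappa> * l / 4) powr p"
            using small[OF P] SD(1)[OF P] \<kappa> p by (intro powr_mono2) auto
          also have "\<dots> = (\<kappa> * l) powr p / 4 powr p"
            using \<kappa> l by (intro powr_divide) 
          finally have "2 powr p * (\<kappa> * snd P) powr p \<le> 2 powr p * ((\<kappa> * l) powr p / 4 powr p)"
            by (rule mult_left_mono) simp
          also have "\<dots> = (\<kappa> * l) powr p / 2 powr p"
            using powr_mult[of 2 2 p] by simp
          also have "\<dots> \<le> (\<kappa> * l) powr p / 2"
            using p powr_mono[of 1 p 2] by (intro divide_left_mono) auto
          finally have "Y * (2 powr p * (\<kappa> * snd P) powr p) \<le> Y * ((\<kappa> * l) powr p / 2)"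
            using Y by (intro mult_left_mono) auto
          then show "2 powr p * (Y * (\<kappa> * snd P) powr p) \<le> Y / 2 * (\<kappa> * l) powr p"
            by (simp add: mult_ac)
        qed simp
        finally show "(\<integral>\<^sup>+x. e P x \<partial>lebesgue) \<le> \<dots>" .
      qed
      also have "\<dots> = ennreal (Y / 2 * (\<kappa> * l) powr p) * (\<integral>\<^sup>+P. (\<integral>\<^sup>+x\<in>D P. G x \<partial>lebesgue) \<partial>count_space S) +
          ennreal (2 powr p * B powr p) * (\<integral>\<^sup>+P. (\<integral>\<^sup>+x\<in>D P. ennreal (w x) \<partial>lebesgue) \<partial>count_space S)"
        by (simp add: nn_integral_add nn_integral_cmult)
      also have "\<dots> \<le> ennreal (Y / 2 * (\<kappa> * l) powr p) * \<Phi> + ennreal (2 powr p * B powr p) * wmeas w Q"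
        unfolding \<Phi>_def wmeas_def
        by (intro add_mono mult_left_mono nn_integral_disjoint_le S(1) Sdis SD(3)) auto
      finally have "(\<integral>\<^sup>+x\<in>Q - \<Omega>. h x \<partial>lebesgue) \<le> ennreal (t powr p) * wmeas w Q +
          (ennreal (Y / 2 * (\<kappa> * l) powr p) * \<Phi> + ennreal (2 powr p * B powr p) * wmeas w Q)"
        by (simp add: add_left_mono)
      also have "\<dots> = ennreal (t powr p * \<omega> + (Y / 2 * (\<kappa> * l) powr p * F + 2 powr p * B powr p * \<omega>))"
        unfolding F(1) \<omega>(1) using F(2) \<omega>(2) Y by (simp flip: ennreal_mult ennreal_plus)
      also have "t powr p * \<omega> + (Y / 2 * (\<kappa> * l) powr p * F + 2 powr p * B powr p * \<omega>)
          = Y * (\<kappa> * l) powr p * F"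
      proof -
        have "t powr p * \<omega> = (4 ^ CARD('n)) powr p * ((\<kappa> * l) powr p * F)"
          by (subst Ap[symmetric]) (simp add: t_def powr_mult)
        moreover have "B powr p * \<omega> = (8 ^ CARD('n)) powr p * ((\<kappa> * l) powr p * F)"
          by (subst Ap[symmetric]) (simp add: B_def powr_mult)
        ultimately show ?thesis
          unfolding mult.assoc by (simp add: Y_def self_improvement_const_def algebra_simps)
      qed
      also have "ennreal \<dots> = ennreal (Y * (\<kappa> * l) powr p) * \<Phi>"
        using F Y by (simp add: ennreal_mult)
      finally show ?thesis .
    qed
    ultimately show ?thesis
      by (intro bexI[of _ \<Omega>]) (auto simp: Q_def c_def h_def \<Phi>_def)
  qed
qed

text \<open>The generations give bounds off sets of measure at most 2^(-k)|Q| with one constant. By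
  Borel-Cantelli almost every point lies in only finitely many of these sets, so Fatou's lemma gives
  the bound on the whole cube.\<close>

lemma self_improvement:
  fixes f w :: "real ^ 'n \<Rightarrow> real" and G :: "real ^ 'n \<Rightarrow> ennreal"
  assumes p: "1 < p" and f: "locally_integrable f" and w0: "\<And>x. 0 \<le> w x"
    and wm [measurable]: "w \<in> borel_measurable lebesgue" and Gm: "G \<in> borel_measurable lebesgue"
    and w: "\<And>a l. 0 < l \<Longrightarrow> wmeas w (cube a l) \<in> {0<..<top}" and \<kappa>: "0 < \<kappa>"
    and osc: "\<And>a l. 0 < l \<Longrightarrow>
      (\<integral>\<^sup>+x\<in>cube a l. ennreal \<bar>f x - avg f (cube a l)\<bar> \<partial>lebesgue) / emeasure lebesgue (cube a l)
      \<le> ennreal (\<kappa> * l) * ennpow ((\<integral>\<^sup>+x\<in>cube a l. G x \<partial>lebesgue) / wmeas w (cube a l)) (1 / p)"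
    and l: "0 < l"
  shows "(\<integral>\<^sup>+x\<in>cube a l. ennreal (\<bar>f x - avg f (cube a l)\<bar> powr p * w x) \<partial>lebesgue)
      \<le> ennreal (self_improvement_const TYPE('n) p * (\<kappa> * l) powr p) * (\<integral>\<^sup>+x\<in>cube a l. G x \<partial>lebesgue)"
proof -
  have [measurable]: "f \<in> borel_measurable lebesgue" using f by (rule locally_integrable_measurable)
  define Y where "Y = self_improvement_const TYPE('n) p"
  define good where "good k a l \<Omega> \<longleftrightarrow> \<Omega> \<in> sets lebesgue \<and>
      emeasure lebesgue \<Omega> \<le> ennreal ((1/2) ^ k) * emeasure lebesgue (cube a l) \<and>
      (\<integral>\<^sup>+x\<in>cube a l - \<Omega>. ennreal (\<bar>f x - avg f (cube a l)\<bar> powr p * w x) \<partial>lebesgue)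
      \<le> ennreal (Y * (\<kappa> * l) powr p) * (\<integral>\<^sup>+x\<in>cube a l. G x \<partial>lebesgue)" for k :: nat and a l \<Omega>
  have ex: "\<exists>\<Omega>. good k a l \<Omega>" if "0 < l" for k a l
    using that
  proof (induction k arbitrary: a l)
    case 0
    \<comment> \<open>At generation 0 the exceptional set is the whole cube and the integral is over
      the empty set, so the induction starts without any information on \<open>f\<close>.\<close>
    have "good 0 a l (cube a l)" by (simp add: good_def)
    then show ?case by blast
  next
    case (Suc k)
    have "\<exists>\<Omega>\<in>sets lebesgue.
      emeasure lebesgue \<Omega> \<le> ennreal ((1/2) ^ k) * emeasure lebesgue (cube b s) \<and>
      (\<integral>\<^sup>+x\<in>cube b s - \<Omega>. ennreal (\<bar>f x - avg f (cube b s)\<bar> powr p * w x) \<partial>lebesgue)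
      \<le> ennreal (Y * (\<kappa> * s) powr p) * (\<integral>\<^sup>+x\<in>cube b s. G x \<partial>lebesgue)" if "0 < s" for b s
      using Suc.IH[OF that, of b] unfolding good_def by blast
    from self_improvement_step[OF p f w0 wm Gm w \<kappa> osc this[unfolded Y_def] Suc.prems]
    show ?case unfolding good_def Y_def by blast
  qed
  define Q where "Q = cube a l"
  define h where "h x = ennreal (\<bar>f x - avg f Q\<bar> powr p * w x)" for x
  have [measurable]: "h \<in> borel_measurable lebesgue" "Q \<in> sets lebesgue"
    unfolding h_def Q_def by measurable
  define B where "B = ennreal (Y * (\<kappa> * l) powr p) * (\<integral>\<^sup>+x\<in>Q. G x \<partial>lebesgue)"
  have "\<forall>k. \<exists>\<Omega>. good k a l \<Omega>" using ex[OF l] by blast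
  from choice[OF this] obtain \<Omega> where "\<forall>k. good k a l (\<Omega> k)" by blast
  then have \<Omega> [measurable]: "\<And>k. \<Omega> k \<in> sets lebesgue"
    and \<Omega>m: "\<And>k. emeasure lebesgue (\<Omega> k) \<le> ennreal ((1/2) ^ k) * emeasure lebesgue Q"
    and \<Omega>i: "\<And>k. (\<integral>\<^sup>+x\<in>Q - \<Omega> k. h x \<partial>lebesgue) \<le> B"
    unfolding good_def Q_def h_def B_def by blast+
  have \<Omega>m': "emeasure lebesgue (\<Omega> k) \<le> ennreal ((1/2) ^ k * l ^ CARD('n))" for k
    using \<Omega>m[of k] l by (simp add: Q_def emeasure_cube ennreal_mult)
  have "AE x in lebesgue. eventually (\<lambda>k. x \<in> space lebesgue - \<Omega> k) sequentially"
  proof (rule borel_cantelli_AE1)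
    show fin: "emeasure lebesgue (\<Omega> k) < \<infinity>" for k
      using \<Omega>m'[of k] by (auto intro: le_less_trans)
    have "measure lebesgue (\<Omega> k) \<le> (1/2) ^ k * l ^ CARD('n)" for k
      unfolding measure_def using \<Omega>m'[of k] l by (intro enn2real_leI) auto
    then show "summable (\<lambda>k. measure lebesgue (\<Omega> k))"
      by (intro summable_comparison_test'[OF summable_mult2[OF summable_geometric[of "1/2::real"]]]) auto
  qed auto
  then have "AE x in lebesgue. h x * indicator Q x \<le> liminf (\<lambda>k. h x * indicator (Q - \<Omega> k) x)"
  proof eventually_elim
    case (elim x)
    then have "\<forall>\<^sub>F k in sequentially. h x * indicator (Q - \<Omega> k) x = h x * indicator Q x"
      by eventually_elim (auto simp: indicator_def)
    then have "(\<lambda>k. h x * indicator (Q - \<Omega> k) x) \<longlonglongrightarrow> h x * indicator Q x"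
      by (rule tendsto_eventually)
    then show ?case by (simp add: lim_imp_Liminf)
  qed
  then have "(\<integral>\<^sup>+x\<in>Q. h x \<partial>lebesgue) \<le> (\<integral>\<^sup>+x. liminf (\<lambda>k. h x * indicator (Q - \<Omega> k) x) \<partial>lebesgue)"
    by (rule nn_integral_mono_AE)
  also have "\<dots> \<le> liminf (\<lambda>k. \<integral>\<^sup>+x\<in>Q - \<Omega> k. h x \<partial>lebesgue)"
    by (rule nn_integral_liminf) measurable
  also have "\<dots> \<le> liminf (\<lambda>k::nat. B)"
    by (intro Liminf_mono always_eventually allI \<Omega>i)
  also have "\<dots> = B" by (simp add: Liminf_const)
  finally show ?thesis by (simp add: h_def Q_def B_def Y_def)
qed

section \<open>Extrapolation on all cubes, followed by self-improvement for the fixed weight\<close>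

theorem corollary1p11:
  fixes p p0 :: real
  assumes "1 < p" and "p < p0"
  shows "\<exists>c C :: real. 0 < c \<and> 1 \<le> C \<and>
    (\<forall>(\<phi> :: real \<Rightarrow> real) (f :: real ^ 'n \<Rightarrow> real) (g :: real ^ 'n \<Rightarrow> ennreal).
      mono_on {1..} \<phi> \<longrightarrow> (\<forall>t\<ge>1. 0 < \<phi> t) \<longrightarrow>
      locally_integrable f \<longrightarrow> g \<in> borel_measurable lebesgue \<longrightarrow>
      (\<forall>w\<in>Ap p0. \<forall>a l. 0 < l \<longrightarrow>
        (\<integral>\<^sup>+x\<in>cube a l. ennreal \<bar>f x - avg f (cube a l)\<bar> \<partial>lebesgue) / emeasure lebesgue (cube a l)
        \<le> ennreal (\<phi> (enn2real (Ap_const p0 w)) * l) *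
           ennpow ((\<integral>\<^sup>+x\<in>cube a l. ennpow (g x) p0 * ennreal (w x) \<partial>lebesgue) / wmeas w (cube a l))
             (1 / p0)) \<longrightarrow>
      (\<forall>w\<in>Ap p. \<forall>a l. 0 < l \<longrightarrow>
        ennpow ((\<integral>\<^sup>+x\<in>cube a l. ennreal (\<bar>f x - avg f (cube a l)\<bar> powr p * w x) \<partial>lebesgue)
                  / wmeas w (cube a l)) (1 / p)
        \<le> ennreal (c * \<phi> (C * enn2real (Ap_const p w) powr ((p0 - 1) / (p - 1))) * l) *
           ennpow ((\<integral>\<^sup>+x\<in>cube a l. ennpow (g x) p * ennreal (w x) \<partial>lebesgue) / wmeas w (cube a l))
             (1 / p)))"
proof -
  define c1 where "c1 = 2 powr ((p + 1) * (1 / p - 1 / p0))"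
  define Y where "Y = self_improvement_const TYPE('n) p"
  define C where "C = extrapol_const TYPE('n) p p0"
  have c1: "0 < c1" by (simp add: c1_def)
  have Y: "0 < Y" by (simp add: Y_def self_improvement_const_def add_pos_pos)
  have C: "1 \<le> C" by (simp add: C_def extrapol_const_def)
  show ?thesis
  \<comment> \<open>\<open>c1\<close> is the loss in extrapolation; \<open>Y\<close> is the loss in
    self-improvement, of which a p-th root is taken at the end.\<close>
  proof (rule exI[of _ "Y powr (1 / p) * c1"], rule exI[of _ C], intro conjI allI impI ballI)
    fix \<phi> :: "real \<Rightarrow> real" and f :: "real ^ 'n \<Rightarrow> real" and g :: "real ^ 'n \<Rightarrow> ennreal"
      and w :: "real ^ 'n \<Rightarrow> real" and a :: "real ^ 'n" and l :: real
    assume \<phi>: "mono_on {1..} \<phi>" "\<forall>t\<ge>1. 0 < \<phi> t" and f: "locally_integrable f"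
      and g [measurable]: "g \<in> borel_measurable lebesgue"
      and hyp: "\<forall>w\<in>Ap p0. \<forall>a l. 0 < l \<longrightarrow>
        (\<integral>\<^sup>+x\<in>cube a l. ennreal \<bar>f x - avg f (cube a l)\<bar> \<partial>lebesgue) / emeasure lebesgue (cube a l)
        \<le> ennreal (\<phi> (enn2real (Ap_const p0 w)) * l) *
           ennpow ((\<integral>\<^sup>+x\<in>cube a l. ennpow (g x) p0 * ennreal (w x) \<partial>lebesgue) / wmeas w (cube a l)) (1 / p0)"
      and w: "w \<in> Ap p" and l: "0 < l"
    have [measurable]: "w \<in> borel_measurable lebesgue" using w by (rule Ap_measurable)
    define t where "t = C * enn2real (Ap_const p w) powr ((p0 - 1) / (p - 1))"
    have t: "1 \<le> t"
    proof -
      have "1 \<le> Ap_const p w" "Ap_const p w < top" by (rule Ap_const_bounds[OF assms(1) w])+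
      then have "1 \<le> enn2real (Ap_const p w)" by (cases "Ap_const p w" rule: ennreal_cases3) auto
      then have "1 \<le> enn2real (Ap_const p w) powr ((p0 - 1) / (p - 1))"
        using assms by (intro ge_one_powr_ge_zero) auto
      then show ?thesis unfolding t_def using C mult_mono[of 1 C 1] by fastforce
    qed
    \<comment> \<open>Depends on \<open>w\<close> but not on the cube, so a single
      \<open>\<kappa>\<close> serves all subcubes in the iteration.\<close>
    define \<kappa> where "\<kappa> = c1 * \<phi> t"
    have \<kappa>: "0 < \<kappa>" using c1 \<phi>(2) t by (simp add: \<kappa>_def)
    define G where "G x = ennpow (g x) p * ennreal (w x)" for x
    have [measurable]: "G \<in> borel_measurable lebesgue" unfolding G_def by measurable
    have wm: "wmeas w (cube b s) \<in> {0<..<top}" if "0 < s" for b s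
      using Ap_wmeas_pos[OF assms(1) w that] Ap_wmeas_finite[OF w] by simp
    have osc: "(\<integral>\<^sup>+x\<in>cube b s. ennreal \<bar>f x - avg f (cube b s)\<bar> \<partial>lebesgue) / emeasure lebesgue (cube b s)
        \<le> ennreal (\<kappa> * s) * ennpow ((\<integral>\<^sup>+x\<in>cube b s. G x \<partial>lebesgue) / wmeas w (cube b s)) (1 / p)"
      if s: "0 < s" for b s
    proof -
      \<comment> \<open>The side of the cube is moved into the monotone function, matching the form
        in which extrapolation was proved.\<close>
      have "mono_on {1..} (\<lambda>t. \<phi> t * s)"
        using \<phi>(1) s by (auto simp: mono_on_def intro!: mult_right_mono)
      moreover have "0 < \<phi> t * s" if "1 \<le> t" for t using \<phi>(2) that s by simp
      ultimately have "(\<integral>\<^sup>+x\<in>cube b s. ennreal \<bar>f x - avg f (cube b s)\<bar> \<partial>lebesgue) / emeasure lebesgue (cube b s)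
          \<le> ennreal (c1 * (\<phi> t * s)) *
            ennpow ((\<integral>\<^sup>+x\<in>cube b s. ennpow (g x) p * ennreal (w x) \<partial>lebesgue) / wmeas w (cube b s)) (1 / p)"
        unfolding c1_def t_def C_def
        by (rule Ap_extrapolation_cube[OF assms w s g]) (simp, rule hyp[rule_format, OF _ s])
      then show ?thesis by (simp add: \<kappa>_def G_def mult.assoc)
    qed
    let ?Q = "cube a l"
    obtain \<omega> where \<omega>: "wmeas w ?Q = ennreal \<omega>" "0 < \<omega>"
      using wm[OF l, of a] by (cases "wmeas w ?Q" rule: ennreal_cases3) auto
    have "(\<integral>\<^sup>+x\<in>?Q. ennreal (\<bar>f x - avg f ?Q\<bar> powr p * w x) \<partial>lebesgue)
        \<le> ennreal (Y * (\<kappa> * l) powr p) * (\<integral>\<^sup>+x\<in>?Q. G x \<partial>lebesgue)"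
      unfolding Y_def by (rule self_improvement[OF assms(1) f _ _ _ wm \<kappa> osc l]) (auto simp: Ap_nonneg[OF w])
    then have "(\<integral>\<^sup>+x\<in>?Q. ennreal (\<bar>f x - avg f ?Q\<bar> powr p * w x) \<partial>lebesgue) / wmeas w ?Q
        \<le> ennreal (Y * (\<kappa> * l) powr p) * (\<integral>\<^sup>+x\<in>?Q. G x \<partial>lebesgue) / wmeas w ?Q"
      by (rule divide_right_mono_ennreal)
    then have "ennpow ((\<integral>\<^sup>+x\<in>?Q. ennreal (\<bar>f x - avg f ?Q\<bar> powr p * w x) \<partial>lebesgue) / wmeas w ?Q) (1 / p)
        \<le> ennpow (ennreal (Y * (\<kappa> * l) powr p) * ((\<integral>\<^sup>+x\<in>?Q. G x \<partial>lebesgue) / wmeas w ?Q)) (1 / p)"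
      using assms by (intro ennpow_mono) (auto simp: ennreal_times_divide)
    also have "\<dots> = ennpow (ennreal (Y * (\<kappa> * l) powr p)) (1 / p) * ennpow ((\<integral>\<^sup>+x\<in>?Q. G x \<partial>lebesgue) / wmeas w ?Q) (1 / p)"
      using assms by (intro ennpow_mult) auto
    also have "ennpow (ennreal (Y * (\<kappa> * l) powr p)) (1 / p) = ennreal (Y powr (1 / p) * c1 * \<phi> t * l)"
    proof -
      have "0 < Y * (\<kappa> * l) powr p" using Y \<kappa> l by simp
      moreover have "(Y * (\<kappa> * l) powr p) powr (1 / p) = Y powr (1 / p) * (\<kappa> * l)"
        using \<kappa> l assms by (simp only: powr_mult powr_powr) (simp add: powr_mult[symmetric])
      ultimately show ?thesis by (simp only: ennpow_ennreal \<kappa>_def mult.assoc)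
    qed
    finally show "ennpow ((\<integral>\<^sup>+x\<in>?Q. ennreal (\<bar>f x - avg f ?Q\<bar> powr p * w x) \<partial>lebesgue) / wmeas w ?Q) (1 / p)
        \<le> ennreal (Y powr (1 / p) * c1 * \<phi> (C * enn2real (Ap_const p w) powr ((p0 - 1) / (p - 1))) * l) *
          ennpow ((\<integral>\<^sup>+x\<in>?Q. ennpow (g x) p * ennreal (w x) \<partial>lebesgue) / wmeas w ?Q) (1 / p)"
      by (simp add: t_def G_def)
  qed (use Y c1 C in auto)
qed

end
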